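(* Let $X$ be a Banach space and let $A:D(A)\subset X\to X$ and $B:D(B)\subset X\to X$ be closed, resolvent commuting linear operators. Assume that $A$ satisfies the weak Hille–Yosida property and the $L^p$-convolution estimate with exponent $p\in[1,\infty)$, that $B$ satisfies the analytic resolvent condition with exponent $p^*\in[1,\infty)$, and that $\frac1p+\frac1{p^*}>1$. Let $q^*\in(1,\infty]$ be defined by $\frac1{p^*}+\frac1{q^*}=1$ (so that $\frac1{q^*}<\frac1p$). Assume furthermore that: (i) there exists $\lambda_0\in\mathbb R$ such that for all $\lambda\ge\lambda_0$ the range $\mathrm R(\lambda-(A+B))$ is dense in $X$, where $A+B$ has domain $D(A)\cap D(B)$; (ii) the strongly continuous semigroup $\bigl\{T_{A_0}(t)_{|\overline{D(A)\cap D(B)}}\circ T_{B_0}(t)_{|\overline{D(A)\cap D(B)}}\bigr\}_{t\ge0}\subset\mathcal L(\overline{D(A)\cap D(B)})$ is analytic. Then $A+B$ is closable and its closure $\overline{A+B}:D(\overline{A+B})\subset X\to X$ satisfies the analytic resolvent condition with $\frac1{p^*}$ replaced by $\gamma$, for $\gamma\in\left(0,\frac1p-\frac1{q^*}\right)$. In particular, $\overline{A+B}$ is $\gamma$-almost sectorial for any $\gamma\in\left(0,\frac1p-\frac1{q^*}\right)$.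
   Context: Notation. For a linear operator $T$ on $X$: $\rho(T)$ is its resolvent set, $\mathrm R(T)=T(D(T))$ its range, and $T_0$ denotes the part of $T$ in $\overline{D(T)}$, i.e. the restriction of $T$ to $\{x\in D(T):Tx\in\overline{D(T)}\}$. $T$ is closable if it has a closed extension; $\overline T$ is then the smallest closed extension. Resolvent commuting: $(\lambda-A)^{-1}(\mu-B)^{-1}=(\mu-B)^{-1}(\lambda-A)^{-1}$ for all $\lambda,\mu\in\rho(A)\cap\rho(B)$. Weak Hille–Yosida property of $A$: (i) there exist $\omega_A\in\mathbb R$, $M_A\ge1$ with $(\omega_A,\infty)\subset\rho(A)$ and $\|(\lambda-A)^{-k}\|_{\mathcal L(\overline{D(A)})}\le M_A(\lambda-\omega_A)^{-k}$ for all $\lambda>\omega_A$, $k\ge1$; (ii) $(\lambda-A)^{-1}x\to0$ as $\lambda\to\infty$ for all $x\in X$. Under it, $A_0$ generates a strongly continuous semigroup $\{T_{A_0}(t)\}_{t\ge0}$ on $\overline{D(A)}$ and $A$ generates the integrated semigroup given, for any $\mu>\omega_A$, by $$S_A(t)x=\mu\int_0^tT_{A_0}(s)(\mu-A)^{-1}x\,ds+(\mu-A)^{-1}x-T_{A_0}(t)(\mu-A)^{-1}x .$$ Set $(S_A\ast f)(t)=\int_0^tS_A(s)f(t-s)\,ds$ and $(S_A\diamond f)(t)=\frac{d}{dt}(S_A\ast f)(t)$. $L^p$-convolution estimate for $A$: (with the same constants $M_A,\omega_A$, without loss of generality) for all $f\in L^p_{\rm loc}([0,\infty);X)$, $S_A\ast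 f$ is continuously differentiable and $\|(S_A\diamond f)(t)\|\le M_A\bigl(\int_0^te^{p\omega_A(t-s)}\|f(s)\|^p\,ds\bigr)^{1/p}$ for all $t\ge0$. Analytic resolvent condition for $B$ with exponent $p^*\in[1,\infty)$: (a) $B_0$ generates a strongly continuous analytic semigroup $\{T_{B_0}(t)\}_{t\ge0}$ on $\overline{D(B)}$; (b) there is $\omega_B\in\mathbb R$ with $(\omega_B,\infty)\subset\rho(B)$ and $\|(\lambda-B)^{-1}\|_{\mathcal L(X)}=\mathcal O(\lambda^{-1/p^*})$ as $\lambda\to\infty$. By resolvent commutativity, $T_{A_0}(t)$ and $T_{B_0}(t)$ leave $\overline{D(A)\cap D(B)}$ invariant and commute there, so the family in (ii) is a strongly continuous semigroup. $\gamma$-almost sectorial: an operator $T$ on $X$ is $\gamma$-almost sectorial if there exist $\omega\in\mathbb R$, $\theta\in(\frac\pi2,\pi)$, $M>0$ such that $\Sigma_{\omega,\theta}:=\{\lambda\in\mathbb C\setminus\{\omega\}:|\arg(\lambda-\omega)|<\theta\}\subset\rho(T)$ and $|\lambda-\omega|^{\gamma}\|(\lambda-T)^{-1}\|_{\mathcal L(X)}\le M$ for all $\lambda\in\Sigma_{\omega,\theta}$. *)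

theory Defs
  imports "HOL-Analysis.Analysis" "HOL-Library.Landau_Symbols"
begin

section \<open>Complex Banach spaces\<close>

text \<open>The distribution has only real Banach spaces; we add a compatible complex scalar
  multiplication, so that the real structure is the restriction of the complex one.\<close>

class complex_banach = banach +
  fixes scaleC :: "complex \<Rightarrow> 'a \<Rightarrow> 'a" (infixr \<open>*\<^sub>C\<close> 75)
  assumes scaleC_add_right: "a *\<^sub>C (x + y) = a *\<^sub>C x + a *\<^sub>C y"
    and scaleC_add_left: "(a + b) *\<^sub>C x = a *\<^sub>C x + b *\<^sub>C x"
    and scaleC_scaleC: "a *\<^sub>C (b *\<^sub>C x) = (a * b) *\<^sub>C x"
    and scaleC_of_real: "complex_of_real r *\<^sub>C x = r *\<^sub>R x"
    and norm_scaleC: "norm (a *\<^sub>C x) = cmod a * norm x"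

instantiation complex :: complex_banach
begin

definition scaleC_complex :: "complex \<Rightarrow> complex \<Rightarrow> complex"
  where "scaleC_complex a x = a * x"

instance
  by standard
    (auto simp: scaleC_complex_def algebra_simps norm_mult scaleR_conv_of_real)

end


section \<open>Unbounded linear operators\<close>

text \<open>A linear operator $T : D(T) \subset X \to X$ is represented by its graph, so that
  $D(T)$ is \<^term>\<open>Domain T\<close>, $R(T)$ is \<^term>\<open>Range T\<close> and extension is inclusion.\<close>

type_synonym 'x operator = "('x \<times> 'x) set"

definition linear_operator :: "('x::complex_banach) operator \<Rightarrow> bool" where
  "linear_operator T \<longleftrightarrow> single_valued T \<and> (0, 0) \<in> T \<and>
     (\<forall>x y x' y'. (x, y) \<in> T \<longrightarrow> (x', y') \<in> T \<longrightarrow> (x + x', y + y') \<in> T) \<and>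
     (\<forall>a x y. (x, y) \<in> T \<longrightarrow> (a *\<^sub>C x, a *\<^sub>C y) \<in> T)"

definition closed_operator :: "('x::complex_banach) operator \<Rightarrow> bool" where
  "closed_operator T \<longleftrightarrow> linear_operator T \<and> closed T"

definition closable :: "('x::complex_banach) operator \<Rightarrow> bool" where
  "closable T \<longleftrightarrow> (\<exists>S. closed_operator S \<and> T \<subseteq> S)"

text \<open>The smallest closed extension (meaningful for closable \<^term>\<open>T\<close>).\<close>

definition op_closure :: "('x::complex_banach) operator \<Rightarrow> 'x operator" where
  "op_closure T = \<Inter>{S. closed_operator S \<and> T \<subseteq> S}"

lemma op_closure_smallest_closed_extension:
  assumes "closable T"
  shows "closed_operator (op_closure T)" "T \<subseteq> op_closure T"
    and "closed_operator S \<Longrightarrow> T \<subseteq> S \<Longrightarrow> op_closure T \<subseteq> S"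
proof -
  obtain S0 where S0: "closed_operator S0" "T \<subseteq> S0"
    using assms unfolding closable_def by blast
  have sv: "single_valued (op_closure T)"
    using S0 single_valued_subset[of "op_closure T" S0]
    unfolding op_closure_def closed_operator_def linear_operator_def by blast
  have "closed (op_closure T)"
    unfolding op_closure_def closed_operator_def by (rule closed_Inter) auto
  with sv show "closed_operator (op_closure T)"
    unfolding closed_operator_def linear_operator_def
    by (simp add: op_closure_def closed_operator_def linear_operator_def)
qed (auto simp: op_closure_def)

definition op_sum :: "('x::complex_banach) operator \<Rightarrow> 'x operator \<Rightarrow> 'x operator" where
  "op_sum A B = {(x, y + z) | x y z. (x, y) \<in> A \<and> (x, z) \<in> B}"

text \<open>The operator $z - T$.\<close>

definition shifted :: "complex \<Rightarrow> ('x::complex_banach) operator \<Rightarrow> 'x operator" where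
  "shifted z T = {(x, z *\<^sub>C x - y) | x y. (x, y) \<in> T}"

definition resolvent :: "('x::complex_banach) operator \<Rightarrow> complex \<Rightarrow> 'x \<Rightarrow> 'x" where
  "resolvent T z x = (THE y. (y, x) \<in> shifted z T)"

definition resolvent_set :: "('x::complex_banach) operator \<Rightarrow> complex set" where
  "resolvent_set T =
     {z. (\<forall>x. \<exists>!y. (y, x) \<in> shifted z T) \<and> bounded_linear (resolvent T z)}"

text \<open>The part of \<^term>\<open>T\<close> in the closure of its domain.\<close>

definition op_part :: "('x::complex_banach) operator \<Rightarrow> 'x operator" where
  "op_part T = {(x, y) \<in> T. y \<in> closure (Domain T)}"

definition resolvent_commuting :: "('x::complex_banach) operator \<Rightarrow> 'x operator \<Rightarrow> bool" where
  "resolvent_commuting A B \<longleftrightarrow>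
     (\<forall>z \<in> resolvent_set A \<inter> resolvent_set B. \<forall>w \<in> resolvent_set A \<inter> resolvent_set B. \<forall>x.
        resolvent A z (resolvent B w x) = resolvent B w (resolvent A z x))"


section \<open>Semigroups on a closed subspace\<close>

text \<open>An element of $\mathcal{L}(Y)$ for a closed subspace \<^term>\<open>Y\<close> is represented by a function
  on the whole space of which only the values on \<^term>\<open>Y\<close> matter.\<close>

definition bounded_operator_on :: "('x::complex_banach) set \<Rightarrow> ('x \<Rightarrow> 'x) \<Rightarrow> bool" where
  "bounded_operator_on Y F \<longleftrightarrow> F ` Y \<subseteq> Y \<and>
     (\<forall>x\<in>Y. \<forall>y\<in>Y. F (x + y) = F x + F y) \<and>
     (\<forall>a. \<forall>x\<in>Y. F (a *\<^sub>C x) = a *\<^sub>C F x) \<and>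
     (\<exists>C. \<forall>x\<in>Y. norm (F x) \<le> C * norm x)"

definition c0_semigroup :: "('x::complex_banach) set \<Rightarrow> (real \<Rightarrow> 'x \<Rightarrow> 'x) \<Rightarrow> bool" where
  "c0_semigroup Y T \<longleftrightarrow>
     (\<forall>t\<ge>0. bounded_operator_on Y (T t)) \<and>
     (\<forall>x\<in>Y. T 0 x = x) \<and>
     (\<forall>s\<ge>0. \<forall>t\<ge>0. \<forall>x\<in>Y. T (s + t) x = T s (T t x)) \<and>
     (\<forall>x\<in>Y. continuous_on {0..} (\<lambda>t. T t x))"

definition generator :: "('x::complex_banach) set \<Rightarrow> (real \<Rightarrow> 'x \<Rightarrow> 'x) \<Rightarrow> 'x operator" where
  "generator Y T = {(x, y). x \<in> Y \<and> ((\<lambda>h. (T h x - x) /\<^sub>R h) \<longlongrightarrow> y) (at_right 0)}"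

definition part_generates :: "('x::complex_banach) operator \<Rightarrow> (real \<Rightarrow> 'x \<Rightarrow> 'x) \<Rightarrow> bool" where
  "part_generates A T \<longleftrightarrow>
     c0_semigroup (closure (Domain A)) T \<and> generator (closure (Domain A)) T = op_part A"

text \<open>The semigroup $T_{A_0}$. A generator determines its semigroup on \<^term>\<open>closure (Domain A)\<close>
  for nonnegative times; no other values are used.\<close>

definition part_semigroup :: "('x::complex_banach) operator \<Rightarrow> real \<Rightarrow> 'x \<Rightarrow> 'x" where
  "part_semigroup A = (SOME T. part_generates A T)"

definition sector :: "real \<Rightarrow> real \<Rightarrow> complex set" where
  "sector \<omega> \<theta> = {z. z \<noteq> complex_of_real \<omega> \<and> \<bar>Arg (z - complex_of_real \<omega>)\<bar> < \<theta>}"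

text \<open>Complex differentiability, in the norm of $\mathcal{L}(Y)$, of an operator-valued function.\<close>

definition operator_holomorphic_on ::
    "('x::complex_banach) set \<Rightarrow> (complex \<Rightarrow> 'x \<Rightarrow> 'x) \<Rightarrow> complex set \<Rightarrow> bool" where
  "operator_holomorphic_on Y U S \<longleftrightarrow>
     (\<forall>z\<in>S. \<exists>D. bounded_operator_on Y D \<and>
        (\<forall>\<epsilon>>0. \<forall>\<^sub>F w in at z. \<forall>x\<in>Y.
           norm (inverse (w - z) *\<^sub>C (U w x - U z x) - D x) \<le> \<epsilon> * norm x))"

text \<open>A strongly continuous semigroup is analytic if it extends to an analytic semigroup on some
  open sector around the positive half line. No boundedness on the sector is required.\<close>

definition analytic_semigroup :: "('x::complex_banach) set \<Rightarrow> (real \<Rightarrow> 'x \<Rightarrow> 'x) \<Rightarrow> bool" where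
  "analytic_semigroup Y T \<longleftrightarrow> c0_semigroup Y T \<and>
     (\<exists>\<delta> U. 0 < \<delta> \<and> \<delta> \<le> pi / 2 \<and>
        (\<forall>t\<ge>0. \<forall>x\<in>Y. U (complex_of_real t) x = T t x) \<and>
        (\<forall>z \<in> sector 0 \<delta>. bounded_operator_on Y (U z)) \<and>
        (\<forall>z \<in> sector 0 \<delta>. \<forall>w \<in> sector 0 \<delta>. \<forall>x\<in>Y. U (z + w) x = U z (U w x)) \<and>
        operator_holomorphic_on Y U (sector 0 \<delta>) \<and>
        (\<forall>\<delta>'. 0 < \<delta>' \<and> \<delta>' < \<delta> \<longrightarrow>
           (\<forall>x\<in>Y. ((\<lambda>z. U z x) \<longlongrightarrow> x) (at 0 within sector 0 \<delta>'))))"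


section \<open>The conditions on the operators\<close>

text \<open>The bound in $\mathcal{L}(\overline{D(A)})$ is spelled out pointwise.\<close>

definition weak_hille_yosida :: "('x::complex_banach) operator \<Rightarrow> real \<Rightarrow> real \<Rightarrow> bool" where
  "weak_hille_yosida A \<omega> M \<longleftrightarrow> M \<ge> 1 \<and>
     (\<forall>r>\<omega>. complex_of_real r \<in> resolvent_set A) \<and>
     (\<forall>r>\<omega>. \<forall>k\<ge>1. \<forall>x \<in> closure (Domain A).
        norm ((resolvent A (complex_of_real r) ^^ k) x) \<le> M / (r - \<omega>) ^ k * norm x) \<and>
     (\<forall>x. ((\<lambda>r. resolvent A (complex_of_real r) x) \<longlongrightarrow> 0) at_top)"

text \<open>The integrated semigroup $S_A$. For \<^term>\<open>A\<close> with the weak Hille--Yosida property it does not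
  depend on the choice of \<^term>\<open>\<mu>\<close> above the growth bound.\<close>

definition integrated_semigroup ::
    "('x::complex_banach) operator \<Rightarrow> real \<Rightarrow> real \<Rightarrow> 'x \<Rightarrow> 'x" where
  "integrated_semigroup A \<mu> t x =
     (let T = part_semigroup A; z = resolvent A (complex_of_real \<mu>) x
      in \<mu> *\<^sub>R integral {0..t} (\<lambda>s. T s z) + z - T t z)"

text \<open>\<^term>\<open>X\<close> need not be separable, so measurability is strong (Bochner) measurability.\<close>

definition strongly_measurable :: "(real \<Rightarrow> 'x::real_normed_vector) \<Rightarrow> bool" where
  "strongly_measurable f \<longleftrightarrow>
     (\<exists>g :: nat \<Rightarrow> real \<Rightarrow> 'x. (\<forall>n. simple_function (lebesgue_on {0..}) (g n)) \<and>
        (AE t in lebesgue_on {0..}. (\<lambda>n. g n t) \<longlonglongrightarrow> f t))"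

definition Lp_loc :: "real \<Rightarrow> (real \<Rightarrow> 'x::real_normed_vector) \<Rightarrow> bool" where
  "Lp_loc p f \<longleftrightarrow> strongly_measurable f \<and>
     (\<forall>\<tau>\<ge>0. set_integrable lebesgue {0..\<tau>} (\<lambda>s. norm (f s) powr p))"

text \<open>The library's Bochner integral is restricted to second countable spaces, so we use the
  Henstock--Kurzweil integral, which extends the Bochner integral. For a strongly continuous
  \<^term>\<open>S\<close> and \<^term>\<open>f\<close> in $L^p_{loc}$ the integrand is Bochner integrable, so the two agree.\<close>

definition convolution ::
    "(real \<Rightarrow> 'x \<Rightarrow> 'x) \<Rightarrow> (real \<Rightarrow> 'x) \<Rightarrow> real \<Rightarrow> 'x::complex_banach" where
  "convolution S f t = integral {0..t} (\<lambda>s. S s (f (t - s)))"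

definition diamond ::
    "(real \<Rightarrow> 'x \<Rightarrow> 'x) \<Rightarrow> (real \<Rightarrow> 'x) \<Rightarrow> real \<Rightarrow> 'x::complex_banach" where
  "diamond S f t = vector_derivative (convolution S f) (at t within {0..})"

definition Lp_convolution_estimate ::
    "('x::complex_banach) operator \<Rightarrow> real \<Rightarrow> real \<Rightarrow> real \<Rightarrow> bool" where
  "Lp_convolution_estimate A \<omega> M p \<longleftrightarrow>
     (\<exists>\<mu>>\<omega>. let S = integrated_semigroup A \<mu> in
        \<forall>f. Lp_loc p f \<longrightarrow>
          (\<forall>t\<ge>0. convolution S f differentiable (at t within {0..})) \<and>
          continuous_on {0..} (diamond S f) \<and>
          (\<forall>t\<ge>0. norm (diamond S f t) \<le>
             M * (integral {0..t} (\<lambda>s. exp (p * \<omega> * (t - s)) * norm (f s) powr p)) powr (1 / p)))"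

text \<open>The analytic resolvent condition for the exponent $p^*$ is the case $\alpha = 1/p^*$.\<close>

definition analytic_resolvent_condition :: "('x::complex_banach) operator \<Rightarrow> real \<Rightarrow> bool" where
  "analytic_resolvent_condition B \<alpha> \<longleftrightarrow>
     (\<exists>T. part_generates B T \<and> analytic_semigroup (closure (Domain B)) T) \<and>
     (\<exists>\<omega>. (\<forall>r>\<omega>. complex_of_real r \<in> resolvent_set B) \<and>
        (\<lambda>r. onorm (resolvent B (complex_of_real r))) \<in> O[at_top](\<lambda>r. r powr (- \<alpha>)))"

definition almost_sectorial :: "real \<Rightarrow> ('x::complex_banach) operator \<Rightarrow> bool" where
  "almost_sectorial \<gamma> T \<longleftrightarrow>
     (\<exists>\<omega> \<theta> M. pi / 2 < \<theta> \<and> \<theta> < pi \<and> M > 0 \<and>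
        sector \<omega> \<theta> \<subseteq> resolvent_set T \<and>
        (\<forall>z \<in> sector \<omega> \<theta>.
           cmod (z - complex_of_real \<omega>) powr \<gamma> * onorm (resolvent T z) \<le> M))"

end

theory Submission
  imports Defs
begin

text \<open>Let \<open>T\<^sub>A\<close> and \<open>T\<^sub>B\<close> be the semigroups of the parts of \<open>A\<close> and \<open>B\<close>; the first exists by
  the Hille--Yosida theorem. Since \<open>T\<^sub>B\<close> is analytic, each \<open>T\<^sub>B(t)\<close> with \<open>t > 0\<close> extends to an
  operator \<open>E(t)\<close> on the whole space with \<open>\<parallel>E(t)\<parallel> = O(t\<^bsup>1/p* - 1\<^esup>)\<close> as \<open>t \<rightarrow> 0\<close>. For \<open>u\<close> in
  \<open>D(A) \<inter> D(B)\<close> and \<open>f = (r - A - B) u\<close>, the convolution of the integrated semigroup of \<open>A\<close> with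
  \<open>s \<mapsto> e\<^bsup>- r (\<tau> - s)\<^esup> E(\<tau> - s) f\<close> recovers \<open>u - e\<^bsup>- r \<tau>\<^esup> T\<^sub>A(\<tau>) T\<^sub>B(\<tau>) u\<close>, and the
  convolution estimate gives \<open>\<parallel>u\<parallel> \<le> K r\<^bsup>- \<gamma>\<^esup> \<parallel>f\<parallel>\<close> for large \<open>r\<close>. With the density of the ranges this
  puts large real \<open>r\<close> in the resolvent set of the closure \<open>C\<close> of \<open>A + B\<close>. The part of \<open>C\<close> is then
  the generator of \<open>T\<^sub>A T\<^sub>B\<close>, whose analyticity moves the estimate from the half line to a sector.\<close>

section \<open>Complex-linear operators on closed subspaces\<close>

text \<open>Neither domain need be dense, so T_B acts only on the closure of D(B), whereas f = (r -
  A - B) u is an unrestricted vector. The extension E(t) = (r_0 - B_0) T_B(t) (r_0 - B)^-1 bridges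
  this gap, but it is singular at t = 0, and the convolution estimate has to absorb the singularity.
  The horizon \<tau> is finite because E is controlled only near 0; the term left over at \<tau> is
  absorbed since e^(-r \<tau>) is small. The second obstacle is that A and B need not map D(A)
  \<inter> D(B) into its closure, so T_A T_B cannot be differentiated at an arbitrary point there.
  The injective product J = (\<mu> - A)^-1 (\<nu> - B)^-1 supplies enough points where it can. It
  also yields closability, and the approximations \<nu> (\<nu> - B)^-1 and \<mu> (\<mu> - A)^-1 of
  the identity remove J at the end.\<close>

lemma scaleC_scaleR: "a *\<^sub>C (r *\<^sub>R x) = r *\<^sub>R (a *\<^sub>C x)" for x :: "'x::complex_banach"
  by (metis mult.commute scaleC_of_real scaleC_scaleC)

lemma bounded_bilinear_scaleC: "bounded_bilinear (scaleC :: complex \<Rightarrow> 'x \<Rightarrow> 'x::complex_banach)"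
proof
  fix a a' :: complex and b b' :: 'x and r :: real
  show "(a + a') *\<^sub>C b = a *\<^sub>C b + a' *\<^sub>C b" "a *\<^sub>C (b + b') = a *\<^sub>C b + a *\<^sub>C b'"
    by (rule scaleC_add_left scaleC_add_right)+
  show "(r *\<^sub>R a) *\<^sub>C b = r *\<^sub>R a *\<^sub>C b"
    by (metis scaleC_of_real scaleC_scaleC scaleR_conv_of_real)
  show "a *\<^sub>C r *\<^sub>R b = r *\<^sub>R a *\<^sub>C b" by (rule scaleC_scaleR)
  show "\<exists>K. \<forall>a b. norm (a *\<^sub>C b :: 'x) \<le> norm a * norm b * K"
    by (rule exI[of _ 1]) (simp add: norm_scaleC)
qed

interpretation scaleC: bounded_bilinear "scaleC :: complex \<Rightarrow> 'x \<Rightarrow> 'x::complex_banach"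
  by (rule bounded_bilinear_scaleC)

lemma scaleC_one [simp]: "1 *\<^sub>C x = (x :: 'x::complex_banach)"
  using scaleC_of_real[of 1 x] by simp

lemma scaleC_cancel: "z *\<^sub>C x = z *\<^sub>C y \<longleftrightarrow> z = 0 \<or> x = (y :: 'x::complex_banach)"
proof -
  have "norm (z *\<^sub>C x - z *\<^sub>C y) = cmod z * norm (x - y)"
    by (metis norm_scaleC scaleC.diff_right)
  then show ?thesis by auto
qed

definition closed_csubspace :: "'x::complex_banach set \<Rightarrow> bool" where
  "closed_csubspace Y \<longleftrightarrow> closed Y \<and> 0 \<in> Y \<and> (\<forall>x\<in>Y. \<forall>y\<in>Y. x + y \<in> Y) \<and> (\<forall>a. \<forall>x\<in>Y. a *\<^sub>C x \<in> Y)"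

lemma closed_csubspaceD:
  assumes "closed_csubspace Y"
  shows "closed Y" "0 \<in> Y" "\<And>x y. x \<in> Y \<Longrightarrow> y \<in> Y \<Longrightarrow> x + y \<in> Y"
    "\<And>a x. x \<in> Y \<Longrightarrow> a *\<^sub>C x \<in> Y" "\<And>r x. x \<in> Y \<Longrightarrow> r *\<^sub>R x \<in> Y"
    "\<And>x. x \<in> Y \<Longrightarrow> - x \<in> Y" "\<And>x y. x \<in> Y \<Longrightarrow> y \<in> Y \<Longrightarrow> x - y \<in> Y"
    "subspace Y"
proof -
  show 0: "closed Y" "0 \<in> Y" "\<And>x y. x \<in> Y \<Longrightarrow> y \<in> Y \<Longrightarrow> x + y \<in> Y"
    "\<And>a x. x \<in> Y \<Longrightarrow> a *\<^sub>C x \<in> Y" using assms by (auto simp: closed_csubspace_def)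
  show 1: "\<And>r x. x \<in> Y \<Longrightarrow> r *\<^sub>R x \<in> Y" by (metis 0(4) scaleC_of_real)
  show 2: "\<And>x. x \<in> Y \<Longrightarrow> - x \<in> Y" using 1[of _ "-1"] by simp
  show "\<And>x y. x \<in> Y \<Longrightarrow> y \<in> Y \<Longrightarrow> x - y \<in> Y" using 0(3) 2 by (metis diff_conv_add_uminus)
  show "subspace Y" using 0 1 by (simp add: subspace_def)
qed

lemma closed_csubspace_closure:
  fixes S :: "'x::complex_banach set"
  assumes "0 \<in> S" "\<And>x y. x \<in> S \<Longrightarrow> y \<in> S \<Longrightarrow> x + y \<in> S" "\<And>a x. x \<in> S \<Longrightarrow> a *\<^sub>C x \<in> S"
  shows "closed_csubspace (closure S)"
  unfolding closed_csubspace_def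
proof (intro conjI ballI allI)
  show "closed (closure S)" "0 \<in> closure S" using assms(1) closure_subset by auto
next
  fix x y assume "x \<in> closure S" "y \<in> closure S"
  then obtain f g where "\<And>n. f n \<in> S" "f \<longlonglongrightarrow> x" "\<And>n. g n \<in> S" "g \<longlonglongrightarrow> y"
    by (auto simp: closure_sequential)
  then show "x + y \<in> closure S"
    unfolding closure_sequential
    by (intro exI[of _ "\<lambda>n. f n + g n"]) (auto intro: assms tendsto_add)
next
  fix a x assume "x \<in> closure S"
  then obtain f where "\<And>n. f n \<in> S" "f \<longlonglongrightarrow> x"
    by (auto simp: closure_sequential)
  then show "a *\<^sub>C x \<in> closure S"
    unfolding closure_sequential
    by (intro exI[of _ "\<lambda>n. a *\<^sub>C f n"]) (auto intro!: assms scaleC.tendsto tendsto_const)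
qed

lemma bounded_operator_onD:
  assumes "bounded_operator_on Y F" "closed_csubspace Y"
  shows "\<And>x. x \<in> Y \<Longrightarrow> F x \<in> Y" "\<And>x y. x \<in> Y \<Longrightarrow> y \<in> Y \<Longrightarrow> F (x + y) = F x + F y"
    "\<And>a x. x \<in> Y \<Longrightarrow> F (a *\<^sub>C x) = a *\<^sub>C F x" "\<And>r x. x \<in> Y \<Longrightarrow> F (r *\<^sub>R x) = r *\<^sub>R F x"
    "\<And>x y. x \<in> Y \<Longrightarrow> y \<in> Y \<Longrightarrow> F (x - y) = F x - F y" "F 0 = 0"
    "\<exists>C>0. \<forall>x\<in>Y. norm (F x) \<le> C * norm x"
proof -
  note Y = closed_csubspaceD[OF assms(2)]
  show 0: "\<And>x. x \<in> Y \<Longrightarrow> F x \<in> Y" "\<And>x y. x \<in> Y \<Longrightarrow> y \<in> Y \<Longrightarrow> F (x + y) = F x + F y"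
    "\<And>a x. x \<in> Y \<Longrightarrow> F (a *\<^sub>C x) = a *\<^sub>C F x" using assms(1) by (auto simp: bounded_operator_on_def)
  show 1: "\<And>r x. x \<in> Y \<Longrightarrow> F (r *\<^sub>R x) = r *\<^sub>R F x" by (metis 0(3) scaleC_of_real)
  show "F (x - y) = F x - F y" if "x \<in> Y" "y \<in> Y" for x y
    using 0(2)[of x "- y"] 1[of y "-1"] Y(6) that by simp
  show "F 0 = 0" using 1[of 0 0] Y by simp
  obtain C where "\<forall>x\<in>Y. norm (F x) \<le> C * norm x" using assms(1) by (auto simp: bounded_operator_on_def)
  then show "\<exists>C>0. \<forall>x\<in>Y. norm (F x) \<le> C * norm x"
    by (metis less_max_iff_disj max.cobounded1 mult_right_mono norm_ge_zero order_trans zero_less_one)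
qed

lemma bounded_operator_on_tendsto:
  assumes "bounded_operator_on Y F" "closed_csubspace Y" "(f \<longlongrightarrow> x) Fl" "x \<in> Y" "\<forall>\<^sub>F i in Fl. f i \<in> Y"
  shows "((\<lambda>i. F (f i)) \<longlongrightarrow> F x) Fl"
proof -
  note F = bounded_operator_onD[OF assms(1,2)]
  obtain C where C: "\<forall>x\<in>Y. norm (F x) \<le> C * norm x" using F(7) by blast
  have "((\<lambda>i. F (f i) - F x) \<longlongrightarrow> 0) Fl"
  proof (rule Lim_null_comparison)
    show "((\<lambda>i. C * norm (f i - x)) \<longlongrightarrow> 0) Fl"
      using assms(3) by (auto intro!: tendsto_eq_intros)
    show "\<forall>\<^sub>F i in Fl. norm (F (f i) - F x) \<le> C * norm (f i - x)"
      using assms(5)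
    proof eventually_elim
      case (elim i)
      then show ?case using C F(5) assms(4) closed_csubspaceD(7)[OF assms(2)] by metis
    qed
  qed
  then show ?thesis by (simp add: LIM_zero_iff)
qed

text \<open>A gliding hump: signed sums of vectors that almost attain the norms of the operators.\<close>

lemma uniform_boundedness_on:
  fixes F :: "nat \<Rightarrow> 'x::complex_banach \<Rightarrow> 'x"
  assumes Y: "closed_csubspace Y" and F: "\<And>n. bounded_operator_on Y (F n)"
    and pw: "\<And>x. x \<in> Y \<Longrightarrow> \<exists>C. \<forall>n. norm (F n x) \<le> C"
  shows "\<exists>C. \<forall>n. \<forall>x\<in>Y. norm (F n x) \<le> C * norm x"
proof (rule ccontr)
  assume unb: "\<not> ?thesis"
  note YD = closed_csubspaceD[OF Y]
  note FD = bounded_operator_onD[OF F Y]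
  define N where "N n = (SUP x\<in>Y. norm (F n x) / norm x)" for n
  have bdd: "bdd_above ((\<lambda>x. norm (F n x) / norm x) ` Y)" for n
  proof -
    obtain C where C: "C > 0" "\<forall>x\<in>Y. norm (F n x) \<le> C * norm x" using FD(7)[of n] by blast
    then have "norm (F n x) / norm x \<le> C" if "x \<in> Y" for x
      using that by (cases "x = 0") (auto simp: divide_le_eq)
    then show ?thesis by (auto simp: bdd_above_def)
  qed
  have N_ge: "norm (F n x) \<le> N n * norm x" if "x \<in> Y" for n x
  proof (cases "x = 0")
    case False
    have "norm (F n x) / norm x \<le> N n" unfolding N_def by (rule cSUP_upper[OF that bdd])
    then show ?thesis using False by (simp add: divide_le_eq)
  qed (simp add: FD)
  have "\<exists>m. N m > 4 ^ n" for n :: nat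
  proof (rule ccontr)
    assume "\<not> ?thesis"
    then have "\<forall>m. \<forall>x\<in>Y. norm (F m x) \<le> 4 ^ n * norm x"
      using N_ge by (meson linorder_not_less mult_right_mono norm_ge_zero order_trans)
    then show False using unb by blast
  qed
  then obtain m where m: "\<And>n::nat. N (m n) > 4 ^ n" by metis
  have "\<exists>y\<in>Y. norm y = (1/3) ^ n \<and> norm (F (m n) y) \<ge> (2/3) * N (m n) * (1/3) ^ n" for n
  proof -
    have pos: "0 < N (m n)" using m[of n] by (metis zero_less_numeral zero_less_power order_less_trans)
    have "\<exists>v \<in> (\<lambda>x. norm (F (m n) x) / norm x) ` Y. (2/3) * N (m n) < v"
      using pos YD(2) unfolding N_def by (intro less_cSupD) auto
    then obtain v where v: "v \<in> Y" "(2/3) * N (m n) < norm (F (m n) v) / norm v" by auto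
    have v0: "v \<noteq> 0" using v(2) pos by auto
    define y where "y = ((1/3) ^ n / norm v) *\<^sub>R v"
    have "norm (F (m n) y) = (1/3) ^ n * (norm (F (m n) v) / norm v)"
      using FD(4)[OF v(1)] v0 by (simp add: y_def)
    then have "norm (F (m n) y) \<ge> (2/3) * N (m n) * (1/3) ^ n"
      using mult_left_mono[OF less_imp_le[OF v(2)], of "(1/3)^n"] by (simp add: mult_ac)
    moreover have "norm y = (1/3) ^ n" "y \<in> Y" using v0 v(1) YD(5) by (auto simp: y_def)
    ultimately show ?thesis by blast
  qed
  then obtain y where y: "\<And>n. y n \<in> Y" "\<And>n. norm (y n) = (1/3) ^ n"
    "\<And>n. norm (F (m n) (y n)) \<ge> (2/3) * N (m n) * (1/3) ^ n" by metis
  \<comment> \<open>The images of \<open>x n + y n\<close> and \<open>x n - y n\<close> differ by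
    twice that of \<open>y n\<close>, so for one of the two signs the image is at least as large as
    that of \<open>y n\<close>.\<close>
  define x where "x = rec_nat 0 (\<lambda>n z. if norm (F (m n) (z + y n)) \<ge> norm (F (m n) (y n)) then z + y n else z - y n)"
  have xS: "x (Suc n) = (if norm (F (m n) (x n + y n)) \<ge> norm (F (m n) (y n)) then x n + y n else x n - y n)" for n
    by (simp add: x_def)
  have x0: "x 0 = 0" by (simp add: x_def)
  have xY: "x n \<in> Y" for n by (induction n) (auto simp: x0 xS YD y)
  have xF: "norm (F (m n) (x (Suc n))) \<ge> norm (F (m n) (y n))" for n
  proof (cases "norm (F (m n) (x n + y n)) \<ge> norm (F (m n) (y n))")
    case False
    have "norm (F (m n) (x n + y n) - F (m n) (x n - y n)) \<le> norm (F (m n) (x n + y n)) + norm (F (m n) (x n - y n))"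
      by (rule norm_triangle_ineq4)
    moreover have "F (m n) (x n + y n) - F (m n) (x n - y n) = 2 *\<^sub>R F (m n) (y n)"
      using FD(2,5) xY y(1) by (simp add: scaleR_2)
    ultimately show ?thesis using False xS[of n] by simp
  qed (simp add: xS)
  have dx: "norm (x (Suc n) - x n) = (1/3) ^ n" for n by (simp add: xS y)
  have tail: "norm (x (n + k) - x n) \<le> (3/2) * (1/3) ^ n - (3/2) * (1/3) ^ (n + k)" for n k
  proof (induction k)
    case (Suc k)
    have "norm (x (n + Suc k) - x n) \<le> norm (x (Suc (n + k)) - x (n + k)) + norm (x (n + k) - x n)"
      by (metis add_Suc_right diff_add_cancel add_diff_eq norm_triangle_ineq)
    then show ?case using Suc dx[of "n + k"] by simp
  qed simp
  have "Cauchy x"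
  proof (rule metric_CauchyI)
    fix e :: real assume "e > 0"
    have "(\<lambda>n. 3 * (1/3::real) ^ n) \<longlonglongrightarrow> 0"
      by (intro tendsto_mult_right_zero LIMSEQ_power_zero) auto
    then obtain M where M: "\<And>n. n \<ge> M \<Longrightarrow> 3 * (1/3::real) ^ n < e"
      using order_tendstoD(2)[of _ 0 sequentially e] \<open>e > 0\<close> by (fastforce simp: eventually_sequentially)
    have "norm (x n - x M) \<le> (3/2) * (1/3) ^ M" if "n \<ge> M" for n
    proof -
      have "(0::real) \<le> (3/2) * (1/3) ^ n" by simp
      then show ?thesis using tail[of M "n - M"] unfolding le_add_diff_inverse[OF that] by linarith
    qed
    then have "dist (x i) (x j) < e" if "i \<ge> M" "j \<ge> M" for i j
    proof -
      have "norm (x i - x M) + norm (x j - x M) < e"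
        using \<open>\<And>n. n \<ge> M \<Longrightarrow> norm (x n - x M) \<le> (3/2) * (1/3) ^ M\<close>[OF that(1)]
          \<open>\<And>n. n \<ge> M \<Longrightarrow> norm (x n - x M) \<le> (3/2) * (1/3) ^ M\<close>[OF that(2)] M[of M] by simp
      then show ?thesis using dist_triangle2[of "x i" "x j" "x M"] by (simp add: dist_norm)
    qed
    then show "\<exists>M. \<forall>m\<ge>M. \<forall>n\<ge>M. dist (x m) (x n) < e" by blast
  qed
  then obtain l where l: "x \<longlonglongrightarrow> l" using Cauchy_convergent convergent_def by blast
  have lY: "l \<in> Y" using closed_sequentially[OF YD(1) xY l] .
  \<comment> \<open>The remaining steps add up to at most half of \<open>(1/3) ^ n\<close>. This is
    less than the share 2/3 secured by \<open>y n\<close>, so a sixth of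
    \<open>N (m n) * (1/3) ^ n\<close>, hence of \<open>(4/3) ^ n\<close>, survives in the
    limit.\<close>
  have lx: "norm (l - x (Suc n)) \<le> (1/2) * (1/3) ^ n" for n
  proof (rule LIMSEQ_le_const2)
    show "(\<lambda>k. norm (x (k + Suc n) - x (Suc n))) \<longlonglongrightarrow> norm (l - x (Suc n))"
      by (intro tendsto_intros LIMSEQ_ignore_initial_segment l)
    have "norm (x (k + Suc n) - x (Suc n)) \<le> (1/2) * (1/3) ^ n" for k
    proof -
      have "(0::real) \<le> (1/3) ^ (Suc n + k)" by simp
      moreover have "(1/3::real) ^ Suc n = (1/3) * (1/3) ^ n" by simp
      ultimately have "norm (x (Suc n + k) - x (Suc n)) \<le> (1/2) * (1/3) ^ n" using tail[of "Suc n" k] by linarith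
      then show ?thesis by (simp add: add.commute)
    qed
    then show "\<exists>N. \<forall>k\<ge>N. norm (x (k + Suc n) - x (Suc n)) \<le> (1/2) * (1/3) ^ n" by blast
  qed
  obtain C where C: "\<And>n. norm (F n l) \<le> C" using pw[OF lY] by blast
  have "6 * C \<ge> (4/3) ^ n" for n :: nat
  proof -
    have "F (m n) (x (Suc n)) = F (m n) l - F (m n) (l - x (Suc n))" using FD(5) lY xY YD by simp
    then have "norm (F (m n) (x (Suc n))) \<le> norm (F (m n) l) + norm (F (m n) (l - x (Suc n)))"
      by (metis norm_triangle_ineq4)
    also have "\<dots> \<le> C + N (m n) * ((1/2) * (1/3) ^ n)"
    proof (intro add_mono C)
      have "norm (F (m n) (l - x (Suc n))) \<le> N (m n) * norm (l - x (Suc n))"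
        by (rule N_ge) (simp add: YD lY xY)
      also have "\<dots> \<le> N (m n) * ((1/2) * (1/3) ^ n)"
        using lx[of n] m[of n] by (intro mult_left_mono) (auto intro: less_imp_le[OF order_less_trans[rotated]])
      finally show "norm (F (m n) (l - x (Suc n))) \<le> N (m n) * ((1/2) * (1/3) ^ n)" .
    qed
    finally have "norm (F (m n) (x (Suc n))) \<le> C + (1/2) * (N (m n) * (1/3) ^ n)" by simp
    moreover have "(2/3) * (N (m n) * (1/3) ^ n) \<le> norm (F (m n) (y n))" using y(3)[of n] by simp
    moreover have "4 ^ n * (1/3) ^ n \<le> N (m n) * (1/3) ^ n"
      using m[of n] by (intro mult_right_mono) auto
    ultimately have "4 ^ n * (1/3) ^ n \<le> 6 * C" using xF[of n] by linarith
    then show ?thesis by (simp add: power_divide)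
  qed
  moreover obtain n where "6 * C < (4/3 :: real) ^ n" using real_arch_pow[of "4/3" "6 * C"] by auto
  ultimately show False by (meson linorder_not_less)
qed

text \<open>Otherwise some sequence tends to \<open>z0\<close> with operator norms above every
  bound, although it converges pointwise, against \<open>uniform_boundedness_on\<close>. It serves
  both t \<rightarrow> 0 on the half line and z \<rightarrow> 0 in a sector.\<close>

lemma uniform_bound_near:
  fixes U :: "'z::metric_space \<Rightarrow> 'x::complex_banach \<Rightarrow> 'x"
  assumes Y: "closed_csubspace Y" and U: "\<And>z. z \<in> S \<Longrightarrow> bounded_operator_on Y (U z)"
    and lim: "\<And>x. x \<in> Y \<Longrightarrow> ((\<lambda>z. U z x) \<longlongrightarrow> x) (at z0 within S)"
  shows "\<exists>\<eta>>0. \<exists>K\<ge>1. \<forall>z\<in>S. z \<noteq> z0 \<longrightarrow> dist z z0 < \<eta> \<longrightarrow> (\<forall>x\<in>Y. norm (U z x) \<le> K * norm x)"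
proof (rule ccontr)
  assume H: "\<not> ?thesis"
  have "\<exists>z\<in>S. z \<noteq> z0 \<and> dist z z0 < 1 / real (Suc n) \<and> (\<exists>x\<in>Y. norm (U z x) > real (Suc n) * norm x)" for n
  proof (rule ccontr)
    assume "\<not> ?thesis"
    then have "\<forall>z\<in>S. z \<noteq> z0 \<longrightarrow> dist z z0 < 1 / real (Suc n) \<longrightarrow> (\<forall>x\<in>Y. norm (U z x) \<le> real (Suc n) * norm x)"
      by (meson linorder_not_less)
    moreover have "1 / real (Suc n) > 0" "real (Suc n) \<ge> 1" by auto
    ultimately show False using H by blast
  qed
  then obtain z where z: "\<And>n. z n \<in> S" "\<And>n. z n \<noteq> z0" "\<And>n. dist (z n) z0 < 1 / real (Suc n)"
    "\<And>n. \<exists>x\<in>Y. norm (U (z n) x) > real (Suc n) * norm x" by metis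
  have "z \<longlonglongrightarrow> z0"
    by (rule metric_tendsto_imp_tendsto[OF LIMSEQ_inverse_real_of_nat])
       (use z(3) in \<open>auto simp: inverse_eq_divide less_imp_le\<close>)
  then have zl: "filterlim z (at z0 within S) sequentially"
    using z(1,2) by (auto simp: filterlim_at)
  have "\<exists>C. \<forall>n. \<forall>x\<in>Y. norm (U (z n) x) \<le> C * norm x"
  proof (rule uniform_boundedness_on[OF Y])
    show "bounded_operator_on Y (U (z n))" for n using U z(1) .
    fix x assume "x \<in> Y"
    then have "(\<lambda>n. U (z n) x) \<longlonglongrightarrow> x" using filterlim_compose[OF lim zl] by simp
    then have "Bseq (\<lambda>n. U (z n) x)" by (metis convergent_imp_Bseq convergent_def)
    then show "\<exists>C. \<forall>n. norm (U (z n) x) \<le> C" by (auto simp: Bseq_def)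
  qed
  then obtain C where C: "\<forall>n. \<forall>x\<in>Y. norm (U (z n) x) \<le> C * norm x" by blast
  obtain n where n: "C < real n" using reals_Archimedean2 by blast
  obtain x where x: "x \<in> Y" "norm (U (z n) x) > real (Suc n) * norm x" using z(4) by blast
  have "C * norm x \<le> real (Suc n) * norm x" using n by (intro mult_right_mono) auto
  then show False using x C by (metis linorder_not_less order_trans)
qed

section \<open>Derivatives and integrals of vector-valued functions\<close>

lemma has_vector_derivative_iff_quotient:
  "(f has_vector_derivative D) (at x within S) \<longleftrightarrow>
    ((\<lambda>y. (f y - f x) /\<^sub>R (y - x)) \<longlongrightarrow> D) (at x within S)"
proof -
  have "norm ((f y - f x - (y - x) *\<^sub>R D) /\<^sub>R \<bar>y - x\<bar>) = norm ((f y - f x) /\<^sub>R (y - x) - D)" if "y \<noteq> x" for y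
  proof -
    have "(f y - f x) /\<^sub>R (y - x) - D = (f y - f x - (y - x) *\<^sub>R D) /\<^sub>R (y - x)"
      using that by (simp add: scaleR_diff_right)
    then show ?thesis by simp
  qed
  then have "((\<lambda>y. norm (f y - f x - (y - x) *\<^sub>R D) / norm (y - x)) \<longlongrightarrow> 0) (at x within S) \<longleftrightarrow>
     ((\<lambda>y. norm ((f y - f x) /\<^sub>R (y - x) - D)) \<longlongrightarrow> 0) (at x within S)"
    by (intro Lim_cong_within) (auto simp: divide_inverse_commute)
  then show ?thesis
    unfolding has_vector_derivative_def has_derivative_iff_norm
    by (simp add: bounded_linear_scaleR_left tendsto_norm_zero_iff LIM_zero_iff)
qed

lemma norm_diff_le_of_derivative_bound:
  fixes f :: "real \<Rightarrow> 'a::real_normed_vector"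
  assumes "a \<le> b" and "\<And>t. t \<in> {a..b} \<Longrightarrow> (f has_vector_derivative f' t) (at t within {a..b})"
    and B: "\<And>t. t \<in> {a..b} \<Longrightarrow> norm (f' t) \<le> B"
  shows "norm (f b - f a) \<le> B * (b - a)"
proof -
  have "norm (f b - f a) \<le> B * norm (b - a)"
  proof (rule differentiable_bound[where f' = "\<lambda>t h. h *\<^sub>R f' t" and S = "{a..b}"])
    show "onorm (\<lambda>h. h *\<^sub>R f' t) \<le> B" if "t \<in> {a..b}" for t
      using B[OF that] by (intro onorm_le) (auto simp: mult.commute[of B] intro: mult_left_mono)
  qed (use assms in \<open>auto simp: has_vector_derivative_def\<close>)
  then show ?thesis using \<open>a \<le> b\<close> by simp
qed

lemma derivative_zero_imp_eq:
  fixes f :: "real \<Rightarrow> 'a::real_normed_vector"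
  assumes "a \<le> b" and "\<And>t. t \<in> {a..b} \<Longrightarrow> (f has_vector_derivative 0) (at t within {a..b})"
  shows "f b = f a"
  using norm_diff_le_of_derivative_bound[OF assms, of 0] by simp

text \<open>Riemann sums stay in the subspace and closedness keeps their limit. Applied to the graph
  of a closed operator, it moves the operator under the integral sign.\<close>

lemma has_integral_in_closed_subspace:
  fixes f :: "real \<Rightarrow> 'a::banach"
  assumes S: "closed S" "subspace S" and f: "\<And>t. t \<in> {a..b} \<Longrightarrow> f t \<in> S" and I: "(f has_integral I) {a..b}"
  shows "I \<in> S"
proof -
  have "\<exists>y\<in>S. dist y I < e" if "e > 0" for e
  proof -
    obtain \<gamma> where g: "gauge \<gamma>" "\<And>D. D tagged_division_of cbox a b \<Longrightarrow> \<gamma> fine D \<Longrightarrow>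
        norm ((\<Sum>(x,k)\<in>D. Henstock_Kurzweil_Integration.content k *\<^sub>R f x) - I) < e"
      using I \<open>e > 0\<close> unfolding has_integral interval_cbox by meson
    obtain D where D: "D tagged_division_of cbox a b" "\<gamma> fine D" using fine_division_exists[OF g(1)] by blast
    have "(\<Sum>(x,k)\<in>D. Henstock_Kurzweil_Integration.content k *\<^sub>R f x) \<in> S"
    proof (rule subspace_sum[OF S(2)])
      fix z assume "z \<in> D"
      then show "(case z of (x, k) \<Rightarrow> Henstock_Kurzweil_Integration.content k *\<^sub>R f x) \<in> S"
        using f tagged_division_ofD(2,3)[OF D(1)] unfolding box_real
        by (cases z) (auto simp: subset_iff intro!: subspace_scale[OF S(2)])
    qed
    then show ?thesis using g(2)[OF D] by (auto simp: dist_norm)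
  qed
  then show ?thesis using closure_approachable closure_closed[OF S(1)] by metis
qed

text \<open>The family \<open>F\<close> is differentiable only strongly and linear only on
  \<open>Y\<close>, so the bilinear product rule does not apply. The uniform bound \<open>K\<close>
  is what lets the difference quotients of \<open>v\<close> converge inside
  \<open>F \<sigma>\<close>.\<close>

lemma product_rule_on:
  fixes F :: "real \<Rightarrow> 'x::complex_banach \<Rightarrow> 'x"
  assumes Y: "closed_csubspace Y"
    and Fd: "\<And>\<sigma> x y. \<sigma> \<in> S \<Longrightarrow> x \<in> Y \<Longrightarrow> y \<in> Y \<Longrightarrow> F \<sigma> (x - y) = F \<sigma> x - F \<sigma> y"
    and Fs: "\<And>\<sigma> r x. \<sigma> \<in> S \<Longrightarrow> x \<in> Y \<Longrightarrow> F \<sigma> (r *\<^sub>R x) = r *\<^sub>R F \<sigma> x"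
    and Fb: "\<And>\<sigma> x. \<sigma> \<in> S \<Longrightarrow> x \<in> Y \<Longrightarrow> norm (F \<sigma> x) \<le> K * norm x"
    and s: "s \<in> S" and vY: "\<And>\<sigma>. \<sigma> \<in> S \<Longrightarrow> v \<sigma> \<in> Y" and v'Y: "v' \<in> Y"
    and dF: "((\<lambda>\<sigma>. F \<sigma> (v s)) has_vector_derivative g) (at s within S)"
    and dv: "(v has_vector_derivative v') (at s within S)"
    and Fv': "((\<lambda>\<sigma>. F \<sigma> v') \<longlongrightarrow> w) (at s within S)"
  shows "((\<lambda>\<sigma>. F \<sigma> (v \<sigma>)) has_vector_derivative (g + w)) (at s within S)"
proof -
  note YD = closed_csubspaceD[OF Y]
  define q where "q \<sigma> = (v \<sigma> - v s) /\<^sub>R (\<sigma> - s)" for \<sigma>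
  have q: "(q \<longlongrightarrow> v') (at s within S)" using dv unfolding has_vector_derivative_iff_quotient q_def[abs_def] .
  have qY: "q \<sigma> \<in> Y" if "\<sigma> \<in> S" for \<sigma> using that vY s YD by (simp add: q_def)
  have inS: "\<forall>\<^sub>F \<sigma> in at s within S. \<sigma> \<in> S \<and> \<sigma> \<noteq> s" by (simp add: eventually_at_filter)
  have "((\<lambda>\<sigma>. F \<sigma> (q \<sigma>) - F \<sigma> v') \<longlongrightarrow> 0) (at s within S)"
  proof (rule Lim_null_comparison)
    show "((\<lambda>\<sigma>. K * norm (q \<sigma> - v')) \<longlongrightarrow> 0) (at s within S)" using q by (auto intro!: tendsto_eq_intros)
    show "\<forall>\<^sub>F \<sigma> in at s within S. norm (F \<sigma> (q \<sigma>) - F \<sigma> v') \<le> K * norm (q \<sigma> - v')"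
      using inS by eventually_elim (metis Fb Fd YD(7) qY v'Y)
  qed
  from tendsto_add[OF this Fv'] have "((\<lambda>\<sigma>. F \<sigma> (q \<sigma>)) \<longlongrightarrow> w) (at s within S)" by simp
  moreover have "((\<lambda>\<sigma>. (F \<sigma> (v s) - F s (v s)) /\<^sub>R (\<sigma> - s)) \<longlongrightarrow> g) (at s within S)"
    using dF by (simp add: has_vector_derivative_iff_quotient)
  ultimately have "((\<lambda>\<sigma>. (F \<sigma> (v s) - F s (v s)) /\<^sub>R (\<sigma> - s) + F \<sigma> (q \<sigma>)) \<longlongrightarrow> g + w) (at s within S)"
    by (rule tendsto_add[rotated])
  moreover have "\<forall>\<^sub>F \<sigma> in at s within S. (F \<sigma> (v s) - F s (v s)) /\<^sub>R (\<sigma> - s) + F \<sigma> (q \<sigma>) = (F \<sigma> (v \<sigma>) - F s (v s)) /\<^sub>R (\<sigma> - s)"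
    using inS
  proof eventually_elim
    case (elim \<sigma>)
    then have "F \<sigma> (q \<sigma>) = (F \<sigma> (v \<sigma>) - F \<sigma> (v s)) /\<^sub>R (\<sigma> - s)"
      unfolding q_def using Fs Fd vY s YD(7) by (metis (full_types))
    then show ?case by (simp add: scaleR_diff_right)
  qed
  ultimately show ?thesis
    unfolding has_vector_derivative_iff_quotient using tendsto_cong by fast
qed

text \<open>The estimate makes the preimages of a convergent sequence Cauchy, and the graph is
  closed. As \<open>k\<close> may be nonpositive, the proof divides by
  \<open>\<bar>k\<bar> + 1\<close>.\<close>

lemma closed_range_of_apriori:
  fixes G :: "('x::complex_banach \<times> 'x) set"
  assumes G: "closed G" and diff: "\<And>x y x' y'. (x, y) \<in> G \<Longrightarrow> (x', y') \<in> G \<Longrightarrow> (x - x', y - y') \<in> G"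
    and ap: "\<And>u v. (u, v) \<in> G \<Longrightarrow> norm u \<le> k * norm (z *\<^sub>C u - v)"
  shows "closed {w. \<exists>u. (u, z *\<^sub>C u - w) \<in> G}"
  unfolding closed_sequential_limits mem_Collect_eq
proof (intro allI impI, elim conjE)
  fix w l assume "\<forall>n. \<exists>u. (u, z *\<^sub>C u - w n) \<in> G" and l: "w \<longlonglongrightarrow> l"
  then obtain u where u: "\<And>n. (u n, z *\<^sub>C u n - w n) \<in> G" by metis
  have "norm (u m - u n) \<le> (\<bar>k\<bar> + 1) * norm (w m - w n)" for m n
  proof -
    have "norm (u m - u n) \<le> k * norm (w m - w n)"
      using ap[OF diff[OF u[of m] u[of n]]] by (simp add: scaleC.diff_right algebra_simps)
    also have "\<dots> \<le> (\<bar>k\<bar> + 1) * norm (w m - w n)" by (intro mult_right_mono) auto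
    finally show ?thesis .
  qed
  then have le: "dist (u m) (u n) \<le> (\<bar>k\<bar> + 1) * dist (w m) (w n)" for m n by (simp add: dist_norm)
  have "Cauchy u"
  proof (rule metric_CauchyI)
    fix e :: real assume "e > 0"
    then have "e / (\<bar>k\<bar> + 1) > 0" by simp
    then obtain N where N: "\<And>m n. m \<ge> N \<Longrightarrow> n \<ge> N \<Longrightarrow> dist (w m) (w n) < e / (\<bar>k\<bar> + 1)"
      using LIMSEQ_imp_Cauchy[OF l] by (meson Cauchy_def)
    have "dist (u m) (u n) < e" if "m \<ge> N" "n \<ge> N" for m n
      using le_less_trans[OF le[of m n]] N[OF that] by (simp add: pos_less_divide_eq mult.commute)
    then show "\<exists>N. \<forall>m\<ge>N. \<forall>n\<ge>N. dist (u m) (u n) < e" by blast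
  qed
  then obtain a where a: "u \<longlonglongrightarrow> a" using Cauchy_convergent convergent_def by blast
  have "(\<lambda>n. (u n, z *\<^sub>C u n - w n)) \<longlonglongrightarrow> (a, z *\<^sub>C a - l)"
    by (intro tendsto_intros scaleC.tendsto a l)
  then have "(a, z *\<^sub>C a - l) \<in> G"
    using closed_sequentially[OF G, of "\<lambda>n. (u n, z *\<^sub>C u n - w n)"] u by blast
  then show "\<exists>u. (u, z *\<^sub>C u - l) \<in> G" by blast
qed

lemma continuous_on_atLeast_0I:
  fixes f :: "real \<Rightarrow> 'a::topological_space"
  assumes "\<And>b. continuous_on {0..b} f" shows "continuous_on {0..} f"
  unfolding continuous_on_eq_continuous_within
proof
  fix t :: real assume "t \<in> {0..}"
  then have "continuous (at t within {0..t+1}) f"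
    using assms[of "t + 1"] by (auto simp: continuous_on_eq_continuous_within)
  moreover have "at t within {0..t+1} = at t within {0..}"
    by (rule at_within_nhd[of _ "{..<t+1}"]) (use \<open>t \<in> {0..}\<close> in auto)
  ultimately show "continuous (at t within {0..}) f" by simp
qed

section \<open>Strongly continuous semigroups\<close>

locale c0_sg =
  fixes Y :: "'x::complex_banach set" and T :: "real \<Rightarrow> 'x \<Rightarrow> 'x"
  assumes Y: "closed_csubspace Y" and sg: "c0_semigroup Y T"
begin

lemma bo: "0 \<le> t \<Longrightarrow> bounded_operator_on Y (T t)"
  using sg by (simp add: c0_semigroup_def)

lemmas YD = closed_csubspaceD[OF Y]
lemmas T_in = bounded_operator_onD(1)[OF bo Y]
lemmas T_scaleC = bounded_operator_onD(3)[OF bo Y]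
lemmas T_scaleR = bounded_operator_onD(4)[OF bo Y]
lemmas T_diff = bounded_operator_onD(5)[OF bo Y]

lemma T_0: "x \<in> Y \<Longrightarrow> T 0 x = x" and T_add: "\<lbrakk>0 \<le> s; 0 \<le> t; x \<in> Y\<rbrakk> \<Longrightarrow> T (s + t) x = T s (T t x)"
  and T_cont: "x \<in> Y \<Longrightarrow> continuous_on {0..} (\<lambda>t. T t x)"
  using sg by (simp_all add: c0_semigroup_def)

lemma T_cont': "x \<in> Y \<Longrightarrow> 0 \<le> a \<Longrightarrow> continuous_on {a..b} (\<lambda>t. T t x)"
  by (rule continuous_on_subset[OF T_cont]) auto

lemma exp_bound: "\<exists>K\<ge>1. \<exists>\<omega>\<ge>0. \<forall>t\<ge>0. \<forall>x\<in>Y. norm (T t x) \<le> K * exp (\<omega> * t) * norm x"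
proof -
  have lim: "((\<lambda>t. T t x) \<longlongrightarrow> x) (at 0 within {0..})" if "x \<in> Y" for x
    using T_cont[OF that] T_0[OF that] unfolding continuous_on by (metis atLeast_iff order_refl)
  obtain \<eta> K where \<eta>: "\<eta> > 0" "K \<ge> 1"
    "\<And>t x. t \<ge> 0 \<Longrightarrow> t \<noteq> 0 \<Longrightarrow> \<bar>t\<bar> < \<eta> \<Longrightarrow> x \<in> Y \<Longrightarrow> norm (T t x) \<le> K * norm x"
    using uniform_bound_near[OF Y _ lim] bo by (auto simp: dist_real_def)
  \<comment> \<open>Halving \<eta> makes the bound available on the closed interval [0, h], which is
    then iterated; the growth rate becomes \<open>ln K / h\<close>.\<close>
  define h where "h = \<eta> / 2"
  have h: "h > 0" using \<eta> by (simp add: h_def)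
  have Kx: "norm x \<le> K * norm x" for x :: 'x using mult_right_mono[OF \<eta>(2), of "norm x"] by simp
  have step: "norm (T t x) \<le> K * norm x" if "0 \<le> t" "t \<le> h" "x \<in> Y" for t x
  proof (cases "t = 0")
    case False
    then show ?thesis using \<eta>(3)[of t x] \<eta>(1) that by (simp add: h_def)
  qed (use that T_0 Kx in simp)
  have iter: "norm (T t x) \<le> K ^ Suc n * norm x" if "0 \<le> t" "t \<le> real (Suc n) * h" "x \<in> Y" for n t x
    using that
  proof (induction n arbitrary: t x)
    case (Suc n)
    show ?case
    proof (cases "t \<le> h")
      case True
      have "K * norm x \<le> K ^ Suc (Suc n) * norm x"
        using power_increasing[of 1 "Suc (Suc n)" K] \<eta>(2) by (intro mult_right_mono) auto
      then show ?thesis using step[OF _ True] Suc.prems by (meson order_trans)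
    next
      case False
      then have "T t x = T h (T (t - h) x)" using T_add[of h "t - h" x] h Suc.prems by simp
      also have "norm \<dots> \<le> K * norm (T (t - h) x)"
        using False h Suc.prems by (intro step T_in) auto
      also have "\<dots> \<le> K * (K ^ Suc n * norm x)"
        using \<eta>(2) False Suc.prems by (intro mult_left_mono Suc.IH) (auto simp: algebra_simps)
      finally show ?thesis by (simp add: mult_ac)
    qed
  qed (use step in auto)
  have "norm (T t x) \<le> K * exp (ln K / h * t) * norm x" if "0 \<le> t" "x \<in> Y" for t x
  proof -
    define n where "n = nat \<lfloor>t / h\<rfloor>"
    have n: "real n \<le> t / h" "t / h \<le> real (Suc n)" using that h real_of_int_floor_add_one_ge[of "t / h"] by (auto simp: n_def add.commute)
    have "norm (T t x) \<le> K ^ Suc n * norm x"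
      using iter[of t n x] n(2) h that by (simp add: pos_divide_le_eq)
    also have "K ^ Suc n = K * exp (real n * ln K)" using \<eta>(2) by (simp add: exp_of_nat_mult)
    also have "\<dots> \<le> K * exp (ln K / h * t)"
      using mult_right_mono[OF n(1), of "ln K"] \<eta>(2) by (intro mult_left_mono) (auto simp: mult.commute)
    finally show ?thesis by (simp add: mult_right_mono)
  qed
  moreover have "ln K / h \<ge> 0" using \<eta>(2) h by simp
  ultimately show ?thesis using \<eta>(2) by blast
qed

lemma local_bound: "\<exists>K\<ge>1. \<forall>t\<in>{0..b}. \<forall>x\<in>Y. norm (T t x) \<le> K * norm x"
proof -
  obtain K \<omega> where K: "K \<ge> 1" "\<omega> \<ge> 0" "\<And>t x. t \<ge> 0 \<Longrightarrow> x \<in> Y \<Longrightarrow> norm (T t x) \<le> K * exp (\<omega> * t) * norm x"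
    using exp_bound by blast
  have "norm (T t x) \<le> (K * exp (\<omega> * \<bar>b\<bar>)) * norm x" if "t \<in> {0..b}" "x \<in> Y" for t x
  proof -
    have "K * exp (\<omega> * t) * norm x \<le> K * exp (\<omega> * \<bar>b\<bar>) * norm x"
      using K that by (intro mult_right_mono mult_left_mono) (auto intro: mult_left_mono)
    then show ?thesis using K(3)[of t x] that by simp
  qed
  moreover have "1 \<le> K * exp (\<omega> * \<bar>b\<bar>)" using K by (metis mult_mono one_le_exp_iff mult_1 zero_le_one abs_ge_zero mult_nonneg_nonneg order_trans)
  ultimately show ?thesis by blast
qed

text \<open>Joint continuity in time and vector: local boundedness replaces \<open>f i\<close> by
  \<open>z\<close>, then strong continuity moves the time.\<close>

lemma T_tendsto:
  assumes f: "(f \<longlongrightarrow> z) F" and \<tau>: "(\<tau> \<longlongrightarrow> t) F" and ev: "\<forall>\<^sub>F i in F. 0 \<le> \<tau> i \<and> f i \<in> Y"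
    and z: "z \<in> Y" "0 \<le> t"
  shows "((\<lambda>i. T (\<tau> i) (f i)) \<longlongrightarrow> T t z) F"
proof -
  obtain K where K: "K \<ge> 1" "\<And>s x. s \<in> {0..t+1} \<Longrightarrow> x \<in> Y \<Longrightarrow> norm (T s x) \<le> K * norm x"
    using local_bound[of "t+1"] by blast
  have "\<forall>\<^sub>F i in F. \<tau> i < t + 1" using \<tau> by (rule order_tendstoD) simp
  with ev have ev': "\<forall>\<^sub>F i in F. norm (T (\<tau> i) (f i) - T (\<tau> i) z) \<le> K * norm (f i - z)"
  proof eventually_elim
    case (elim i)
    then show ?case using K(2)[of "\<tau> i" "f i - z"] T_diff[of "\<tau> i" "f i" z] YD(7) z by auto
  qed
  have "((\<lambda>i. T (\<tau> i) (f i) - T (\<tau> i) z) \<longlongrightarrow> 0) F"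
    by (rule Lim_null_comparison[OF ev']) (use f in \<open>auto intro!: tendsto_eq_intros\<close>)
  moreover have "((\<lambda>i. T (\<tau> i) z) \<longlongrightarrow> T t z) F"
    by (rule continuous_on_tendsto_compose[OF T_cont \<tau>]) (use z ev in \<open>auto elim: eventually_mono\<close>)
  ultimately show ?thesis using tendsto_add by fastforce
qed

section \<open>The generator of a strongly continuous semigroup\<close>

definition G where "G = generator Y T"

lemma G_iff: "(x, y) \<in> G \<longleftrightarrow> x \<in> Y \<and> ((\<lambda>h. (T h x - x) /\<^sub>R h) \<longlongrightarrow> y) (at_right 0)"
  by (simp add: G_def generator_def)

lemma G_in: assumes "(x, y) \<in> G" shows "x \<in> Y" "y \<in> Y"
proof -
  show x: "x \<in> Y" using assms by (simp add: G_iff)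
  have "\<forall>\<^sub>F h in at_right 0. (T h x - x) /\<^sub>R h \<in> Y"
    unfolding eventually_at_right_field by (rule exI[of _ 1]) (auto intro!: YD T_in x)
  then show "y \<in> Y" using assms by (intro Lim_in_closed_set[OF YD(1)]) (auto simp: G_iff)
qed

text \<open>With m = min s t the quotient on either side of t equals T(m) applied to the forward
  quotient at 0 of step |s - t|. Joint continuity therefore gives both one-sided derivatives at
  once.\<close>

lemma G_deriv:
  assumes "(x, y) \<in> G" "0 \<le> t"
  shows "((\<lambda>t. T t x) has_vector_derivative T t y) (at t within {0..})"
proof -
  define q where "q h = (T h x - x) /\<^sub>R h" for h
  note xy = G_in[OF assms(1)]
  have q: "(q \<longlongrightarrow> y) (at_right 0)" using assms(1) by (simp add: G_iff q_def[abs_def])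
  have fl: "filterlim (\<lambda>s. \<bar>s - t\<bar>) (at_right 0) (at t within {0..})"
    unfolding filterlim_at by (auto simp: eventually_at_filter intro!: tendsto_eq_intros)
  have qY: "q h \<in> Y" if "h > 0" for h using that xy T_in YD by (simp add: q_def)
  have "((\<lambda>s. T (min s t) (q \<bar>s - t\<bar>)) \<longlongrightarrow> T t y) (at t within {0..})"
  proof (rule T_tendsto)
    show "((\<lambda>s. q \<bar>s - t\<bar>) \<longlongrightarrow> y) (at t within {0..})" by (rule filterlim_compose[OF q fl])
    show "((\<lambda>s. min s t) \<longlongrightarrow> t) (at t within {0..})" by (auto intro!: tendsto_eq_intros)
    show "\<forall>\<^sub>F s in at t within {0..}. 0 \<le> min s t \<and> q \<bar>s - t\<bar> \<in> Y"
      using qY assms(2) by (auto simp: eventually_at_filter)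
  qed (use xy assms in auto)
  moreover have "\<forall>\<^sub>F s in at t within {0..}. T (min s t) (q \<bar>s - t\<bar>) = (T s x - T t x) /\<^sub>R (s - t)"
    unfolding eventually_at_filter
  proof (intro always_eventually allI impI)
    fix s assume s: "s \<noteq> t" "s \<in> {0..}"
    define m where "m = min s t"
    have m: "0 \<le> m" "max s t = m + \<bar>s - t\<bar>" using s assms by (auto simp: m_def)
    have "T m (q \<bar>s - t\<bar>) = (T m (T \<bar>s - t\<bar> x) - T m x) /\<^sub>R \<bar>s - t\<bar>"
      unfolding q_def using m xy T_in YD by (simp add: T_scaleR T_diff)
    also have "T m (T \<bar>s - t\<bar> x) = T (max s t) x" using m xy by (simp add: T_add)
    finally have e: "T m (q \<bar>s - t\<bar>) = (T (max s t) x - T m x) /\<^sub>R \<bar>s - t\<bar>" .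
    show "T (min s t) (q \<bar>s - t\<bar>) = (T s x - T t x) /\<^sub>R (s - t)"
    proof (cases "s < t")
      case True
      then show ?thesis using e unfolding m_def
        by (simp add: max_def min_def) (metis inverse_minus_eq minus_diff_eq scaleR_minus_left scaleR_minus_right)
    next
      case False
      then show ?thesis using e s unfolding m_def by (simp add: max_def min_def)
    qed
  qed
  ultimately show ?thesis
    unfolding has_vector_derivative_iff_quotient using tendsto_cong by fast
qed

lemma G_T: "(x, y) \<in> G \<Longrightarrow> 0 \<le> t \<Longrightarrow> (T t x, T t y) \<in> G"
proof -
  assume A: "(x, y) \<in> G" "0 \<le> t"
  note xy = G_in[OF A(1)]
  have "((\<lambda>h. T t ((T h x - x) /\<^sub>R h)) \<longlongrightarrow> T t y) (at_right 0)"
    using A xy T_in YD unfolding eventually_at_right_field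
    by (intro bounded_operator_on_tendsto[OF bo Y]) (auto simp: G_iff eventually_at_right_field intro!: exI[of _ 1])
  moreover have "\<forall>\<^sub>F h in at_right 0. T t ((T h x - x) /\<^sub>R h) = (T h (T t x) - T t x) /\<^sub>R h"
    unfolding eventually_at_right_field
  proof (intro exI[of _ 1] conjI allI impI)
    fix h :: real assume "0 < h"
    then show "T t ((T h x - x) /\<^sub>R h) = (T h (T t x) - T t x) /\<^sub>R h"
      using A xy T_in YD T_add[of t h x] T_add[of h t x] by (simp add: T_scaleR T_diff add.commute)
  qed auto
  ultimately have "((\<lambda>h. (T h (T t x) - T t x) /\<^sub>R h) \<longlongrightarrow> T t y) (at_right 0)"
    using tendsto_cong by fast
  then show ?thesis using xy A T_in by (simp add: G_iff)
qed

lemma G_integral: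
  assumes "(x, y) \<in> G" "0 \<le> t"
  shows "((\<lambda>s. T s y) has_integral (T t x - x)) {0..t}"
proof -
  have "((\<lambda>s. T s y) has_integral (T t x - T 0 x)) {0..t}"
    using assms by (intro fundamental_theorem_of_calculus)
      (auto intro!: has_vector_derivative_within_subset[OF G_deriv[OF assms(1)]])
  then show ?thesis using T_0 G_in[OF assms(1)] by simp
qed

text \<open>Dividing the integral equation by t and letting t \<rightarrow> 0 gives the defining
  limit. Unlike difference quotients, integral equations survive limits of operators and vectors, so
  membership in a generator is mostly proved this way.\<close>

lemma G_I:
  assumes "x \<in> Y" "y \<in> Y" "0 < b" "\<And>t. 0 \<le> t \<Longrightarrow> t \<le> b \<Longrightarrow> integral {0..t} (\<lambda>s. T s y) = T t x - x"
  shows "(x, y) \<in> G"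
proof -
  have "((\<lambda>u. integral {0..u} (\<lambda>s. T s y)) has_vector_derivative T 0 y) (at 0 within {0..b})"
    using assms(2,3) T_cont' by (intro integral_has_vector_derivative) auto
  then have "((\<lambda>u. integral {0..u} (\<lambda>s. T s y) /\<^sub>R u) \<longlongrightarrow> y) (at_right 0)"
    using assms(2,3) T_0 by (simp add: has_vector_derivative_iff_quotient at_within_Icc_at_right)
  moreover have "\<forall>\<^sub>F u in at_right 0. integral {0..u} (\<lambda>s. T s y) /\<^sub>R u = (T u x - x) /\<^sub>R u"
    unfolding eventually_at_right_field using assms(3,4) by (intro exI[of _ b]) auto
  ultimately show ?thesis using assms(1) unfolding G_iff using tendsto_cong by fast
qed

lemma T_integral_bound:
  assumes "y \<in> Y" "0 \<le> t" "\<And>s x. s \<in> {0..t} \<Longrightarrow> x \<in> Y \<Longrightarrow> norm (T s x) \<le> K * norm x"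
  shows "norm (integral {0..t} (\<lambda>s. T s y)) \<le> K * t * norm y"
proof -
  have "norm (integral {0..t} (\<lambda>s. T s y)) \<le> (K * norm y) * (t - 0)"
    using assms by (intro integral_bound T_cont') auto
  then show ?thesis by (simp add: mult_ac)
qed

lemma G_linear:
  shows "(0, 0) \<in> G" "(x, y) \<in> G \<Longrightarrow> (x', y') \<in> G \<Longrightarrow> (x - x', y - y') \<in> G"
    "(x, y) \<in> G \<Longrightarrow> (a *\<^sub>C x, a *\<^sub>C y) \<in> G" "subspace G" "single_valued G"
proof -
  have cg: "\<And>f g. (f \<longlongrightarrow> l) (at_right 0) \<Longrightarrow> (\<And>h. 0 < h \<Longrightarrow> f h = g h) \<Longrightarrow> (g \<longlongrightarrow> l) (at_right 0)"
    for l :: 'x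
    by (rule Lim_transform_eventually) (auto simp: eventually_at_filter)
  show z: "(0, 0) \<in> G"
    unfolding G_iff using YD(2) bounded_operator_onD(6)[OF bo Y]
    by (auto intro!: cg[OF tendsto_const])
  show d: "(x - x', y - y') \<in> G" if "(x, y) \<in> G" "(x', y') \<in> G" for x y x' y'
    unfolding G_iff
  proof
    show "((\<lambda>h. (T h (x - x') - (x - x')) /\<^sub>R h) \<longlongrightarrow> y - y') (at_right 0)"
    proof (rule cg)
      show "((\<lambda>h. (T h x - x) /\<^sub>R h - (T h x' - x') /\<^sub>R h) \<longlongrightarrow> y - y') (at_right 0)"
        using that by (auto simp: G_iff intro: tendsto_diff)
    qed (use that in \<open>auto simp: G_iff T_diff scaleR_diff_right\<close>)
  qed (rule YD(7)[OF G_in(1)[OF that(1)] G_in(1)[OF that(2)]])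
  show c: "(a *\<^sub>C x, a *\<^sub>C y) \<in> G" if "(x, y) \<in> G" for a x y
    unfolding G_iff
  proof
    show "((\<lambda>h. (T h (a *\<^sub>C x) - (a *\<^sub>C x)) /\<^sub>R h) \<longlongrightarrow> a *\<^sub>C y) (at_right 0)"
    proof -
      have "((\<lambda>h. (T h x - x) /\<^sub>R h) \<longlongrightarrow> y) (at_right 0)" using that by (simp add: G_iff)
      from scaleC.tendsto[OF tendsto_const this, of a] show ?thesis
        by (rule cg) (use that in \<open>simp add: G_iff T_scaleC scaleC.diff_right scaleC_scaleR\<close>)
    qed
  qed (rule YD(4)[OF G_in(1)[OF that]])
  have r: "(r *\<^sub>R x, r *\<^sub>R y) \<in> G" if "(x, y) \<in> G" for r x y
    using c[OF that, of "of_real r"] by (simp add: scaleC_of_real)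
  have "(x + x', y + y') \<in> G" if "(x, y) \<in> G" "(x', y') \<in> G" for x y x' y'
    using d[OF that(1) r[OF that(2), of "-1"]] by simp
  with z r show "subspace G" by (auto simp: subspace_def zero_prod_def)
  show "single_valued G"
    by (intro single_valuedI) (auto simp: G_iff intro: tendsto_unique[OF trivial_limit_at_right_real])
qed

lemma G_closed: "closed G"
proof (unfold closed_sequential_limits, intro allI impI, elim conjE)
  fix p l assume p: "\<forall>n. p n \<in> G" and l: "p \<longlonglongrightarrow> l"
  define x y where "x n = fst (p n)" and "y n = snd (p n)" for n
  have xy: "(x n, y n) \<in> G" for n using p by (simp add: x_def y_def)
  obtain a b where ab: "l = (a, b)" by fastforce
  have x: "x \<longlonglongrightarrow> a" and y: "y \<longlonglongrightarrow> b" using tendsto_fst[OF l] tendsto_snd[OF l] by (simp_all add: x_def[abs_def] y_def[abs_def] ab)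
  have aY: "a \<in> Y" and bY: "b \<in> Y" using closed_sequentially[OF YD(1)] x y xy G_in by metis+
  have "(a, b) \<in> G"
  proof (rule G_I[OF aY bY zero_less_one])
    fix t :: real assume t: "0 \<le> t" "t \<le> 1"
    obtain K where K: "\<And>s x. s \<in> {0..t} \<Longrightarrow> x \<in> Y \<Longrightarrow> norm (T s x) \<le> K * norm x"
      using local_bound[of t] by blast
    have "(\<lambda>n. (T t (x n) - x n) - integral {0..t} (\<lambda>s. T s b)) \<longlonglongrightarrow> 0"
    proof (rule Lim_null_comparison)
      show "(\<lambda>n. K * t * norm (y n - b)) \<longlonglongrightarrow> 0" using y by (auto intro!: tendsto_eq_intros)
      show "\<forall>\<^sub>F n in sequentially. norm ((T t (x n) - x n) - integral {0..t} (\<lambda>s. T s b)) \<le> K * t * norm (y n - b)"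
      proof (intro always_eventually allI)
        fix n
        note yn = G_in(2)[OF xy[of n]]
        have "(T t (x n) - x n) - integral {0..t} (\<lambda>s. T s b) = integral {0..t} (\<lambda>s. T s (y n)) - integral {0..t} (\<lambda>s. T s b)"
          using integral_unique[OF G_integral[OF xy t(1)]] by simp
        also have "\<dots> = integral {0..t} (\<lambda>s. T s (y n) - T s b)"
          using yn bY T_cont' by (intro integral_diff[symmetric] integrable_continuous_real) auto
        also have "\<dots> = integral {0..t} (\<lambda>s. T s (y n - b))"
          using yn bY by (intro integral_cong) (auto simp: T_diff)
        finally show "norm ((T t (x n) - x n) - integral {0..t} (\<lambda>s. T s b)) \<le> K * t * norm (y n - b)"
          using T_integral_bound[OF _ t(1) K] yn bY YD(7) by simp
      qed
    qed
    moreover have "(\<lambda>n. (T t (x n) - x n) - integral {0..t} (\<lambda>s. T s b)) \<longlonglongrightarrow> (T t a - a) - integral {0..t} (\<lambda>s. T s b)"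
      using G_in[OF xy] t by (intro tendsto_intros T_tendsto x aY) auto
    ultimately show "integral {0..t} (\<lambda>s. T s b) = T t a - a" using LIMSEQ_unique by fastforce
  qed
  then show "l \<in> G" by (simp add: ab)
qed

section \<open>Truncated Laplace transforms and the resolvent of the generator\<close>

lemma exp_scaled_deriv:
  assumes "(x, y) \<in> G" "0 \<le> t"
  shows "((\<lambda>s. exp (- (z * of_real s)) *\<^sub>C T s x) has_vector_derivative - (exp (- (z * of_real t)) *\<^sub>C T t (z *\<^sub>C x - y))) (at t within {0..})"
proof -
  have "((\<lambda>s. exp (- (z * of_real s))) has_vector_derivative (- z) * exp (- (z * of_real t))) (at t within {0..})"
    by (rule has_vector_derivative_real_field) (auto intro!: derivative_eq_intros)
  from scaleC.has_vector_derivative[OF this G_deriv[OF assms]]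
  show ?thesis
    by (rule has_vector_derivative_eq_rhs)
      (use G_in[OF assms(1)] assms(2) YD in \<open>simp add: T_diff T_scaleC scaleC.diff_right scaleC_scaleC scaleC.minus_left mult.commute\<close>)
qed

lemma exp_scaled_integral:
  assumes "(x, y) \<in> G" "0 \<le> t"
  shows "((\<lambda>s. exp (- (z * of_real s)) *\<^sub>C T s (z *\<^sub>C x - y)) has_integral (x - exp (- (z * of_real t)) *\<^sub>C T t x)) {0..t}"
proof -
  have "((\<lambda>s. - (exp (- (z * of_real s)) *\<^sub>C T s (z *\<^sub>C x - y))) has_integral
      (exp (- (z * of_real t)) *\<^sub>C T t x - exp (- (z * of_real 0)) *\<^sub>C T 0 x)) {0..t}"
    using assms by (intro fundamental_theorem_of_calculus)
      (auto intro!: has_vector_derivative_within_subset[OF exp_scaled_deriv[OF assms(1)]])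
  from has_integral_neg[OF this] show ?thesis using T_0 G_in[OF assms(1)] by simp
qed

context
  fixes K \<omega> :: real
  assumes KT: "\<And>t x. t \<ge> 0 \<Longrightarrow> x \<in> Y \<Longrightarrow> norm (T t x) \<le> K * exp (\<omega> * t) * norm x"
begin

lemma exp_scaled_norm:
  assumes "0 \<le> t" "x \<in> Y"
  shows "norm (exp (- (z * of_real t)) *\<^sub>C T t x) \<le> K * norm x * exp (- ((Re z - \<omega>) * t))"
proof -
  have "norm (exp (- (z * of_real t)) *\<^sub>C T t x) = exp (- (Re z * t)) * norm (T t x)"
    by (simp add: norm_scaleC norm_exp_eq_Re)
  also have "\<dots> \<le> exp (- (Re z * t)) * (K * exp (\<omega> * t) * norm x)" using KT[OF assms] by simp
  also have "\<dots> = K * norm x * (exp (- (Re z * t)) * exp (\<omega> * t))" by (simp add: mult_ac)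
  also have "exp (- (Re z * t)) * exp (\<omega> * t) = exp (- ((Re z - \<omega>) * t))"
    by (simp add: exp_add[symmetric] algebra_simps)
  finally show ?thesis .
qed

lemma exp_scaled_tendsto:
  assumes "Re z > \<omega>" "x \<in> Y"
  shows "((\<lambda>t. exp (- (z * of_real t)) *\<^sub>C T t x) \<longlongrightarrow> 0) at_top"
proof (rule Lim_null_comparison)
  show "\<forall>\<^sub>F t in at_top. norm (exp (- (z * of_real t)) *\<^sub>C T t x) \<le> K * norm x * exp (- ((Re z - \<omega>) * t))"
    using eventually_ge_at_top[of 0] by eventually_elim (rule exp_scaled_norm[OF _ assms(2)])
  have "filterlim (\<lambda>t. (Re z - \<omega>) * t) at_top at_top"
    using assms(1) by (intro filterlim_tendsto_pos_mult_at_top[OF tendsto_const] filterlim_ident) auto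
  then have "((\<lambda>t. exp (- ((Re z - \<omega>) * t))) \<longlongrightarrow> 0) at_top"
    by (intro filterlim_compose[OF exp_at_bot] filterlim_uminus_at_bot_at_top[THEN filterlim_compose])
  then show "((\<lambda>t. K * norm x * exp (- ((Re z - \<omega>) * t))) \<longlongrightarrow> 0) at_top" by (rule tendsto_mult_right_zero)
qed

text \<open>By \<open>exp_scaled_integral\<close>, x - e^(-zt) T(t) x is the Laplace integral of (z
  - G) x cut off at t. Estimating it and then letting t \<rightarrow> \<infinity> avoids an improper
  integral.\<close>

lemma G_apriori:
  assumes "(x, y) \<in> G" "Re z > \<omega>"
  shows "(Re z - \<omega>) * norm x \<le> K * norm (z *\<^sub>C x - y)"
proof -
  note xy = G_in[OF assms(1)]
  define a w where "a = Re z - \<omega>" and "w = z *\<^sub>C x - y"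
  have a: "a > 0" using assms by (simp add: a_def)
  have wY: "w \<in> Y" using xy YD by (simp add: w_def)
  \<comment> \<open>No sign of \<open>K\<close> is assumed; the growth bound at time 0 supplies
    it.\<close>
  have Kw: "0 \<le> K * norm w" using KT[of 0 w] wY T_0 by simp (metis norm_ge_zero order_trans)
  have le: "norm (x - exp (- (z * of_real t)) *\<^sub>C T t x) \<le> K * norm w / a" if t: "0 \<le> t" for t
  proof -
    have i: "((\<lambda>s. K * norm w * exp (- (a * s))) has_integral (- (K * norm w / a) * exp (- (a * t)) - (- (K * norm w / a) * exp (- (a * 0))))) {0..t}"
      using t a by (intro fundamental_theorem_of_calculus)
        (auto simp: has_real_derivative_iff_has_vector_derivative[symmetric] intro!: derivative_eq_intros)
    have "norm (x - exp (- (z * of_real t)) *\<^sub>C T t x) \<le> K * norm w / a * (1 - exp (- (a * t)))"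
    proof -
      have "norm (integral {0..t} (\<lambda>s. exp (- (z * of_real s)) *\<^sub>C T s w)) \<le> integral {0..t} (\<lambda>s. K * norm w * exp (- (a * s)))"
        using i exp_scaled_integral[OF assms(1) t] exp_scaled_norm[OF _ wY]
        by (intro integral_norm_bound_integral) (auto simp: w_def a_def)
      moreover have "integral {0..t} (\<lambda>s. K * norm w * exp (- (a * s))) = K * norm w / a * (1 - exp (- (a * t)))"
        using integral_unique[OF i] by (simp add: right_diff_distrib)
      ultimately show ?thesis
        using integral_unique[OF exp_scaled_integral[OF assms(1) t, of z]] by (simp only: w_def)
    qed
    also have "\<dots> \<le> K * norm w / a * 1" using Kw a by (intro mult_left_mono) auto
    finally show ?thesis by simp
  qed
  have "norm (x - 0) \<le> K * norm w / a"
  proof (rule tendsto_upperbound)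
    show "((\<lambda>t. norm (x - exp (- (z * of_real t)) *\<^sub>C T t x)) \<longlongrightarrow> norm (x - 0)) at_top"
      by (intro tendsto_intros exp_scaled_tendsto assms(2) xy)
    show "\<forall>\<^sub>F t in at_top. norm (x - exp (- (z * of_real t)) *\<^sub>C T t x) \<le> K * norm w / a"
      using eventually_ge_at_top[of 0] by eventually_elim (rule le)
  qed simp
  then show ?thesis using a by (simp add: a_def w_def field_simps)
qed

text \<open>For x in the domain, the truncated Laplace integral of the orbit is a preimage of x -
  e^(-zt) T(t) x, and this tends to x. Since the range is closed, it contains the closure of the
  domain.\<close>

lemma G_surj:
  assumes dense: "Y \<subseteq> closure (Domain G)" and z: "Re z > \<omega>" and "w \<in> Y"
  shows "\<exists>x. (x, z *\<^sub>C x - w) \<in> G"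
proof -
  define R where "R = {w. \<exists>x. (x, z *\<^sub>C x - w) \<in> G}"
  have "closed R" unfolding R_def
  proof (rule closed_range_of_apriori[OF G_closed])
    show "norm u \<le> K / (Re z - \<omega>) * norm (z *\<^sub>C u - v)" if "(u, v) \<in> G" for u v
      using G_apriori[OF that z] z by (simp add: field_simps)
  qed (rule G_linear(2))
  moreover have "Domain G \<subseteq> R"
  proof
    fix x assume "x \<in> Domain G"
    then obtain y where xy: "(x, y) \<in> G" by blast
    note xyY = G_in[OF xy]
    have "x - exp (- (z * of_real t)) *\<^sub>C T t x \<in> R" if t: "0 \<le> t" for t
    proof -
      define f g where "f s = exp (- (z * of_real s)) *\<^sub>C T s x" and "g s = exp (- (z * of_real s)) *\<^sub>C T s y" for s
      have fg: "(f s, g s) \<in> G" if "s \<in> {0..t}" for s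
        unfolding f_def g_def using that by (intro G_linear(3) G_T xy) auto
      have cont: "continuous_on {0..t} f" "continuous_on {0..t} g"
        unfolding f_def g_def using xyY T_cont' by (intro scaleC.continuous_on continuous_intros; simp)+
      \<comment> \<open>The orbit is integrated as a curve in the closed graph of \<open>G\<close>,
        so the pair of integrals is again in \<open>G\<close>.\<close>
      have "((\<lambda>s. (f s, g s)) has_integral integral {0..t} (\<lambda>s. (f s, g s))) {0..t}"
        by (intro integrable_integral integrable_continuous_real continuous_intros cont)
      then have 1: "integral {0..t} (\<lambda>s. (f s, g s)) \<in> G"
        by (rule has_integral_in_closed_subspace[OF G_closed G_linear(4), rotated]) (rule fg)
      have fgi: "(\<lambda>s. (f s, g s)) integrable_on {0..t}" by (intro integrable_continuous_real continuous_intros cont)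
      have 2: "integral {0..t} (\<lambda>s. (f s, g s)) = (integral {0..t} f, integral {0..t} g)"
        using integral_linear[OF fgi bounded_linear_fst] integral_linear[OF fgi bounded_linear_snd]
        by (simp add: o_def prod_eq_iff)
      have "((\<lambda>s. z *\<^sub>C f s - g s) has_integral (z *\<^sub>C integral {0..t} f - integral {0..t} g)) {0..t}"
        by (intro has_integral_diff has_integral_linear[OF _ scaleC.bounded_linear_right, unfolded o_def]
            integrable_integral integrable_continuous_real cont)
      moreover have "z *\<^sub>C f s - g s = exp (- (z * of_real s)) *\<^sub>C T s (z *\<^sub>C x - y)" if "s \<in> {0..t}" for s
        using that xyY YD by (simp add: f_def g_def T_diff T_scaleC scaleC.diff_right scaleC_scaleC mult.commute)
      ultimately have "((\<lambda>s. exp (- (z * of_real s)) *\<^sub>C T s (z *\<^sub>C x - y)) has_integral (z *\<^sub>C integral {0..t} f - integral {0..t} g)) {0..t}"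
        by (rule has_integral_eq[rotated]) auto
      then have e: "z *\<^sub>C integral {0..t} f - integral {0..t} g = x - exp (- (z * of_real t)) *\<^sub>C T t x"
        using exp_scaled_integral[OF xy t] has_integral_unique by blast
      then have "integral {0..t} g = z *\<^sub>C integral {0..t} f - (x - exp (- (z * of_real t)) *\<^sub>C T t x)"
        unfolding e[symmetric] by simp
      then show ?thesis using 1 unfolding 2 R_def by auto
    qed
    moreover have "((\<lambda>t. x - exp (- (z * of_real t)) *\<^sub>C T t x) \<longlongrightarrow> x - 0) at_top"
      by (intro tendsto_intros exp_scaled_tendsto z xyY)
    ultimately show "x \<in> R"
      using Lim_in_closed_set[OF \<open>closed R\<close> eventually_mono[OF eventually_ge_at_top[of 0]] trivial_limit_at_top_linorder,
          of "\<lambda>t. x - exp (- (z * of_real t)) *\<^sub>C T t x" x] by simp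
  qed
  ultimately have "closure (Domain G) \<subseteq> R" by (rule closure_minimal[rotated])
  then show ?thesis using dense assms(3) by (auto simp: R_def)
qed

text \<open>A restriction \<open>Q\<close> of \<open>G\<close> with z - Q onto \<open>Y\<close>
  cannot be proper because z - G is injective by \<open>G_apriori\<close>. This decides both
  identifications of generators below.\<close>

lemma G_eqI:
  assumes "Q \<subseteq> G" "Re z > \<omega>" "\<And>w. w \<in> Y \<Longrightarrow> \<exists>x. (x, z *\<^sub>C x - w) \<in> Q"
  shows "G = Q"
proof (rule subset_antisym[OF subrelI assms(1)])
  fix x y assume xy: "(x, y) \<in> G"
  define w where "w = z *\<^sub>C x - y"
  have "w \<in> Y" using G_in[OF xy] YD by (simp add: w_def)
  then obtain x' where x': "(x', z *\<^sub>C x' - w) \<in> Q" using assms(3) by blast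
  then have "(Re z - \<omega>) * norm (x - x') \<le> K * norm (z *\<^sub>C (x - x') - (y - (z *\<^sub>C x' - w)))"
    using assms(1,2) by (intro G_apriori G_linear(2) xy) auto
  then have "(Re z - \<omega>) * norm (x - x') \<le> 0" by (simp add: w_def scaleC.diff_right)
  then have "x = x'" using assms(2) by (simp add: mult_le_0_iff)
  then show "(x, y) \<in> Q" using x' by (simp add: w_def)
qed

end

lemma G_deriv_reflect:
  assumes "(x, y) \<in> G" "s \<in> {0..t}"
  shows "((\<lambda>\<sigma>. T (t - \<sigma>) x) has_vector_derivative - T (t - s) y) (at s within {0..t})"
proof -
  have d: "((\<lambda>\<sigma>. t - \<sigma>) has_vector_derivative - 1) (at s within {0..t})"
    by (auto intro!: derivative_eq_intros)
  have "((\<lambda>u. T u x) has_vector_derivative T (t - s) y) (at (t - s) within (\<lambda>\<sigma>. t - \<sigma>) ` {0..t})"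
    using assms by (intro has_vector_derivative_within_subset[OF G_deriv]) auto
  from vector_diff_chain_within[OF d this] show ?thesis by (simp add: o_def)
qed

end

text \<open>For \<open>Q\<close> the identity this is the uniqueness of the semigroup generated by an operator.\<close>

lemma semigroup_intertwining:
  fixes Q :: "'x::complex_banach \<Rightarrow> 'x"
  assumes T: "c0_sg Y T" and S: "c0_sg Z S" and Q: "bounded_linear Q" "\<And>x. x \<in> Z \<Longrightarrow> Q x \<in> Y"
    and QG: "\<And>x y. (x, y) \<in> generator Z S \<Longrightarrow> (Q x, Q y) \<in> generator Y T"
    and dense: "Z \<subseteq> closure (Domain (generator Z S))" and t: "0 \<le> t" and x: "x \<in> Z"
  shows "Q (S t x) = T t (Q x)"
proof -
  interpret T: c0_sg Y T by fact
  interpret S: c0_sg Z S by fact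
  interpret Q: bounded_linear Q by fact
  note QG' = QG[folded T.G_def S.G_def]
  \<comment> \<open>On the domain, T(t - \<sigma>) Q S(\<sigma>) x interpolates between the two
    sides and has derivative zero in \<sigma>; density extends the equality to
    \<open>Z\<close>.\<close>
  have D: "Q (S t x) = T t (Q x)" if xy: "(x, y) \<in> S.G" for x y
  proof -
    obtain K where K: "\<And>s x. s \<in> {0..t} \<Longrightarrow> x \<in> Y \<Longrightarrow> norm (T s x) \<le> K * norm x"
      using T.local_bound[of t] by blast
    have "((\<lambda>\<sigma>. T (t - \<sigma>) (Q (S \<sigma> x))) has_vector_derivative 0) (at s within {0..t})" if s: "s \<in> {0..t}" for s
    proof -
      have "((\<lambda>\<sigma>. T (t - \<sigma>) (Q (S \<sigma> x))) has_vector_derivative (- T (t - s) (Q (S s y)) + T (t - s) (Q (S s y)))) (at s within {0..t})"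
      proof (rule product_rule_on[OF T.Y, where K = K and v' = "Q (S s y)" and F = "\<lambda>\<sigma>. T (t - \<sigma>)" and v = "\<lambda>\<sigma>. Q (S \<sigma> x)"])
        show "((\<lambda>\<sigma>. T (t - \<sigma>) (Q (S s x))) has_vector_derivative - T (t - s) (Q (S s y))) (at s within {0..t})"
          using s by (intro T.G_deriv_reflect QG' S.G_T xy) auto
        show "((\<lambda>\<sigma>. Q (S \<sigma> x)) has_vector_derivative Q (S s y)) (at s within {0..t})"
          using s by (intro Q.has_vector_derivative has_vector_derivative_within_subset[OF S.G_deriv[OF xy]]) auto
        show "((\<lambda>\<sigma>. T (t - \<sigma>) (Q (S s y))) \<longlongrightarrow> T (t - s) (Q (S s y))) (at s within {0..t})"
          using s Q(2) S.T_in S.G_in[OF xy]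
          by (intro T.T_tendsto tendsto_intros) (auto simp: eventually_at_filter)
      qed (use s Q(2) S.T_in S.G_in[OF xy] K in \<open>auto intro: T.T_diff T.T_scaleR\<close>)
      then show ?thesis by simp
    qed
    from derivative_zero_imp_eq[OF t this] have "T 0 (Q (S t x)) = T t (Q (S 0 x))" by simp
    then show ?thesis using S.G_in[OF xy] S.T_0 T.T_0 Q(2) S.T_in t by simp
  qed
  obtain f where f: "\<And>n. f n \<in> Domain S.G" "f \<longlonglongrightarrow> x"
    using dense x closure_sequential[of x "Domain S.G"] unfolding S.G_def by blast
  then have fZ: "f n \<in> Z" for n using S.G_in by blast
  have "(\<lambda>n. Q (S t (f n))) \<longlonglongrightarrow> Q (S t x)"
    using fZ t x by (intro Q.tendsto S.T_tendsto f) auto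
  moreover have "(\<lambda>n. T t (Q (f n))) \<longlonglongrightarrow> T t (Q x)"
    using fZ t x Q(2) by (intro Q.tendsto T.T_tendsto f) auto
  moreover have "Q (S t (f n)) = T t (Q (f n))" for n using f(1) D by blast
  ultimately show ?thesis using LIMSEQ_unique by auto
qed

section \<open>Resolvents and exponentials of bounded operators\<close>

lemma linear_operatorD:
  assumes "linear_operator T"
  shows "(x, y) \<in> T \<Longrightarrow> (x, y') \<in> T \<Longrightarrow> y = y'" "(0, 0) \<in> T"
    "(x, y) \<in> T \<Longrightarrow> (x', y') \<in> T \<Longrightarrow> (x + x', y + y') \<in> T"
    "(x, y) \<in> T \<Longrightarrow> (a *\<^sub>C x, a *\<^sub>C y) \<in> T"
    "(x, y) \<in> T \<Longrightarrow> (r *\<^sub>R x, r *\<^sub>R y) \<in> T"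
    "(x, y) \<in> T \<Longrightarrow> (x', y') \<in> T \<Longrightarrow> (x - x', y - y') \<in> T"
proof -
  have sv: "single_valued T" and
    add: "\<And>x y x' y'. (x, y) \<in> T \<Longrightarrow> (x', y') \<in> T \<Longrightarrow> (x + x', y + y') \<in> T" and
    sc: "\<And>a x y. (x, y) \<in> T \<Longrightarrow> (a *\<^sub>C x, a *\<^sub>C y) \<in> T" and z: "(0, 0) \<in> T"
    using assms by (auto simp: linear_operator_def)
  have sr: "\<And>r x y. (x, y) \<in> T \<Longrightarrow> (r *\<^sub>R x, r *\<^sub>R y) \<in> T"
    by (metis sc scaleC_of_real)
  show "(x, y) \<in> T \<Longrightarrow> (x, y') \<in> T \<Longrightarrow> y = y'" using sv by (auto simp: single_valued_def)
  show "(0, 0) \<in> T" "(x, y) \<in> T \<Longrightarrow> (x', y') \<in> T \<Longrightarrow> (x + x', y + y') \<in> T"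
    "(x, y) \<in> T \<Longrightarrow> (a *\<^sub>C x, a *\<^sub>C y) \<in> T" "(x, y) \<in> T \<Longrightarrow> (r *\<^sub>R x, r *\<^sub>R y) \<in> T"
    by (rule z add sc sr; assumption)+
  show "(x - x', y - y') \<in> T" if "(x, y) \<in> T" "(x', y') \<in> T"
    using add[OF that(1) sr[OF that(2), of "-1"]] by simp
qed

lemma closed_csubspace_Domain:
  assumes "linear_operator T" shows "closed_csubspace (closure (Domain T))"
  using linear_operatorD[OF assms] by (intro closed_csubspace_closure) blast+

section \<open>The resolvent of an operator given as a graph\<close>

context
  fixes T :: "'x::complex_banach operator" and z :: complex
  assumes z: "z \<in> resolvent_set T"
begin

lemma resolvent_mem: "(resolvent T z x, z *\<^sub>C resolvent T z x - x) \<in> T"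
proof -
  have "\<exists>!y. (y, x) \<in> shifted z T" using z by (auto simp: resolvent_set_def)
  then have "(resolvent T z x, x) \<in> shifted z T" unfolding resolvent_def by (rule theI')
  then obtain v where "(resolvent T z x, v) \<in> T" "x = z *\<^sub>C resolvent T z x - v"
    by (auto simp: shifted_def)
  then show ?thesis by (metis diff_diff_eq2 add_diff_cancel_left')
qed

lemma resolvent_eq: assumes "(u, v) \<in> T" shows "resolvent T z (z *\<^sub>C u - v) = u"
proof -
  have "\<exists>!y. (y, z *\<^sub>C u - v) \<in> shifted z T" using z by (auto simp: resolvent_set_def)
  moreover have "(u, z *\<^sub>C u - v) \<in> shifted z T" using assms by (auto simp: shifted_def)
  ultimately show ?thesis unfolding resolvent_def by (rule the1_equality)
qed

lemma resolvent_bounded_linear: "bounded_linear (resolvent T z)"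
  using z by (auto simp: resolvent_set_def)

lemma resolvent_inj: "resolvent T z x = resolvent T z y \<Longrightarrow> linear_operator T \<Longrightarrow> x = y"
  using resolvent_mem[of x] resolvent_mem[of y] linear_operatorD(1)[of T]
  by (metis diff_diff_eq2 add_diff_cancel_left')

lemma resolvent_scaleC:
  assumes "linear_operator T" shows "resolvent T z (a *\<^sub>C x) = a *\<^sub>C resolvent T z x"
proof -
  have "(a *\<^sub>C resolvent T z x, a *\<^sub>C (z *\<^sub>C resolvent T z x - x)) \<in> T"
    by (rule linear_operatorD(4)[OF assms resolvent_mem])
  from resolvent_eq[OF this] show ?thesis
    by (simp add: scaleC.diff_right scaleC_scaleC mult.commute)
qed

end

text \<open>The a priori estimate supplies injectivity and boundedness together, so a spectral point
  is excluded by one inequality and one existence statement.\<close>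

lemma resolvent_setI:
  assumes T: "linear_operator T"
    and ex: "\<And>x. \<exists>y. (y, z *\<^sub>C y - x) \<in> T"
    and ap: "\<And>u v. (u, v) \<in> T \<Longrightarrow> norm u \<le> K * norm (z *\<^sub>C u - v)"
  shows "z \<in> resolvent_set T" and "norm (resolvent T z x) \<le> K * norm x"
proof -
  note TD = linear_operatorD[OF T]
  have sh: "(y, x) \<in> shifted z T \<longleftrightarrow> (y, z *\<^sub>C y - x) \<in> T" for x y
    by (auto simp: shifted_def) (metis diff_diff_eq2 add_diff_cancel_left')
  have un: "y = y'" if "(y, z *\<^sub>C y - x) \<in> T" "(y', z *\<^sub>C y' - x) \<in> T" for x y y'
    using ap[OF TD(6)[OF that]] by (simp add: scaleC.diff_right)
  have ex1: "\<exists>!y. (y, x) \<in> shifted z T" for x using ex un unfolding sh by blast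
  have R: "(resolvent T z x, z *\<^sub>C resolvent T z x - x) \<in> T" for x
    using theI'[OF ex1] unfolding resolvent_def sh .
  have nb: "norm (resolvent T z x) \<le> K * norm x" for x using ap[OF R, of x] by simp
  have "bounded_linear (resolvent T z)"
  proof (rule bounded_linear_intro)
    show "resolvent T z (x + y) = resolvent T z x + resolvent T z y" for x y
      by (rule un[OF R]) (use TD(3)[OF R[of x] R[of y]] in \<open>simp add: scaleC.add_right algebra_simps\<close>)
    show "resolvent T z (r *\<^sub>R x) = r *\<^sub>R resolvent T z x" for r x
      by (rule un[OF R]) (use TD(5)[OF R[of x], of r] in \<open>simp add: scaleC_scaleR algebra_simps\<close>)
    show "norm (resolvent T z x) \<le> norm x * K" for x using nb[of x] by (simp add: mult.commute)
  qed
  then show "z \<in> resolvent_set T" using ex1 by (simp add: resolvent_set_def)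
  show "norm (resolvent T z x) \<le> K * norm x" by (rule nb)
qed

lemma resolvent_identity:
  assumes "linear_operator T" "z \<in> resolvent_set T" "w \<in> resolvent_set T"
  shows "resolvent T z x - resolvent T w x = (w - z) *\<^sub>C resolvent T z (resolvent T w x)"
proof -
  interpret bounded_linear "resolvent T z" by (rule resolvent_bounded_linear[OF assms(2)])
  define u where "u = resolvent T w x"
  have "resolvent T z (z *\<^sub>C u - (w *\<^sub>C u - x)) = u"
    unfolding u_def by (intro resolvent_eq resolvent_mem assms)
  moreover have "z *\<^sub>C u - (w *\<^sub>C u - x) = x - (w - z) *\<^sub>C u" by (simp add: scaleC.diff_left)
  ultimately have "resolvent T z x - (w - z) *\<^sub>C resolvent T z u = u"
    by (simp add: diff resolvent_scaleC[OF assms(2,1)])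
  then show ?thesis by (simp add: u_def algebra_simps)
qed

lemma resolvent_commute:
  assumes "linear_operator T" "z \<in> resolvent_set T" "w \<in> resolvent_set T"
  shows "resolvent T z (resolvent T w x) = resolvent T w (resolvent T z x)"
proof (cases "w = z")
  case False
  have "(w - z) *\<^sub>C resolvent T z (resolvent T w x) = (w - z) *\<^sub>C resolvent T w (resolvent T z x)"
    using resolvent_identity[OF assms, of x] resolvent_identity[OF assms(1,3,2), of x]
    by (metis minus_diff_eq scaleC.minus_left)
  then show ?thesis using False by (simp add: scaleC_cancel)
qed simp

section \<open>Exponentials of bounded operators\<close>

definition op_exp :: "('x \<Rightarrow> 'x) \<Rightarrow> real \<Rightarrow> 'x \<Rightarrow> 'x::complex_banach" where
  "op_exp Q t x = (\<Sum>k. (t ^ k / fact k) *\<^sub>R (Q ^^ k) x)"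

text \<open>The constant \<open>m\<close> is kept apart from the rate \<open>c\<close>: with bounds
  of the form M c^k on all powers, M stays in front of the exponential and does not enter the
  exponent. The uniform bound for the Yosida approximations depends on this.\<close>

lemma op_exp_summable:
  fixes Q :: "'x::complex_banach \<Rightarrow> 'x"
  assumes "\<And>k. norm ((Q ^^ k) x) \<le> m * c ^ k"
  shows "summable (\<lambda>k. norm ((t ^ k / fact k) *\<^sub>R (Q ^^ k) x))"
    and "summable (\<lambda>k. (t ^ k / fact k) *\<^sub>R (Q ^^ k) x)"
    and "norm (op_exp Q t x) \<le> m * exp (\<bar>t\<bar> * c)"
proof -
  have e: "(\<lambda>k. m * ((\<bar>t\<bar> * c) ^ k /\<^sub>R fact k)) sums (m * exp (\<bar>t\<bar> * c))"
    by (intro sums_mult exp_converges)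
  have le: "norm ((t ^ k / fact k) *\<^sub>R (Q ^^ k) x) \<le> m * ((\<bar>t\<bar> * c) ^ k /\<^sub>R fact k)" for k
  proof -
    have "norm ((t ^ k / fact k) *\<^sub>R (Q ^^ k) x) = \<bar>t\<bar> ^ k / fact k * norm ((Q ^^ k) x)"
      by (simp add: power_abs)
    also have "\<dots> \<le> \<bar>t\<bar> ^ k / fact k * (m * c ^ k)" by (intro mult_left_mono assms) auto
    finally show ?thesis by (simp add: power_mult_distrib divide_inverse mult_ac)
  qed
  show 1: "summable (\<lambda>k. norm ((t ^ k / fact k) *\<^sub>R (Q ^^ k) x))"
    by (rule summable_comparison_test'[OF sums_summable[OF e], of 0]) (use le in simp)
  then show "summable (\<lambda>k. (t ^ k / fact k) *\<^sub>R (Q ^^ k) x)" by (rule summable_norm_cancel)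
  show "norm (op_exp Q t x) \<le> m * exp (\<bar>t\<bar> * c)"
    unfolding op_exp_def sums_unique[OF e]
    by (rule order_trans[OF summable_norm[OF 1]]) (intro suminf_le le 1 sums_summable[OF e])
qed

context
  fixes Q :: "'x::complex_banach \<Rightarrow> 'x"
  assumes Q: "bounded_linear Q" and QC: "\<And>a x. Q (a *\<^sub>C x) = a *\<^sub>C Q x"
begin

interpretation Q: bounded_linear Q by (rule Q)

lemma op_pow: "bounded_linear (Q ^^ k)" and op_pow_scaleC: "(Q ^^ k) (a *\<^sub>C x) = a *\<^sub>C (Q ^^ k) x"
  and op_pow_commute: "(Q ^^ k) (Q x) = Q ((Q ^^ k) x)"
  by (induction k arbitrary: x) (auto simp: QC bounded_linear_ident[unfolded id_def[symmetric]] o_def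
      intro: bounded_linear_compose[OF Q])

lemma op_pow_norm: "norm ((Q ^^ k) x) \<le> norm x * onorm Q ^ k"
proof (induction k)
  case (Suc k)
  have "norm (Q ((Q ^^ k) x)) \<le> onorm Q * norm ((Q ^^ k) x)" by (rule onorm[OF Q])
  also have "\<dots> \<le> onorm Q * (norm x * onorm Q ^ k)" by (intro mult_left_mono Suc onorm_pos_le Q)
  finally show ?case by (simp add: mult_ac)
qed simp

lemmas op_exp_summable' = op_exp_summable(2)[OF op_pow_norm]
lemmas op_exp_norm' = op_exp_summable(3)[OF op_pow_norm]

lemma op_exp_sums: "(\<lambda>k. (t ^ k / fact k) *\<^sub>R (Q ^^ k) x) sums op_exp Q t x"
  unfolding op_exp_def by (rule summable_sums[OF op_exp_summable'])

lemma op_exp_linear: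
  "op_exp Q t (x + y) = op_exp Q t x + op_exp Q t y" "op_exp Q t (a *\<^sub>C x) = a *\<^sub>C op_exp Q t x"
  "op_exp Q t (r *\<^sub>R x) = r *\<^sub>R op_exp Q t x" "op_exp Q t (x - y) = op_exp Q t x - op_exp Q t y"
proof -
  show add: "op_exp Q t (x + y) = op_exp Q t x + op_exp Q t y" for x y
    using sums_add[OF op_exp_sums[of t x] op_exp_sums[of t y]] op_exp_sums[of t "x + y"]
    by (simp add: bounded_linear.linear[OF op_pow, THEN linear_add] scaleR_add_right sums_unique2)
  show sc: "op_exp Q t (a *\<^sub>C x) = a *\<^sub>C op_exp Q t x" for a x
    using bounded_linear.sums[OF scaleC.bounded_linear_right op_exp_sums[of t x], of a] op_exp_sums[of t "a *\<^sub>C x"]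
    by (simp add: op_pow_scaleC scaleC_scaleR sums_unique2)
  show sr: "op_exp Q t (r *\<^sub>R x) = r *\<^sub>R op_exp Q t x" for r x
    by (metis sc scaleC_of_real)
  show "op_exp Q t (x - y) = op_exp Q t x - op_exp Q t y"
    using add[of "x - y" y] by simp
qed

lemma op_exp_commute:
  assumes "bounded_linear P" "\<And>x. P (Q x) = Q (P x)"
  shows "P (op_exp Q t x) = op_exp Q t (P x)"
proof -
  have "P ((Q ^^ k) x) = (Q ^^ k) (P x)" for k by (induction k) (auto simp: assms(2))
  then have "(\<lambda>k. (t ^ k / fact k) *\<^sub>R (Q ^^ k) (P x)) sums P (op_exp Q t x)"
    using bounded_linear.sums[OF assms(1) op_exp_sums[of t x]]
    by (simp add: bounded_linear.linear[OF assms(1), THEN linear_scale])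
  then show ?thesis using op_exp_sums sums_unique2 by blast
qed

lemma op_exp_0: "op_exp Q 0 x = x"
proof -
  have "(\<lambda>k. (0 ^ k / fact k) *\<^sub>R (Q ^^ k) x) sums (\<Sum>k\<in>{0::nat}. (0 ^ k / fact k) *\<^sub>R (Q ^^ k) x)"
    by (rule sums_finite) auto
  then show ?thesis using op_exp_sums[of 0 x] sums_unique2 by fastforce
qed

lemma op_exp_uniform:
  "uniform_limit {0..b} (\<lambda>n t. \<Sum>k<n. (t ^ k / fact k) *\<^sub>R (Q ^^ k) x) (\<lambda>t. op_exp Q t x) sequentially"
  unfolding op_exp_def
proof (rule Weierstrass_m_test[where M = "\<lambda>k. norm ((b ^ k / fact k) *\<^sub>R (norm x * onorm Q ^ k))"])
  fix k :: nat and t :: real assume t: "t \<in> {0..b}"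
  have "t ^ k / fact k * norm ((Q ^^ k) x) \<le> b ^ k / fact k * (norm x * onorm Q ^ k)"
    using t by (intro mult_mono op_pow_norm divide_right_mono power_mono) auto
  moreover have "onorm Q \<ge> 0" by (rule onorm_pos_le[OF Q])
  ultimately show "norm ((t ^ k / fact k) *\<^sub>R (Q ^^ k) x) \<le> norm ((b ^ k / fact k) *\<^sub>R (norm x * onorm Q ^ k))"
    using t by simp
next
  have "summable (\<lambda>k. norm x * norm ((b * onorm Q) ^ k /\<^sub>R fact k))"
    by (intro summable_mult summable_norm_exp)
  then show "summable (\<lambda>k. norm ((b ^ k / fact k) *\<^sub>R (norm x * onorm Q ^ k)))"
    by (simp add: power_mult_distrib divide_inverse abs_mult mult_ac)
qed

lemma op_exp_continuous: "continuous_on {0..b} (\<lambda>t. op_exp Q t x)"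
  by (rule uniform_limit_theorem[OF always_eventually op_exp_uniform]) (auto intro!: continuous_intros)

text \<open>Integrating the uniformly convergent series term by term replaces differentiation of the
  series; the derivative follows from the fundamental theorem of calculus.\<close>

lemma op_exp_integral: assumes "0 \<le> t"
  shows "((\<lambda>s. op_exp Q s (Q x)) has_integral (op_exp Q t x - x)) {0..t}"
proof -
  define S where "S n s = (\<Sum>k<n. (s ^ k / fact k) *\<^sub>R (Q ^^ k) (Q x))" for n and s :: real
  obtain I J where IJ: "\<And>n. (S n has_integral I n) {0..t}" "((\<lambda>s. op_exp Q s (Q x)) has_integral J) {0..t}" "I \<longlonglongrightarrow> J"
    using uniform_limit_integral[OF op_exp_uniform[where b = t and x = "Q x", folded S_def[abs_def]]]
    by (force simp: S_def intro!: continuous_intros)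
  have "(S n has_integral (\<Sum>k<n. (t ^ Suc k / fact (Suc k)) *\<^sub>R (Q ^^ Suc k) x)) {0..t}" for n
    unfolding S_def
  proof (intro has_integral_sum finite_lessThan)
    fix k
    have "((\<lambda>s. (s ^ k / fact k) *\<^sub>R (Q ^^ k) (Q x)) has_integral
      ((t ^ Suc k / fact (Suc k)) *\<^sub>R (Q ^^ k) (Q x) - (0 ^ Suc k / fact (Suc k)) *\<^sub>R (Q ^^ k) (Q x))) {0..t}"
      using assms
    proof (rule fundamental_theorem_of_calculus)
      fix s :: real
      have "((\<lambda>s. s ^ Suc k / fact (Suc k)) has_real_derivative (s ^ k / fact k)) (at s within {0..t})"
        using DERIV_cdivide[OF DERIV_pow[of "Suc k" s], of "fact (Suc k)"] by (simp del: of_nat_Suc)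
      then show "((\<lambda>s. (s ^ Suc k / fact (Suc k)) *\<^sub>R (Q ^^ k) (Q x)) has_vector_derivative (s ^ k / fact k) *\<^sub>R (Q ^^ k) (Q x)) (at s within {0..t})"
        using has_vector_derivative_scaleR[OF _ has_vector_derivative_const] by fastforce
    qed
    then show "((\<lambda>s. (s ^ k / fact k) *\<^sub>R (Q ^^ k) (Q x)) has_integral (t ^ Suc k / fact (Suc k)) *\<^sub>R (Q ^^ Suc k) x) {0..t}"
      by (simp add: op_pow_commute)
  qed
  then have "I = (\<lambda>n. \<Sum>k<n. (t ^ Suc k / fact (Suc k)) *\<^sub>R (Q ^^ Suc k) x)"
    using IJ(1) has_integral_unique by blast
  \<comment> \<open>Termwise integration raises every index by one, so the series for
    \<open>op_exp Q t x\<close> comes back without its zeroth term \<open>x\<close>.\<close>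
  moreover have "(\<lambda>k. (t ^ Suc k / fact (Suc k)) *\<^sub>R (Q ^^ Suc k) x) sums (op_exp Q t x - x)"
    using op_exp_sums[of t x] by (subst sums_Suc_iff) simp
  ultimately have "J = op_exp Q t x - x" using IJ(3) LIMSEQ_unique unfolding sums_def by blast
  then show ?thesis using IJ(2) by simp
qed

lemma op_exp_deriv: assumes "t \<in> {0..b}"
  shows "((\<lambda>t. op_exp Q t x) has_vector_derivative op_exp Q t (Q x)) (at t within {0..b})"
proof -
  have "((\<lambda>u. integral {0..u} (\<lambda>s. op_exp Q s (Q x)) + x) has_vector_derivative op_exp Q t (Q x)) (at t within {0..b})"
    using integral_has_vector_derivative[OF op_exp_continuous assms, of "Q x"]
    by (simp add: has_vector_derivative_add_const)
  then show ?thesis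
    by (rule has_vector_derivative_transform[OF assms, rotated])
       (use integral_unique[OF op_exp_integral] in auto)
qed

text \<open>The function \<sigma> \<mapsto> e^((s + t - \<sigma>) Q) e^(\<sigma> Q) x has derivative
  zero on [0, t]; its end values are the two sides.\<close>

lemma op_exp_add: assumes "0 \<le> s" "0 \<le> t" shows "op_exp Q (s + t) x = op_exp Q s (op_exp Q t x)"
proof -
  define a where "a = s + t"
  have "((\<lambda>\<sigma>. op_exp Q (a - \<sigma>) (op_exp Q \<sigma> x)) has_vector_derivative 0) (at u within {0..t})" if u: "u \<in> {0..t}" for u
  proof -
    have "((\<lambda>\<sigma>. op_exp Q (a - \<sigma>) (op_exp Q \<sigma> x)) has_vector_derivative
        (- op_exp Q (a - u) (Q (op_exp Q u x)) + op_exp Q (a - u) (op_exp Q u (Q x)))) (at u within {0..t})"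
    proof (rule product_rule_on[where Y = UNIV and v' = "op_exp Q u (Q x)" and K = "exp (a * onorm Q)" and
          F = "\<lambda>\<sigma>. op_exp Q (a - \<sigma>)" and v = "\<lambda>\<sigma>. op_exp Q \<sigma> x"])
      show "norm (op_exp Q (a - \<sigma>) x) \<le> exp (a * onorm Q) * norm x" if "\<sigma> \<in> {0..t}" for \<sigma> x
      proof -
        have "\<bar>a - \<sigma>\<bar> * onorm Q \<le> a * onorm Q"
          using that assms onorm_pos_le[OF Q] by (intro mult_right_mono) (auto simp: a_def)
        then have "norm x * exp (\<bar>a - \<sigma>\<bar> * onorm Q) \<le> norm x * exp (a * onorm Q)" by (intro mult_left_mono) auto
        then show ?thesis using op_exp_norm'[of "a - \<sigma>" x] by (simp add: mult.commute)
      qed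
      have d: "((\<lambda>\<sigma>. a - \<sigma>) has_vector_derivative - 1) (at u within {0..t})"
        by (auto intro!: derivative_eq_intros)
      have "((\<lambda>\<sigma>. op_exp Q \<sigma> y) has_vector_derivative op_exp Q (a - u) (Q y)) (at (a - u) within (\<lambda>\<sigma>. a - \<sigma>) ` {0..t})" for y
        using assms u by (intro has_vector_derivative_within_subset[OF op_exp_deriv[where b = a]]) (auto simp: a_def)
      from vector_diff_chain_within[OF d this]
      have d2: "((\<lambda>\<sigma>. op_exp Q (a - \<sigma>) y) has_vector_derivative - op_exp Q (a - u) (Q y)) (at u within {0..t})" for y
        by (simp add: o_def)
      then show "((\<lambda>\<sigma>. op_exp Q (a - \<sigma>) (op_exp Q u x)) has_vector_derivative - op_exp Q (a - u) (Q (op_exp Q u x))) (at u within {0..t})" .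
      show "((\<lambda>\<sigma>. op_exp Q (a - \<sigma>) (op_exp Q u (Q x))) \<longlongrightarrow> op_exp Q (a - u) (op_exp Q u (Q x))) (at u within {0..t})"
        using has_vector_derivative_continuous[OF d2] by (simp add: continuous_within)
      show "((\<lambda>\<sigma>. op_exp Q \<sigma> x) has_vector_derivative op_exp Q u (Q x)) (at u within {0..t})"
        by (rule op_exp_deriv[OF u])
    qed (use u in \<open>auto simp: op_exp_linear closed_csubspace_def\<close>)
    moreover have "Q (op_exp Q u x) = op_exp Q u (Q x)" by (rule op_exp_commute[OF Q]) simp
    ultimately show ?thesis by simp
  qed
  from derivative_zero_imp_eq[OF assms(2) this] show ?thesis by (simp add: a_def op_exp_0)
qed

text \<open>This is the semigroup of the bounded operator Q - r, with e^(-rt) split off so that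
  power bounds for Q alone can be used. Partial sums of the series show that closed Q-invariant
  subspaces are preserved.\<close>

lemma scaled_op_exp_c0:
  assumes Y: "closed_csubspace Y" and QY: "\<And>x. x \<in> Y \<Longrightarrow> Q x \<in> Y"
  shows "c0_sg Y (\<lambda>t x. exp (- (r * t)) *\<^sub>R op_exp Q t x)"
    and "x \<in> Y \<Longrightarrow> (x, Q x - r *\<^sub>R x) \<in> generator Y (\<lambda>t x. exp (- (r * t)) *\<^sub>R op_exp Q t x)"
proof -
  note YD = closed_csubspaceD[OF Y]
  have expY: "op_exp Q t x \<in> Y" if "x \<in> Y" for t x
  proof -
    have "(Q ^^ k) x \<in> Y" for k using that QY by (induction k) auto
    then have "(\<Sum>k<n. (t ^ k / fact k) *\<^sub>R (Q ^^ k) x) \<in> Y" for n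
      by (intro subspace_sum YD) auto
    then show ?thesis by (rule closed_sequentially[OF YD(1) _ op_exp_sums[unfolded sums_def]])
  qed
  have cont: "continuous_on {0..} (\<lambda>t. op_exp Q t x)" for x
    by (rule continuous_on_atLeast_0I) (rule op_exp_continuous)
  let ?E = "\<lambda>t x. exp (- (r * t)) *\<^sub>R op_exp Q t x"
  have "bounded_operator_on Y (?E t)" for t
    unfolding bounded_operator_on_def
  proof (intro conjI ballI allI)
    show "\<exists>C. \<forall>x\<in>Y. norm (?E t x) \<le> C * norm x"
      using op_exp_norm'[of t] by (intro exI[of _ "exp (- (r * t)) * exp (\<bar>t\<bar> * onorm Q)"]) (auto simp: mult_ac)
  qed (use expY YD in \<open>auto simp: op_exp_linear scaleR_add_right scaleC_scaleR\<close>)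
  moreover have "?E (s + t) x = ?E s (?E t x)" if "0 \<le> s" "0 \<le> t" for s t x
    using that by (simp add: op_exp_add op_exp_linear distrib_left exp_add[symmetric])
  ultimately have "c0_semigroup Y ?E"
    unfolding c0_semigroup_def by (auto simp: op_exp_0 intro!: continuous_intros cont)
  then show "c0_sg Y ?E" using Y by unfold_locales
  show "(x, Q x - r *\<^sub>R x) \<in> generator Y ?E" if "x \<in> Y"
  proof -
    have e: "((\<lambda>t. exp (- (r * t))) has_real_derivative - r) (at 0 within {0..1})"
      by (auto intro!: derivative_eq_intros)
    have "((\<lambda>t. ?E t x) has_vector_derivative (Q x - r *\<^sub>R x)) (at 0 within {0..1})"
      using has_vector_derivative_scaleR[OF e op_exp_deriv[of 0 1 x]] by (simp add: op_exp_0)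
    then show ?thesis
      using that by (simp add: generator_def has_vector_derivative_iff_quotient at_within_Icc_at_right op_exp_0)
  qed
qed

end

section \<open>The Hille--Yosida generation theorem\<close>

text \<open>Equicontinuity: a common Lipschitz constant carries convergence from a dense set to its
  closure.\<close>

lemma tendsto_0_on_closure:
  fixes L :: "'i \<Rightarrow> 'x::real_normed_vector \<Rightarrow> 'y::real_normed_vector"
  assumes lip: "\<forall>\<^sub>F i in F. \<forall>x\<in>closure D. \<forall>y\<in>closure D. norm (L i x - L i y) \<le> K * norm (x - y)"
    and D: "\<And>x. x \<in> D \<Longrightarrow> ((\<lambda>i. L i x) \<longlongrightarrow> 0) F" and x: "x \<in> closure D"
  shows "((\<lambda>i. L i x) \<longlongrightarrow> 0) F"
proof (rule tendstoI)
  fix e :: real assume e: "e > 0"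
  then obtain y where y: "y \<in> D" "dist y x < e / (2 * (\<bar>K\<bar> + 1))"
    using closure_approachable[THEN iffD1, OF x, rule_format, of "e / (2 * (\<bar>K\<bar> + 1))"] by auto
  have "\<forall>\<^sub>F i in F. dist (L i y) 0 < e / 2" by (rule tendstoD[OF D[OF y(1)]]) (use e in simp)
  with lip show "\<forall>\<^sub>F i in F. dist (L i x) 0 < e"
  proof eventually_elim
    case (elim i)
    have "norm (L i x - L i y) \<le> K * norm (x - y)" using elim(1) x subsetD[OF closure_subset y(1)] by blast
    also have "\<dots> \<le> (\<bar>K\<bar> + 1) * norm (x - y)" by (intro mult_right_mono) auto
    also have "\<dots> < (\<bar>K\<bar> + 1) * (e / (2 * (\<bar>K\<bar> + 1)))"
      using y(2) by (intro mult_strict_left_mono) (auto simp: dist_norm norm_minus_commute)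
    also have "\<dots> = e / 2" by (simp add: field_simps)
    finally have "norm (L i x - L i y) < e / 2" .
    moreover have "norm (L i x) \<le> norm (L i x - L i y) + norm (L i y)"
      by (metis diff_add_cancel norm_triangle_ineq)
    ultimately show ?case using elim(2) by simp
  qed
qed

locale hille_yosida_operator =
  fixes A :: "'x::complex_banach operator" and \<omega> M :: real
  assumes A: "linear_operator A" and hy: "weak_hille_yosida A \<omega> M"
begin

definition Y where "Y = closure (Domain A)"
definition R where "R r = resolvent A (complex_of_real r)"

lemma Y: "closed_csubspace Y" unfolding Y_def by (rule closed_csubspace_Domain[OF A])
lemmas YD = closed_csubspaceD[OF Y]

lemma M: "M \<ge> 1" using hy by (simp add: weak_hille_yosida_def)

lemma res: "r > \<omega> \<Longrightarrow> complex_of_real r \<in> resolvent_set A"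
  using hy by (simp add: weak_hille_yosida_def)

lemma R_pow: "r > \<omega> \<Longrightarrow> x \<in> Y \<Longrightarrow> norm ((R r ^^ k) x) \<le> M / (r - \<omega>) ^ k * norm x"
proof (cases "k = 0")
  case True
  then show ?thesis using mult_right_mono[OF M, of "norm x"] by simp
next
  case False
  then show "r > \<omega> \<Longrightarrow> x \<in> Y \<Longrightarrow> ?thesis"
    using hy unfolding weak_hille_yosida_def Y_def R_def by (meson less_one linorder_not_less)
qed

lemma R_to_0: "((\<lambda>r. R r x) \<longlongrightarrow> 0) at_top"
  using hy by (simp add: weak_hille_yosida_def R_def)

lemma R_mem: "r > \<omega> \<Longrightarrow> (R r x, r *\<^sub>R R r x - x) \<in> A"
  using resolvent_mem[OF res] by (simp add: R_def scaleC_of_real)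

lemma R_eq: "r > \<omega> \<Longrightarrow> (u, v) \<in> A \<Longrightarrow> R r (r *\<^sub>R u - v) = u"
  using resolvent_eq[OF res] by (simp add: R_def scaleC_of_real)

lemma R_bl: "r > \<omega> \<Longrightarrow> bounded_linear (R r)"
  unfolding R_def by (rule resolvent_bounded_linear[OF res])

lemma R_scaleC: "r > \<omega> \<Longrightarrow> R r (a *\<^sub>C x) = a *\<^sub>C R r x"
  unfolding R_def by (rule resolvent_scaleC[OF res A])

lemma R_in: "r > \<omega> \<Longrightarrow> R r x \<in> Y"
  unfolding Y_def by (rule subsetD[OF closure_subset DomainI[OF R_mem]])

lemma R_commute: "r > \<omega> \<Longrightarrow> s > \<omega> \<Longrightarrow> R r (R s x) = R s (R r x)"
  unfolding R_def by (rule resolvent_commute[OF A res res])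

text \<open>Since r R(r) x = x + R(r) y, this is condition (ii) applied to y = A x. That y may lie
  outside \<open>Y\<close>, where the power bounds say nothing.\<close>

lemma R_approx_domain: assumes "x \<in> Domain A" shows "((\<lambda>r. r *\<^sub>R R r x) \<longlongrightarrow> x) at_top"
proof -
  obtain y where xy: "(x, y) \<in> A" using assms by blast
  have "((\<lambda>r. R r y + x) \<longlongrightarrow> 0 + x) at_top" by (rule tendsto_add[OF R_to_0 tendsto_const])
  moreover have "\<forall>\<^sub>F r in at_top. R r y + x = r *\<^sub>R R r x"
    using eventually_gt_at_top[of \<omega>]
  proof eventually_elim
    case (elim r)
    interpret bounded_linear "R r" by (rule R_bl[OF elim])
    show ?case using R_eq[OF elim xy] by (simp add: diff scaleR algebra_simps)
  qed
  ultimately show ?thesis using tendsto_cong by fastforce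
qed

lemma R_approx: assumes "x \<in> Y" shows "((\<lambda>r. r *\<^sub>R R r x) \<longlongrightarrow> x) at_top"
proof -
  have "((\<lambda>r. r *\<^sub>R R r x - x) \<longlongrightarrow> 0) at_top"
  proof (rule tendsto_0_on_closure[where D = "Domain A" and K = "2 * M + 1"])
    show "\<forall>\<^sub>F r in at_top. \<forall>x\<in>closure (Domain A). \<forall>y\<in>closure (Domain A).
        norm ((r *\<^sub>R R r x - x) - (r *\<^sub>R R r y - y)) \<le> (2 * M + 1) * norm (x - y)"
      using eventually_ge_at_top[of "2 * \<bar>\<omega>\<bar> + 1"]
    proof eventually_elim
      case (elim r)
      \<comment> \<open>Beyond the threshold 2 |\<omega>| + 1 one has r \<le> 2 (r - \<omega>), so r
        R(r) is bounded by 2 M on \<open>Y\<close>; this gives the Lipschitz constant 2 M +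
        1.\<close>
      then have r: "r > \<omega>" "r > 0" "r \<le> 2 * (r - \<omega>)" by (simp_all add: abs_if split: if_splits)
      interpret bounded_linear "R r" by (rule R_bl[OF r(1)])
      show ?case
      proof (intro ballI)
        fix x y assume "x \<in> closure (Domain A)" "y \<in> closure (Domain A)"
        then have xy: "x - y \<in> Y" using YD(7) by (simp add: Y_def)
        have "r * norm (R r (x - y)) \<le> r * (M / (r - \<omega>) * norm (x - y))"
          using R_pow[OF r(1) xy, of 1] r by (intro mult_left_mono) auto
        also have "\<dots> = (r / (r - \<omega>)) * (M * norm (x - y))" by simp
        also have "\<dots> \<le> 2 * (M * norm (x - y))"
          using r M by (intro mult_right_mono) (auto simp: pos_divide_le_eq)
        finally have 1: "norm (r *\<^sub>R R r (x - y)) \<le> 2 * M * norm (x - y)" using r by simp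
        have "(r *\<^sub>R R r x - x) - (r *\<^sub>R R r y - y) = r *\<^sub>R R r (x - y) - (x - y)"
          by (simp add: diff scaleR_diff_right)
        then show "norm ((r *\<^sub>R R r x - x) - (r *\<^sub>R R r y - y)) \<le> (2 * M + 1) * norm (x - y)"
          using 1 norm_triangle_ineq4[of "r *\<^sub>R R r (x - y)" "x - y"] by (simp add: algebra_simps)
      qed
    qed
    show "((\<lambda>r. r *\<^sub>R R r x - x) \<longlongrightarrow> 0) at_top" if "x \<in> Domain A" for x
      using R_approx_domain[OF that] by (simp add: LIM_zero_iff)
  qed (use assms in \<open>simp add: Y_def\<close>)
  then show ?thesis by (simp add: LIM_zero_iff)
qed

lemma part_in: assumes "(x, y) \<in> op_part A" shows "(x, y) \<in> A" "x \<in> Y" "y \<in> Y"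
  using assms closure_subset[of "Domain A"] by (auto simp: op_part_def Y_def)

text \<open>For x in \<open>Y\<close> the approximant r R(r) x is mapped by A to r (r R(r) x - x),
  which lies in \<open>Y\<close>, so it belongs to the domain of the part.\<close>

lemma part_dense: "Y \<subseteq> closure (Domain (op_part A))"
proof
  fix x assume x: "x \<in> Y"
  have "\<forall>\<^sub>F r in at_top. r *\<^sub>R R r x \<in> closure (Domain (op_part A))"
    using eventually_gt_at_top[of \<omega>]
  proof eventually_elim
    case (elim r)
    have "r *\<^sub>R (r *\<^sub>R R r x - x) \<in> Y" by (intro YD(5,7) R_in[OF elim] x)
    then have "(r *\<^sub>R R r x, r *\<^sub>R (r *\<^sub>R R r x - x)) \<in> op_part A"
      using linear_operatorD(5)[OF A R_mem[OF elim]] by (simp add: op_part_def Y_def)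
    then have "r *\<^sub>R R r x \<in> Domain (op_part A)" by (rule DomainI)
    then show ?case by (rule subsetD[OF closure_subset])
  qed
  from Lim_in_closed_set[OF closed_closure this _ R_approx[OF x]]
  show "x \<in> closure (Domain (op_part A))" by simp
qed

section \<open>Yosida approximation\<close>

definition \<rho> where "\<rho> n = real n + 2 * \<bar>\<omega>\<bar> + 1"

lemma \<rho>: "\<rho> n > \<omega>" "\<rho> n > 0" "\<rho> n \<ge> 2 * \<bar>\<omega>\<bar>" by (auto simp: \<rho>_def)

lemma \<rho>_top: "filterlim \<rho> at_top sequentially"
proof -
  have "filterlim (\<lambda>n. (2 * \<bar>\<omega>\<bar> + 1) + real n) at_top sequentially"
    by (rule filterlim_tendsto_add_at_top[OF tendsto_const filterlim_real_sequentially])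
  then show ?thesis by (simp add: \<rho>_def[abs_def] add_ac)
qed

text \<open>\<open>B n\<close> is the Yosida approximation \<rho> A (\<rho> - A)^-1, written as
  \<rho>^2 (\<rho> - A)^-1 - \<rho>, and \<open>E n\<close> is its exponential with the scalar part
  split off.\<close>

definition Q where "Q n x = (\<rho> n)\<^sup>2 *\<^sub>R R (\<rho> n) x"
definition B where "B n x = Q n x - \<rho> n *\<^sub>R x"
definition E where "E n t x = exp (- (\<rho> n * t)) *\<^sub>R op_exp (Q n) t x"
abbreviation "c \<equiv> 2 * \<bar>\<omega>\<bar>"

lemma Q_bl: "bounded_linear (Q n)"
  unfolding Q_def[abs_def] by (rule bounded_linear_compose[OF bounded_linear_scaleR_right R_bl[OF \<rho>(1)]])

lemma Q_scaleC: "Q n (a *\<^sub>C x) = a *\<^sub>C Q n x"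
  by (simp add: Q_def R_scaleC \<rho> scaleC_scaleR)

lemma Q_in: "x \<in> Y \<Longrightarrow> Q n x \<in> Y" unfolding Q_def by (intro YD R_in \<rho>)

lemma B_in: "x \<in> Y \<Longrightarrow> B n x \<in> Y" unfolding B_def by (intro YD Q_in)

lemma E_c0: "c0_sg Y (E n)"
  using scaled_op_exp_c0(1)[OF Q_bl Q_scaleC Y Q_in] by (simp add: E_def[abs_def])

lemma E_gen: "x \<in> Y \<Longrightarrow> (x, B n x) \<in> c0_sg.G Y (E n)"
  unfolding c0_sg.G_def[OF E_c0] unfolding E_def[abs_def] B_def by (rule scaled_op_exp_c0(2)[OF Q_bl Q_scaleC Y Q_in])

text \<open>The exponent \<rho>^2 / (\<rho> - \<omega>) - \<rho> equals \<rho> \<omega> / (\<rho> -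
  \<omega>). It is at most 2 |\<omega>| because \<rho> \<ge> 2 |\<omega>|, so the bound is uniform
  in n.\<close>

lemma E_bound: assumes "x \<in> Y" "0 \<le> t" shows "norm (E n t x) \<le> M * exp (c * t) * norm x"
proof -
  let ?r = "\<rho> n"
  have pw: "(Q n ^^ k) x = (?r\<^sup>2) ^ k *\<^sub>R (R ?r ^^ k) x" for k
  proof (induction k)
    case (Suc k)
    interpret bounded_linear "R ?r" by (rule R_bl[OF \<rho>(1)])
    have "(Q n ^^ Suc k) x = Q n ((?r\<^sup>2) ^ k *\<^sub>R (R ?r ^^ k) x)" by (simp add: Suc)
    also have "\<dots> = (?r\<^sup>2) ^ Suc k *\<^sub>R (R ?r ^^ Suc k) x" by (simp add: Q_def scaleR)
    finally show ?case .
  qed simp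
  have "norm ((Q n ^^ k) x) \<le> (M * norm x) * (?r\<^sup>2 / (?r - \<omega>)) ^ k" for k
    using mult_left_mono[OF R_pow[OF \<rho>(1) assms(1), where k = k], of "(?r\<^sup>2) ^ k"]
    by (simp add: pw power_divide mult_ac)
  from op_exp_summable(3)[OF this, of t]
  have "norm (E n t x) \<le> exp (- (?r * t)) * (M * norm x * exp (t * (?r\<^sup>2 / (?r - \<omega>))))"
    using assms(2) by (simp add: E_def)
  also have "\<dots> = M * norm x * exp (t * (?r\<^sup>2 / (?r - \<omega>) - ?r))"
    by (simp add: exp_add[symmetric] algebra_simps)
  also have "\<dots> \<le> M * norm x * exp (t * c)"
  proof -
    have "?r\<^sup>2 \<le> (c + ?r) * (?r - \<omega>)"
    proof -
      have "(c + ?r) * (?r - \<omega>) - ?r\<^sup>2 = ?r * (c - \<omega>) - c * \<omega>" by (simp add: power2_eq_square algebra_simps)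
      moreover have "?r * \<bar>\<omega>\<bar> \<le> ?r * (c - \<omega>)" using \<rho>(2)[of n] by (intro mult_left_mono) auto
      moreover have "c * \<bar>\<omega>\<bar> \<le> ?r * \<bar>\<omega>\<bar>" using \<rho>(3) by (intro mult_right_mono) auto
      moreover have "c * \<omega> \<le> c * \<bar>\<omega>\<bar>" by (intro mult_left_mono) auto
      ultimately show ?thesis by linarith
    qed
    then have "?r\<^sup>2 / (?r - \<omega>) - ?r \<le> c" using \<rho>(1)[of n] by (simp add: pos_divide_le_eq diff_le_eq)
    then show ?thesis using M assms by (intro mult_left_mono) (auto intro: mult_left_mono)
  qed
  finally show ?thesis by (simp add: mult_ac)
qed

lemma E_R_commute: "R (\<rho> m) (E n t x) = E n t (R (\<rho> m) x)"
proof -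
  interpret R: bounded_linear "R (\<rho> m)" by (rule R_bl[OF \<rho>(1)])
  have "R (\<rho> m) (op_exp (Q n) t x) = op_exp (Q n) t (R (\<rho> m) x)"
    by (rule op_exp_commute[OF Q_bl Q_scaleC R_bl[OF \<rho>(1)]]) (simp add: Q_def R.scaleR R_commute \<rho>)
  then show ?thesis by (simp add: E_def R.scaleR)
qed

lemma E_B_commute: assumes "x \<in> Y" "0 \<le> t" shows "B m (E n t x) = E n t (B m x)"
proof -
  interpret c0_sg Y "E n" by (rule E_c0)
  show ?thesis unfolding B_def Q_def using assms R_in[OF \<rho>(1)] YD
    by (simp add: T_diff T_scaleR E_R_commute)
qed

text \<open>Differentiate \<sigma> \<mapsto> E_n(t - \<sigma>) E_m(\<sigma>) x. As all resolvents of
  A commute, the derivative is E_n(t - \<sigma>) E_m(\<sigma>) (B_m x - B_n x), and the uniform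
  bound enters twice.\<close>

lemma E_diff: assumes "x \<in> Y" "0 \<le> t"
  shows "norm (E n t x - E m t x) \<le> (M * exp (c * t))\<^sup>2 * norm (B n x - B m x) * t"
proof -
  interpret n: c0_sg Y "E n" by (rule E_c0)
  interpret m: c0_sg Y "E m" by (rule E_c0)
  define \<phi> where "\<phi> \<sigma> = E n (t - \<sigma>) (E m \<sigma> x)" for \<sigma>
  have d: "(\<phi> has_vector_derivative (- E n (t - s) (B n (E m s x)) + E n (t - s) (E m s (B m x)))) (at s within {0..t})"
    if s: "s \<in> {0..t}" for s
    unfolding \<phi>_def
  proof (rule product_rule_on[OF Y, where v' = "E m s (B m x)" and K = "M * exp (c * t)" and
          F = "\<lambda>\<sigma>. E n (t - \<sigma>)" and v = "\<lambda>\<sigma>. E m \<sigma> x"])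
    show "norm (E n (t - \<sigma>) x) \<le> M * exp (c * t) * norm x" if "\<sigma> \<in> {0..t}" "x \<in> Y" for \<sigma> x
    proof -
      have "exp (c * (t - \<sigma>)) \<le> exp (c * t)" using that by (auto intro!: mult_left_mono)
      then have "M * exp (c * (t - \<sigma>)) * norm x \<le> M * exp (c * t) * norm x" using M by (intro mult_right_mono mult_left_mono) auto
      then show ?thesis using E_bound[OF that(2), of "t - \<sigma>" n] that by simp
    qed
    show "((\<lambda>\<sigma>. E n (t - \<sigma>) (E m s x)) has_vector_derivative - E n (t - s) (B n (E m s x))) (at s within {0..t})"
      using s assms by (intro n.G_deriv_reflect E_gen m.T_in) auto
    show "((\<lambda>\<sigma>. E m \<sigma> x) has_vector_derivative E m s (B m x)) (at s within {0..t})"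
      using s assms by (intro has_vector_derivative_within_subset[OF m.G_deriv[OF E_gen]]) auto
    show "((\<lambda>\<sigma>. E n (t - \<sigma>) (E m s (B m x))) \<longlongrightarrow> E n (t - s) (E m s (B m x))) (at s within {0..t})"
    proof (rule n.T_tendsto)
      have "E m s (B m x) \<in> Y" using s assms by (intro m.T_in B_in) auto
      then show "\<forall>\<^sub>F \<sigma> in at s within {0..t}. 0 \<le> t - \<sigma> \<and> E m s (B m x) \<in> Y" "E m s (B m x) \<in> Y"
        by (auto simp: eventually_at_filter)
    qed (use s in \<open>auto intro!: tendsto_intros\<close>)
  qed (use s assms in \<open>auto intro: n.T_diff n.T_scaleR m.T_in B_in\<close>)
  have b: "norm (- E n (t - s) (B n (E m s x)) + E n (t - s) (E m s (B m x))) \<le> (M * exp (c * t))\<^sup>2 * norm (B n x - B m x)"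
    if s: "s \<in> {0..t}" for s
  proof -
    have By: "B n x \<in> Y" "B m x \<in> Y" "B m x - B n x \<in> Y" using assms B_in YD(7) by auto
    have mono: "exp (c * u) \<le> exp (c * t)" if "u \<le> t" for u using that by (auto intro!: mult_left_mono)
    have "- E n (t - s) (B n (E m s x)) + E n (t - s) (E m s (B m x)) = E n (t - s) (E m s (B m x - B n x))"
      using s assms By m.T_in E_B_commute[of x s n m] by (simp add: m.T_diff n.T_diff)
    also have "norm \<dots> \<le> M * exp (c * (t - s)) * norm (E m s (B m x - B n x))"
      using s By by (intro E_bound m.T_in) auto
    also have "\<dots> \<le> M * exp (c * t) * (M * exp (c * s) * norm (B m x - B n x))"
      using s By M by (intro mult_mono mono E_bound mult_left_mono) auto
    also have "\<dots> \<le> M * exp (c * t) * (M * exp (c * t) * norm (B m x - B n x))"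
      using s M by (intro mult_left_mono mult_right_mono mono) auto
    finally show ?thesis by (simp add: power2_eq_square norm_minus_commute mult_ac)
  qed
  have "norm (\<phi> t - \<phi> 0) \<le> (M * exp (c * t))\<^sup>2 * norm (B n x - B m x) * (t - 0)"
    by (rule norm_diff_le_of_derivative_bound[OF assms(2) d b]) auto
  moreover have "\<phi> t = E m t x" "\<phi> 0 = E n t x"
    using assms m.T_in by (auto simp: \<phi>_def n.T_0 m.T_0)
  ultimately show ?thesis by (simp add: norm_minus_commute)
qed

text \<open>On the part one has B_n x = \<rho> R(\<rho>) y, which tends to y precisely because y is
  in \<open>Y\<close>. For general elements of A this convergence may fail.\<close>

lemma B_tendsto: assumes "(x, y) \<in> op_part A" shows "(\<lambda>n. B n x) \<longlonglongrightarrow> y"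
proof -
  note xy = part_in(1,3)[OF assms]
  have "B n x = \<rho> n *\<^sub>R R (\<rho> n) y" for n
  proof -
    interpret bounded_linear "R (\<rho> n)" by (rule R_bl[OF \<rho>(1)])
    have "x = \<rho> n *\<^sub>R R (\<rho> n) x - R (\<rho> n) y" using R_eq[OF \<rho>(1) xy(1), of n] by (simp add: diff scaleR)
    then have "\<rho> n *\<^sub>R x = \<rho> n *\<^sub>R (\<rho> n *\<^sub>R R (\<rho> n) x - R (\<rho> n) y)" by simp
    then show ?thesis by (simp add: B_def Q_def scaleR_diff_right power2_eq_square)
  qed
  then show ?thesis using filterlim_compose[OF R_approx[OF xy(2)] \<rho>_top] by simp
qed

text \<open>On the domain of the part, \<open>E_diff\<close> and \<open>B_tendsto\<close> give a
  uniform Cauchy estimate; the uniform bound and density extend it to \<open>Y\<close>.\<close>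

lemma E_uniform: assumes x: "x \<in> Y" shows "uniformly_convergent_on {0..b} (\<lambda>n t. E n t x)"
proof (intro Cauchy_uniformly_convergent uniformly_Cauchy_onI)
  fix e :: real assume e: "e > 0"
  define C where "C = M * exp (c * \<bar>b\<bar>)"
  have C: "C > 0" using M by (simp add: C_def)
  have EC: "norm (E n t y) \<le> C * norm y" if "t \<in> {0..b}" "y \<in> Y" for n t y
  proof -
    have "c * t \<le> c * \<bar>b\<bar>" using that by (intro mult_left_mono) auto
    then have "M * exp (c * t) * norm y \<le> C * norm y"
      unfolding C_def using M by (intro mult_right_mono mult_left_mono) auto
    then show ?thesis using E_bound[OF that(2), of t n] that by simp
  qed
  have "e / (3 * C) > 0" using e C by simp
  then obtain x' where x': "x' \<in> Domain (op_part A)" "dist x' x < e / (3 * C)"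
    using closure_approachable[THEN iffD1, OF subsetD[OF part_dense x]] by meson
  then obtain y' where xy': "(x', y') \<in> op_part A" by blast
  have x'Y: "x' \<in> Y" by (rule part_in(2)[OF xy'])
  have "Cauchy (\<lambda>n. B n x')" using B_tendsto[OF xy'] LIMSEQ_imp_Cauchy by blast
  moreover have "e / (3 * (C\<^sup>2 * (\<bar>b\<bar> + 1))) > 0" using e C by (simp add: add_nonneg_pos)
  ultimately obtain N where N: "\<And>m n. m \<ge> N \<Longrightarrow> n \<ge> N \<Longrightarrow> norm (B m x' - B n x') < e / (3 * (C\<^sup>2 * (\<bar>b\<bar> + 1)))"
    by (meson CauchyD)
  have "dist (E m t x) (E n t x) < e" if t: "t \<in> {0..b}" and mn: "m \<ge> N" "n \<ge> N" for t m n
  proof -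
    interpret m: c0_sg Y "E m" by (rule E_c0)
    interpret n: c0_sg Y "E n" by (rule E_c0)
    have xx: "x - x' \<in> Y" by (rule YD(7)[OF x x'Y])
    have 1: "C * norm (x - x') < e / 3"
      using x'(2) C by (simp add: dist_norm norm_minus_commute field_simps)
    have "M * exp (c * t) \<le> C"
      using t M unfolding C_def by (intro mult_left_mono) (auto intro: mult_left_mono)
    then have "(M * exp (c * t))\<^sup>2 \<le> C\<^sup>2" using M by (intro power_mono) auto
    then have "norm (E m t x' - E n t x') \<le> C\<^sup>2 * norm (B m x' - B n x') * (\<bar>b\<bar> + 1)"
      using t by (intro order_trans[OF E_diff[OF x'Y]] mult_mono) auto
    also have "\<dots> = (C\<^sup>2 * (\<bar>b\<bar> + 1)) * norm (B m x' - B n x')" by simp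
    also have "\<dots> < (C\<^sup>2 * (\<bar>b\<bar> + 1)) * (e / (3 * (C\<^sup>2 * (\<bar>b\<bar> + 1))))"
      using C by (intro mult_strict_left_mono N mn) (auto simp: add_nonneg_pos)
    also have "\<dots> = e / 3" using C by (simp add: field_simps add_nonneg_eq_0_iff)
    finally have 2: "norm (E m t x' - E n t x') < e / 3" .
    have "E m t x - E n t x = E m t (x - x') + (E m t x' - E n t x') - E n t (x - x')"
      using t x x'Y by (simp add: m.T_diff n.T_diff)
    then have "norm (E m t x - E n t x) \<le> norm (E m t (x - x')) + norm (E m t x' - E n t x') + norm (E n t (x - x'))"
      by (metis norm_triangle_le_diff norm_triangle_ineq add_right_mono)
    then show ?thesis using 1 2 EC[OF t xx, of m] EC[OF t xx, of n] by (simp add: dist_norm)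
  qed
  then show "\<exists>N. \<forall>t\<in>{0..b}. \<forall>m\<ge>N. \<forall>n\<ge>N. dist (E m t x) (E n t x) < e" by blast
qed

section \<open>The limit semigroup and its generator\<close>

definition S where "S t x = lim (\<lambda>n. E n t x)"

lemma S_uniform: "x \<in> Y \<Longrightarrow> uniform_limit {0..b} (\<lambda>n t. E n t x) (\<lambda>t. S t x) sequentially"
  using E_uniform[of x b] unfolding uniformly_convergent_uniform_limit_iff S_def .

lemma S_lim: "x \<in> Y \<Longrightarrow> 0 \<le> t \<Longrightarrow> (\<lambda>n. E n t x) \<longlonglongrightarrow> S t x"
  by (rule tendsto_uniform_limitI[OF S_uniform[of x t]]) auto

lemma S_in: "x \<in> Y \<Longrightarrow> 0 \<le> t \<Longrightarrow> S t x \<in> Y"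
  by (rule closed_sequentially[OF YD(1) _ S_lim]) (auto intro: c0_sg.T_in[OF E_c0])

lemma S_c0: "c0_sg Y S"
proof unfold_locales
  have bnd: "norm (S t x) \<le> M * exp (c * t) * norm x" if "x \<in> Y" "0 \<le> t" for t x
    by (rule LIMSEQ_le_const2[OF tendsto_norm[OF S_lim[OF that]]]) (use E_bound that in blast)
  have "bounded_operator_on Y (S t)" if t: "0 \<le> t" for t
    unfolding bounded_operator_on_def
  proof (intro conjI ballI allI)
    fix x y assume xy: "x \<in> Y" "y \<in> Y"
    have "E n t (x + y) = E n t x + E n t y" for n
      using bounded_operator_onD(2)[OF c0_sg.bo[OF E_c0 t] Y xy] .
    then show "S t (x + y) = S t x + S t y"
      using LIMSEQ_unique[OF S_lim[OF YD(3)[OF xy] t]] tendsto_add[OF S_lim[OF xy(1) t] S_lim[OF xy(2) t]] by simp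
  next
    fix a x assume x: "x \<in> Y"
    have "E n t (a *\<^sub>C x) = a *\<^sub>C E n t x" for n using c0_sg.T_scaleC[OF E_c0 t x] .
    then show "S t (a *\<^sub>C x) = a *\<^sub>C S t x"
      using LIMSEQ_unique[OF S_lim[OF YD(4)[OF x] t]] scaleC.tendsto[OF tendsto_const S_lim[OF x t], of a] by simp
  next
    show "\<exists>C. \<forall>x\<in>Y. norm (S t x) \<le> C * norm x" using bnd t by blast
  qed (use S_in t in auto)
  moreover have "S 0 x = x" if "x \<in> Y" for x
    using S_lim[OF that, of 0] c0_sg.T_0[OF E_c0 that] by (simp add: LIMSEQ_const_iff)
  moreover have "S (s + t) x = S s (S t x)" if st: "0 \<le> s" "0 \<le> t" and x: "x \<in> Y" for s t x
  proof -
    have "(\<lambda>n. E n s (E n t x) - E n s (S t x)) \<longlonglongrightarrow> 0"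
    proof (rule Lim_null_comparison)
      show "(\<lambda>n. M * exp (c * s) * norm (E n t x - S t x)) \<longlonglongrightarrow> 0"
        using S_lim[OF x st(2)] by (auto intro!: tendsto_eq_intros)
      show "\<forall>\<^sub>F n in sequentially. norm (E n s (E n t x) - E n s (S t x)) \<le> M * exp (c * s) * norm (E n t x - S t x)"
      proof (intro always_eventually allI)
        fix n
        interpret c0_sg Y "E n" by (rule E_c0)
        show "norm (E n s (E n t x) - E n s (S t x)) \<le> M * exp (c * s) * norm (E n t x - S t x)"
          using E_bound[of "E n t x - S t x" s n] st x T_in S_in YD by (simp add: T_diff)
      qed
    qed
    from tendsto_add[OF this S_lim[OF S_in[OF x st(2)] st(1)]]
    have "(\<lambda>n. E n s (E n t x)) \<longlonglongrightarrow> S s (S t x)" by simp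
    moreover have "E n (s + t) x = E n s (E n t x)" for n by (rule c0_sg.T_add[OF E_c0 st x])
    ultimately show ?thesis using S_lim[OF x, of "s + t"] st LIMSEQ_unique by fastforce
  qed
  moreover have "continuous_on {0..} (\<lambda>t. S t x)" if x: "x \<in> Y" for x
  proof (rule continuous_on_atLeast_0I)
    show "continuous_on {0..b} (\<lambda>t. S t x)" for b
      by (rule uniform_limit_theorem[OF always_eventually S_uniform[OF x]])
         (auto intro: c0_sg.T_cont'[OF E_c0 x])
  qed
  ultimately show "c0_semigroup Y S" unfolding c0_semigroup_def by blast
qed (rule Y)

text \<open>The identity E_n(t) x - x = \<integral> E_n(s) B_n x ds passes to the limit, since B_n x
  \<rightarrow> y and E_n \<rightarrow> S uniformly on compact time intervals.\<close>

lemma part_subset_generator: "op_part A \<subseteq> generator Y S"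
proof (rule subrelI)
  fix x y assume xy: "(x, y) \<in> op_part A"
  note xyY = part_in(2,3)[OF xy]
  interpret S: c0_sg Y S by (rule S_c0)
  have "(x, y) \<in> S.G"
  proof (rule S.G_I[OF xyY zero_less_one])
    fix t :: real assume t: "0 \<le> t" "t \<le> 1"
    have "uniform_limit {0..t} (\<lambda>n s. E n s (B n x - y)) (\<lambda>_. 0) sequentially"
    proof (rule uniform_limitI)
      fix e :: real assume e: "e > 0"
      define C where "C = M * exp c"
      have C: "C > 0" using M by (simp add: C_def)
      have "\<forall>\<^sub>F n in sequentially. norm (B n x - y) < e / C"
        using tendstoD[OF B_tendsto[OF xy], of "e / C"] e C by (simp add: dist_norm)
      then show "\<forall>\<^sub>F n in sequentially. \<forall>s\<in>{0..t}. dist (E n s (B n x - y)) 0 < e"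
      proof (eventually_elim, intro ballI)
        fix n s assume n: "norm (B n x - y) < e / C" and s: "s \<in> {0..t}"
        have "c * s \<le> c * 1" using s t by (intro mult_left_mono) auto
        then have "norm (E n s (B n x - y)) \<le> C * norm (B n x - y)"
          using s M B_in[OF xyY(1)] xyY YD(7) unfolding C_def
          by (intro order_trans[OF E_bound] mult_right_mono mult_left_mono) auto
        also have "\<dots> < e" using n C by (simp add: pos_less_divide_eq mult.commute)
        finally show "dist (E n s (B n x - y)) 0 < e" by simp
      qed
    qed
    from uniform_limit_add[OF this S_uniform[OF xyY(2)]]
    have "uniform_limit {0..t} (\<lambda>n s. E n s (B n x - y) + E n s y) (\<lambda>s. S s y) sequentially" by simp
    moreover have "E n s (B n x - y) + E n s y = E n s (B n x)" if "s \<in> {0..t}" for n s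
      using that c0_sg.T_diff[OF E_c0] xyY B_in by simp
    ultimately have u: "uniform_limit {0..t} (\<lambda>n s. E n s (B n x)) (\<lambda>s. S s y) sequentially"
      by (subst uniform_limit_cong'[where g = "\<lambda>n s. E n s (B n x - y) + E n s y" and i = "\<lambda>s. S s y"]) auto
    obtain I J where IJ: "\<And>n. ((\<lambda>s. E n s (B n x)) has_integral I n) {0..t}" "((\<lambda>s. S s y) has_integral J) {0..t}" "I \<longlonglongrightarrow> J"
      using uniform_limit_integral[OF u c0_sg.T_cont'[OF E_c0 B_in[OF xyY(1)]]] by auto
    have "I = (\<lambda>n. E n t x - x)"
      using IJ(1) c0_sg.G_integral[OF E_c0 E_gen[OF xyY(1)] t(1)] has_integral_unique by blast
    then have "I \<longlonglongrightarrow> S t x - x" using S_lim[OF xyY(1) t(1)] by (simp add: tendsto_diff)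
    then show "integral {0..t} (\<lambda>s. S s y) = S t x - x"
      using IJ LIMSEQ_unique integral_unique by blast
  qed
  then show "(x, y) \<in> generator Y S" by (simp add: S.G_def)
qed

text \<open>For large r the resolvent of A maps \<open>Y\<close> into the domain of the part, so r
  minus the part is onto \<open>Y\<close>, and \<open>G_eqI\<close> turns the inclusion in the
  generator into equality.\<close>

theorem hille_yosida_generation: "\<exists>T. part_generates A T"
proof -
  interpret S: c0_sg Y S by (rule S_c0)
  obtain K \<omega>' where K: "\<And>t x. t \<ge> 0 \<Longrightarrow> x \<in> Y \<Longrightarrow> norm (S t x) \<le> K * exp (\<omega>' * t) * norm x"
    using S.exp_bound by blast
  define r where "r = max \<omega> \<omega>' + 1"
  have r: "r > \<omega>" "r > \<omega>'" by (auto simp: r_def)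
  have "S.G = op_part A"
  proof (rule S.G_eqI[OF K, where z = "of_real r"])
    fix w assume "w \<in> Y"
    then show "\<exists>x. (x, of_real r *\<^sub>C x - w) \<in> op_part A"
      using R_mem[OF r(1), of w] R_in[OF r(1)] YD
      by (intro exI[of _ "R r w"]) (auto simp: op_part_def Y_def[symmetric] scaleC_of_real)
  qed (use r part_subset_generator S.G_def in auto)
  then show ?thesis
    using S.sg by (auto simp: part_generates_def S.G_def Y_def[symmetric])
qed

end

section \<open>Analytic semigroups\<close>

lemma has_vector_derivative_cis: "(cis has_vector_derivative (\<i> * cis t)) (at t within S)"
proof -
  have "((\<lambda>z. exp (\<i> * z)) has_field_derivative \<i> * exp (\<i> * of_real t)) (at (of_real t))"
    by (auto intro!: derivative_eq_intros)
  from has_vector_derivative_real_field[OF this, of S] show ?thesis by (simp add: cis_conv_exp[abs_def])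
qed

lemma has_vector_derivative_line: "((\<lambda>s. w + complex_of_real s * c) has_vector_derivative c) (at s within S)"
proof -
  have "((\<lambda>s. complex_of_real s * c) has_vector_derivative of_real 1 * c) (at s within S)"
    by (rule bounded_linear.has_vector_derivative[OF bounded_linear_mult_left
        bounded_linear.has_vector_derivative[OF bounded_linear_of_real has_vector_derivative_id]])
  from has_vector_derivative_add[OF has_vector_derivative_const this] show ?thesis by simp
qed

text \<open>\<open>h r\<close> is 2\<pi> times the first Fourier coefficient of f on the circle of
  radius r. Differentiating in r gives h' = k, integrating over a period gives h = r k, so h / r is
  constant and k(\<rho>) = k(0) = 2\<pi> f'(c). The bound on f then controls h(\<rho>).\<close>

lemma cauchy_estimate:
  fixes f f' :: "complex \<Rightarrow> 'x::complex_banach"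
  assumes \<rho>: "0 < \<rho>"
    and df: "\<And>w. w \<in> cball c \<rho> \<Longrightarrow> (f has_derivative (\<lambda>h. h *\<^sub>C f' w)) (at w)"
    and cf': "continuous_on (cball c \<rho>) f'"
    and B: "\<And>w. w \<in> cball c \<rho> \<Longrightarrow> norm (f w) \<le> B"
  shows "norm (f' c) \<le> B / \<rho>"
proof -
  define g where "g r s = c + of_real r * cis s" for r s
  define h where "h r = integral {0..2*pi} (\<lambda>s. cis (- s) *\<^sub>C f (g r s))" for r
  define k where "k r = integral {0..2*pi} (\<lambda>s. f' (g r s))" for r
  have gin: "g r s \<in> cball c \<rho>" if "r \<in> {0..\<rho>}" for r s
    using that by (simp add: g_def dist_norm norm_mult)
  have cf: "continuous_on (cball c \<rho>) f"
    using df by (auto intro!: has_derivative_continuous continuous_at_imp_continuous_on)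
  have cg: "continuous_on S (\<lambda>p. g (fst p) (snd p))" "continuous_on S' (g r)" for S S' r
    unfolding g_def by (intro continuous_intros)+
  have gr: "((\<lambda>r. g r s) has_vector_derivative cis s) (at r within S)" for r s S
    unfolding g_def by (rule has_vector_derivative_line)
  have gs: "(g r has_vector_derivative (of_real r * (\<i> * cis s))) (at s within S)" for r s S
  proof -
    have "((\<lambda>s. cis s) has_vector_derivative (\<i> * cis s)) (at s within S)"
      by (rule has_vector_derivative_cis)
    then show ?thesis unfolding g_def by (auto intro!: derivative_eq_intros)
  qed
  have cisd: "((\<lambda>s. cis (- s)) has_vector_derivative (- \<i> * cis (- s))) (at s within S)" for s S
  proof -
    have d: "((\<lambda>s. - s) has_vector_derivative -1) (at s within S)" by (auto intro!: derivative_eq_intros)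
    have "(cis has_vector_derivative (\<i> * cis (- s))) (at (- s) within uminus ` S)"
      by (rule has_vector_derivative_cis)
    from vector_diff_chain_within[OF d this] show ?thesis by (simp add: o_def)
  qed
  have dfg: "((\<lambda>u. f (\<gamma> u)) has_vector_derivative (\<gamma>' *\<^sub>C f' (\<gamma> u))) (at u within S)"
    if "(\<gamma> has_vector_derivative \<gamma>') (at u within S)" "\<gamma> u \<in> cball c \<rho>" for \<gamma> \<gamma>' u S
    using vector_derivative_diff_chain_within[OF that(1) has_derivative_at_withinI[OF df[OF that(2)]]]
    by (simp add: o_def)
  have hk: "(h has_vector_derivative k r) (at r within {0..\<rho>})" if r: "r \<in> {0..\<rho>}" for r
  proof -
    have "((\<lambda>r. integral (cbox 0 (2*pi)) (\<lambda>s. cis (- s) *\<^sub>C f (g r s))) has_vector_derivative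
        integral (cbox 0 (2*pi)) (\<lambda>s. f' (g r s))) (at r within {0..\<rho>})"
    proof (rule leibniz_rule_vector_derivative[where f = "\<lambda>r s. cis (- s) *\<^sub>C f (g r s)" and fx = "\<lambda>r s. f' (g r s)", OF _ _ _ r])
      fix r t assume r: "r \<in> {0..\<rho>}"
      show "((\<lambda>r. cis (- t) *\<^sub>C f (g r t)) has_vector_derivative f' (g r t)) (at r within {0..\<rho>})"
        by (rule has_vector_derivative_eq_rhs[OF scaleC.has_vector_derivative[OF has_vector_derivative_const dfg[OF gr gin[OF r]]]])
           (simp add: scaleC_scaleC cis_mult scaleC.zero_left)
    next
      fix r assume r: "r \<in> {0..\<rho>}"
      show "(\<lambda>s. cis (- s) *\<^sub>C f (g r s)) integrable_on cbox 0 (2 * pi)"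
        by (intro integrable_continuous scaleC.continuous_on continuous_intros continuous_on_compose2[OF cf cg(2)])
           (use gin[OF r] in auto)
    next
      show "continuous_on ({0..\<rho>} \<times> cbox 0 (2 * pi)) (\<lambda>(r, s). f' (g r s))"
        unfolding case_prod_beta by (rule continuous_on_compose2[OF cf' cg(1)]) (use gin in auto)
    qed simp
    then show ?thesis by (simp add: h_def[abs_def] k_def)
  qed
  \<comment> \<open>The angular derivative of e^(-is) f(c + r e^(is)) is i (r f' - e^(-is) f), and
    its integral over a full period vanishes.\<close>
  have hrk: "h r = r *\<^sub>R k r" if r: "r \<in> {0..\<rho>}" for r
  proof -
    have i1: "((\<lambda>s. cis (- s) *\<^sub>C f (g r s)) has_integral h r) {0..2*pi}"
      unfolding h_def by (intro integrable_integral integrable_continuous_real scaleC.continuous_on continuous_intros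
          continuous_on_compose2[OF cf cg(2)]) (use gin[OF r] in auto)
    have i2: "((\<lambda>s. f' (g r s)) has_integral k r) {0..2*pi}"
      unfolding k_def by (intro integrable_integral integrable_continuous_real
          continuous_on_compose2[OF cf' cg(2)]) (use gin[OF r] in auto)
    have "((\<lambda>s. \<i> *\<^sub>C (r *\<^sub>R f' (g r s) - cis (- s) *\<^sub>C f (g r s))) has_integral
        (cis (- (2*pi)) *\<^sub>C f (g r (2*pi)) - cis (- 0) *\<^sub>C f (g r 0))) {0..2*pi}"
    proof (rule fundamental_theorem_of_calculus)
      fix s
      have "\<i> * complex_of_real r * (cis (- s) * cis s) = \<i> * complex_of_real r" by (simp add: cis_mult)
      then have e: "cis (- s) * (complex_of_real r * (\<i> * cis s)) = \<i> * complex_of_real r"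
        by (simp add: mult_ac)
      show "((\<lambda>s. cis (- s) *\<^sub>C f (g r s)) has_vector_derivative \<i> *\<^sub>C (r *\<^sub>R f' (g r s) - cis (- s) *\<^sub>C f (g r s)))
          (at s within {0..2*pi})"
        by (rule has_vector_derivative_eq_rhs[OF scaleC.has_vector_derivative[OF cisd dfg[OF gs gin[OF r]]]])
           (simp add: scaleC_scaleC e scaleC.diff_right scaleC_of_real[symmetric] scaleC.minus_left)
    qed simp
    moreover have "((\<lambda>s. \<i> *\<^sub>C (r *\<^sub>R f' (g r s) - cis (- s) *\<^sub>C f (g r s))) has_integral \<i> *\<^sub>C (r *\<^sub>R k r - h r)) {0..2*pi}"
      by (intro has_integral_linear[OF _ scaleC.bounded_linear_right, unfolded o_def] has_integral_diff
          has_integral_linear[OF _ bounded_linear_scaleR_right, unfolded o_def] i1 i2)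
    ultimately have "\<i> *\<^sub>C (r *\<^sub>R k r - h r) = cis (- (2*pi)) *\<^sub>C f (g r (2*pi)) - cis (- 0) *\<^sub>C f (g r 0)"
      using has_integral_unique by blast
    also have "cis (- (2*pi)) = 1" by (simp add: complex_eq_iff)
    also have "1 *\<^sub>C f (g r (2*pi)) - cis (- 0) *\<^sub>C f (g r 0) = \<i> *\<^sub>C 0" by (simp add: g_def scaleC.zero_right)
    finally show ?thesis unfolding scaleC_cancel by simp
  qed
  \<comment> \<open>The quotient rule together with h' = k and h = r k gives derivative zero for h /
    r away from 0.\<close>
  have const: "k r = k \<rho>" if r: "0 < r" "r \<le> \<rho>" for r
  proof -
    have "((\<lambda>u. h u /\<^sub>R u) has_vector_derivative 0) (at u within {r..\<rho>})" if u: "u \<in> {r..\<rho>}" for u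
    proof -
      have u0: "0 < u" "u \<in> {0..\<rho>}" using u r by auto
      have 1: "((\<lambda>u. inverse u) has_real_derivative (- (inverse u * inverse u))) (at u within {r..\<rho>})"
        using u0 by (auto intro!: derivative_eq_intros)
      have 2: "(h has_vector_derivative k u) (at u within {r..\<rho>})"
        using r by (intro has_vector_derivative_within_subset[OF hk[OF u0(2)]]) auto
      show ?thesis
        by (rule has_vector_derivative_eq_rhs[OF has_vector_derivative_scaleR[OF 1 2]]) (use u0 in \<open>simp add: hrk\<close>)
    qed
    from derivative_zero_imp_eq[OF r(2) this] show ?thesis using r \<rho> by (simp add: hrk)
  qed
  have "k 0 = k \<rho>"
  proof -
    have "((\<lambda>r. (h r - h 0) /\<^sub>R (r - 0)) \<longlongrightarrow> k 0) (at_right 0)"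
      using hk[of 0] \<rho> by (simp add: has_vector_derivative_iff_quotient at_within_Icc_at_right)
    moreover have "\<forall>\<^sub>F r in at_right 0. (h r - h 0) /\<^sub>R (r - 0) = k \<rho>"
      unfolding eventually_at_right_field
    proof (intro exI[of _ \<rho>] conjI allI impI \<rho>)
      fix r assume "0 < r" "r < \<rho>"
      then show "(h r - h 0) /\<^sub>R (r - 0) = k \<rho>" using \<rho> const[of r] hrk[of r] hrk[of 0] by simp
    qed
    ultimately have "((\<lambda>r. k \<rho>) \<longlongrightarrow> k 0) (at_right (0::real))" using tendsto_cong by fast
    then show ?thesis by (simp add: tendsto_const_iff)
  qed
  moreover have "k 0 = (2 * pi) *\<^sub>R f' c" by (simp add: k_def g_def)
  ultimately have "k \<rho> = (2 * pi) *\<^sub>R f' c" by simp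
  then have "norm (h \<rho>) = \<rho> * (2 * pi * norm (f' c))" using \<rho> by (simp add: hrk)
  moreover have "norm (h \<rho>) \<le> B * (2 * pi - 0)"
    unfolding h_def
    by (intro integral_bound scaleC.continuous_on continuous_intros continuous_on_compose2[OF cf cg(2)])
       (use gin[of \<rho>] B \<rho> in \<open>auto simp: norm_scaleC\<close>)
  ultimately show ?thesis using \<rho> by (simp add: field_simps)
qed

section \<open>Sectors with vertex at the origin\<close>

lemma sector_0_iff: "z \<in> sector 0 \<delta> \<longleftrightarrow> z \<noteq> 0 \<and> \<bar>Arg z\<bar> < \<delta>"
  by (simp add: sector_def)

text \<open>The half-angle bound \<pi> / 2 keeps the sector away from the branch cut, so
  \<open>Arg\<close> is continuous on it.\<close>

lemma eventually_nhds_sector_0: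
  assumes "\<delta> \<le> pi / 2" "z \<in> sector 0 \<delta>" shows "\<forall>\<^sub>F w in nhds z. w \<in> sector 0 \<delta>"
proof -
  have z: "z \<noteq> 0" "\<bar>Arg z\<bar> < \<delta>" using assms(2) by (auto simp: sector_0_iff)
  have "z \<notin> \<real>\<^sub>\<le>\<^sub>0"
  proof
    assume "z \<in> \<real>\<^sub>\<le>\<^sub>0"
    then have "Arg z = pi" using z(1) by (auto simp: complex_nonpos_Reals_iff Arg_eq_pi complex_eq_iff)
    then show False using z assms(1) pi_gt_zero by linarith
  qed
  then have "isCont Arg z" by (rule continuous_at_Arg)
  then have "filterlim Arg (nhds (Arg z)) (nhds z)" by (simp add: isCont_def tendsto_at_iff_tendsto_nhds)
  then have "((\<lambda>w. \<bar>Arg w\<bar>) \<longlongrightarrow> \<bar>Arg z\<bar>) (nhds z)" by (rule tendsto_rabs)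
  then have "\<forall>\<^sub>F w in nhds z. \<bar>Arg w\<bar> < \<delta>" using z(2) by (rule order_tendstoD)
  moreover have "\<forall>\<^sub>F w in nhds z. w \<noteq> 0" using z(1) by (rule t1_space_nhds)
  ultimately show ?thesis by eventually_elim (simp add: sector_0_iff)
qed

lemma sector_0_polar:
  assumes "0 < r" "\<bar>\<alpha>\<bar> < \<delta>" "\<delta> \<le> pi" shows "of_real r * cis \<alpha> \<in> sector 0 \<delta>"
proof -
  have "Arg (of_real r * cis \<alpha>) = \<alpha>"
    using assms by (intro Arg_unique[of r]) (auto simp: cis_conv_exp)
  then show ?thesis using assms by (simp add: sector_0_iff)
qed

text \<open>Sectors are invariant under positive scaling, so a disc around 1 yields discs around r
  with radius proportional to r. This proportionality is the source of the 1 / r in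
  \<open>D_estimate\<close>.\<close>

lemma cball_subset_sector_0:
  assumes "0 < \<delta>" "\<delta> \<le> pi / 2"
  obtains \<kappa> where "0 < \<kappa>" "\<kappa> < 1" "\<And>r. 0 < r \<Longrightarrow> cball (of_real r) (\<kappa> * r) \<subseteq> sector 0 \<delta>"
proof -
  have "1 \<in> sector 0 \<delta>" using sector_0_polar[of 1 0 \<delta>] assms by simp
  from eventually_nhds_sector_0[OF assms(2) this]
  obtain d where d: "d > 0" "\<And>w. dist w 1 < d \<Longrightarrow> w \<in> sector 0 \<delta>" unfolding eventually_nhds_metric by blast
  define \<kappa> where "\<kappa> = min (d / 2) (1 / 2)"
  have k: "0 < \<kappa>" "\<kappa> < 1" "\<kappa> < d" using d(1) by (auto simp: \<kappa>_def)
  have "w \<in> sector 0 \<delta>" if r: "0 < r" and w: "w \<in> cball (of_real r) (\<kappa> * r)" for r w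
  proof -
    have "dist (w / of_real r) 1 = dist w (of_real r) / r"
    proof -
      have "w / of_real r - 1 = (w - of_real r) / of_real r" using r by (simp add: diff_divide_distrib)
      then show ?thesis using r by (simp add: dist_norm norm_divide)
    qed
    also have "\<dots> < d" using w r k(3) by (simp add: dist_commute pos_divide_less_eq) (meson le_less_trans mult_strict_right_mono)
    finally have "w / of_real r \<in> sector 0 \<delta>" by (rule d(2))
    then show ?thesis using r by (auto simp: sector_0_iff)
  qed
  then show ?thesis using k that by blast
qed

locale analytic_sg = c0_sg Y T for Y :: "'x::complex_banach set" and T +
  fixes \<delta> :: real and U :: "complex \<Rightarrow> 'x \<Rightarrow> 'x"
  assumes \<delta>: "0 < \<delta>" "\<delta> \<le> pi / 2"
    and U_T: "\<And>t x. 0 \<le> t \<Longrightarrow> x \<in> Y \<Longrightarrow> U (of_real t) x = T t x"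
    and U_bo: "\<And>z. z \<in> sector 0 \<delta> \<Longrightarrow> bounded_operator_on Y (U z)"
    and U_add: "\<And>z w x. z \<in> sector 0 \<delta> \<Longrightarrow> w \<in> sector 0 \<delta> \<Longrightarrow> x \<in> Y \<Longrightarrow> U (z + w) x = U z (U w x)"
    and U_hol: "operator_holomorphic_on Y U (sector 0 \<delta>)"
    and U_lim: "\<And>\<delta>' x. 0 < \<delta>' \<Longrightarrow> \<delta>' < \<delta> \<Longrightarrow> x \<in> Y \<Longrightarrow> ((\<lambda>z. U z x) \<longlongrightarrow> x) (at 0 within sector 0 \<delta>')"
begin

text \<open>The complex derivative of \<open>U\<close> at \<open>z\<close> on \<open>Y\<close>. At
  real points it turns out to be the generator applied to the semigroup, by
  \<open>T_G\<close>.\<close>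

definition D where "D z = (SOME D. bounded_operator_on Y D \<and>
  (\<forall>\<epsilon>>0. \<forall>\<^sub>F w in at z. \<forall>x\<in>Y. norm (inverse (w - z) *\<^sub>C (U w x - U z x) - D x) \<le> \<epsilon> * norm x))"

lemma D: assumes "z \<in> sector 0 \<delta>"
  shows "bounded_operator_on Y (D z)"
    and "0 < \<epsilon> \<Longrightarrow> \<forall>\<^sub>F w in at z. \<forall>x\<in>Y. norm (inverse (w - z) *\<^sub>C (U w x - U z x) - D z x) \<le> \<epsilon> * norm x"
  using someI_ex[OF U_hol[unfolded operator_holomorphic_on_def, rule_format, OF assms]] unfolding D_def by auto

lemma U_deriv: assumes z: "z \<in> sector 0 \<delta>" and x: "x \<in> Y"
  shows "((\<lambda>w. U w x) has_derivative (\<lambda>h. h *\<^sub>C D z x)) (at z)"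
  unfolding has_derivative_iff_norm
proof (intro conjI scaleC.bounded_linear_left tendstoI)
  fix e :: real assume e: "e > 0"
  define \<epsilon> where "\<epsilon> = e / (2 * (norm x + 1))"
  have \<epsilon>: "\<epsilon> > 0" using e by (simp add: \<epsilon>_def add_nonneg_pos)
  have "\<epsilon> * norm x \<le> \<epsilon> * (norm x + 1)" using \<epsilon> by simp
  also have "\<dots> = e / 2" by (simp add: \<epsilon>_def field_simps add_nonneg_eq_0_iff)
  finally have ex: "\<epsilon> * norm x < e" using e by simp
  have "\<forall>\<^sub>F w in at z. w \<noteq> z" by (simp add: eventually_at_filter)
  with D(2)[OF z \<epsilon>]
  show "\<forall>\<^sub>F w in at z. dist (norm (U w x - U z x - (w - z) *\<^sub>C D z x) / norm (w - z)) 0 < e"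
  proof eventually_elim
    case (elim w)
    have "inverse (w - z) *\<^sub>C (U w x - U z x) - D z x = inverse (w - z) *\<^sub>C (U w x - U z x - (w - z) *\<^sub>C D z x)"
      using elim(2) by (simp add: scaleC.diff_right scaleC_scaleC)
    then have "norm (U w x - U z x - (w - z) *\<^sub>C D z x) / norm (w - z) = norm (inverse (w - z) *\<^sub>C (U w x - U z x) - D z x)"
      by (simp add: norm_scaleC norm_inverse divide_inverse_commute)
    then show ?case using elim(1) x ex by (metis dist_0_norm dist_commute abs_of_nonneg le_less_trans norm_ge_zero real_norm_def)
  qed
qed

lemma U_path_deriv:
  assumes "(\<gamma> has_vector_derivative \<gamma>') (at s within S)" "\<gamma> s \<in> sector 0 \<delta>" "x \<in> Y"
  shows "((\<lambda>\<sigma>. U (\<gamma> \<sigma>) x) has_vector_derivative \<gamma>' *\<^sub>C D (\<gamma> s) x) (at s within S)"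
  using vector_derivative_diff_chain_within[OF assms(1) has_derivative_at_withinI[OF U_deriv[OF assms(2,3)]]]
  by (simp add: o_def)

text \<open>The analytic semigroup restricted to the half line of angle \<alpha>. Its generator is
  cis \<alpha> times \<open>G\<close>, so half-plane estimates for the rays combine to sector
  estimates for \<open>G\<close>.\<close>

definition ray where "ray \<alpha> t = U (of_real t * cis \<alpha>)"

lemma ray_sector: "\<bar>\<alpha>\<bar> < \<delta> \<Longrightarrow> 0 < t \<Longrightarrow> of_real t * cis \<alpha> \<in> sector 0 \<delta>"
  using \<delta> by (intro sector_0_polar) auto

lemma ray_0: "x \<in> Y \<Longrightarrow> ray \<alpha> 0 x = x"
  using U_T[of 0 x] T_0 by (simp add: ray_def)

lemma ray_deriv: "\<bar>\<alpha>\<bar> < \<delta> \<Longrightarrow> 0 < t \<Longrightarrow> x \<in> Y \<Longrightarrow>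
  ((\<lambda>t. ray \<alpha> t x) has_vector_derivative cis \<alpha> *\<^sub>C D (of_real t * cis \<alpha>) x) (at t within S)"
  unfolding ray_def using has_vector_derivative_line[of 0 "cis \<alpha>" t S]
  by (intro U_path_deriv[OF _ ray_sector]) simp_all

lemma ray_c0: assumes \<alpha>: "\<bar>\<alpha>\<bar> < \<delta>" shows "c0_sg Y (ray \<alpha>)"
proof unfold_locales
  have bo: "bounded_operator_on Y (ray \<alpha> t)" if "0 \<le> t" for t
  proof (cases "t = 0")
    case True
    then show ?thesis unfolding bounded_operator_on_def
      using ray_0 YD(3,4) by (auto intro!: exI[of _ 1])
  qed (use that U_bo ray_sector[OF \<alpha>] in \<open>auto simp: ray_def\<close>)
  moreover have "ray \<alpha> (s + t) x = ray \<alpha> s (ray \<alpha> t x)" if "0 \<le> s" "0 \<le> t" "x \<in> Y" for s t x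
  proof (cases "s = 0 \<or> t = 0")
    case True
    then show ?thesis using that ray_0 bounded_operator_onD(1)[OF bo Y] by auto
  next
    case False
    then show ?thesis using that U_add[OF ray_sector[OF \<alpha>] ray_sector[OF \<alpha>], of s t x] by (simp add: ray_def distrib_right)
  qed
  moreover have "continuous_on {0..} (\<lambda>t. ray \<alpha> t x)" if x: "x \<in> Y" for x
    unfolding continuous_on_eq_continuous_within
  proof
    fix t :: real assume t: "t \<in> {0..}"
    show "continuous (at t within {0..}) (\<lambda>t. ray \<alpha> t x)"
    proof (cases "t = 0")
      case False
      then show ?thesis using t by (intro has_vector_derivative_continuous[OF ray_deriv[OF \<alpha> _ x]]) auto
    next
      case True
      \<comment> \<open>Convergence at 0 is given only in strictly smaller sectors; the midpoint is
        an angle strictly between |\<alpha>| and \<delta>.\<close>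
      define \<delta>' where "\<delta>' = (\<bar>\<alpha>\<bar> + \<delta>) / 2"
      have \<delta>': "\<bar>\<alpha>\<bar> < \<delta>'" "0 < \<delta>'" "\<delta>' < \<delta>" using \<alpha> \<delta> by (auto simp: \<delta>'_def)
      have "filterlim (\<lambda>t. of_real t * cis \<alpha>) (at 0 within sector 0 \<delta>') (at 0 within {0..})"
        unfolding filterlim_at
      proof
        show "((\<lambda>t. of_real t * cis \<alpha>) \<longlongrightarrow> 0) (at 0 within {0..})" by (auto intro!: tendsto_eq_intros)
        show "\<forall>\<^sub>F t in at 0 within {0..}. of_real t * cis \<alpha> \<in> sector 0 \<delta>' \<and> of_real t * cis \<alpha> \<noteq> 0"
          unfolding eventually_at_filter
          by (intro always_eventually allI impI conjI sector_0_polar) (use \<delta>' \<delta> in auto)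
      qed
      from filterlim_compose[OF U_lim[OF \<delta>'(2,3) x] this]
      show ?thesis using ray_0[OF x] True by (simp add: continuous_within ray_def)
    qed
  qed
  ultimately show "c0_semigroup Y (ray \<alpha>)" unfolding c0_semigroup_def using ray_0 by blast
qed (rule Y)

text \<open>Write z = w + s cis \<alpha> with w still in the sector and differentiate U(w + \<sigma>
  cis \<alpha>) x at \<sigma> = s: once by holomorphy, once by factoring out U(w) and using the ray
  semigroup.\<close>

lemma D_generator:
  assumes \<alpha>: "\<bar>\<alpha>\<bar> < \<delta>" and z: "z \<in> sector 0 \<delta>" and xy: "(x, y) \<in> generator Y (ray \<alpha>)"
  shows "cis \<alpha> *\<^sub>C D z x = U z y"
proof -
  interpret R: c0_sg Y "ray \<alpha>" by (rule ray_c0[OF \<alpha>])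
  note xyG = xy[folded R.G_def]
  note xyY = R.G_in[OF xyG]
  have "((\<lambda>s. z - of_real s * cis \<alpha>) \<longlongrightarrow> z) (at_right 0)" by (auto intro!: tendsto_eq_intros)
  then have "\<forall>\<^sub>F s in at_right 0. z - of_real s * cis \<alpha> \<in> sector 0 \<delta>"
    by (rule eventually_compose_filterlim[OF eventually_nhds_sector_0[OF \<delta>(2) z]])
  then obtain s where s: "0 < s" and w: "z - of_real s * cis \<alpha> \<in> sector 0 \<delta>"
    unfolding eventually_at_right_field using dense by (metis zero_less_one)
  define w where "w = z - of_real s * cis \<alpha>"
  have zw: "w + of_real s * cis \<alpha> = z" by (simp add: w_def)
  have 1: "((\<lambda>\<sigma>. U (w + of_real \<sigma> * cis \<alpha>) x) has_vector_derivative cis \<alpha> *\<^sub>C D z x) (at s)"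
    using U_path_deriv[OF has_vector_derivative_line[of w "cis \<alpha>" s UNIV], of x] z xyY by (simp add: zw)
  have "((\<lambda>\<sigma>. U w (ray \<alpha> \<sigma> x)) has_vector_derivative U w (ray \<alpha> s y)) (at s)"
  proof -
    have at: "at s within {0..} = at s" using s by (intro at_within_interior) (simp add: interior_real_atLeast)
    have q: "((\<lambda>\<sigma>. (ray \<alpha> \<sigma> x - ray \<alpha> s x) /\<^sub>R (\<sigma> - s)) \<longlongrightarrow> ray \<alpha> s y) (at s)"
      using R.G_deriv[OF xyG, of s] s by (simp add: at has_vector_derivative_iff_quotient)
    have pos: "\<forall>\<^sub>F \<sigma> in at s. 0 < \<sigma>" using s by (simp add: eventually_at_in_open' eventually_at_topological) (metis open_greaterThan greaterThan_iff)
    have "((\<lambda>\<sigma>. U w ((ray \<alpha> \<sigma> x - ray \<alpha> s x) /\<^sub>R (\<sigma> - s))) \<longlongrightarrow> U w (ray \<alpha> s y)) (at s)"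
      by (rule bounded_operator_on_tendsto[OF U_bo[OF w[folded w_def]] Y q])
         (use s xyY R.T_in in \<open>auto intro!: eventually_mono[OF pos] YD(5,7)\<close>)
    moreover have "\<forall>\<^sub>F \<sigma> in at s. U w ((ray \<alpha> \<sigma> x - ray \<alpha> s x) /\<^sub>R (\<sigma> - s)) = (U w (ray \<alpha> \<sigma> x) - U w (ray \<alpha> s x)) /\<^sub>R (\<sigma> - s)"
      using pos
    proof eventually_elim
      case (elim \<sigma>)
      have "ray \<alpha> \<sigma> x \<in> Y" "ray \<alpha> s x \<in> Y" using R.T_in s elim xyY by auto
      then show ?case
        using YD(7) bounded_operator_onD(4,5)[OF U_bo[OF w[folded w_def]] Y] by simp
    qed
    ultimately show ?thesis unfolding has_vector_derivative_iff_quotient using tendsto_cong by fast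
  qed
  moreover have "U w (ray \<alpha> \<sigma> x') = U (w + of_real \<sigma> * cis \<alpha>) x'" if "0 < \<sigma>" "x' \<in> Y" for \<sigma> x'
    unfolding ray_def by (rule U_add[symmetric, OF w[folded w_def] ray_sector[OF \<alpha> that(1)] that(2)])
  ultimately have "((\<lambda>\<sigma>. U (w + of_real \<sigma> * cis \<alpha>) x) has_vector_derivative U z y) (at s)"
    using s xyY has_vector_derivative_transform_within_open[of "\<lambda>\<sigma>. U w (ray \<alpha> \<sigma> x)" "U w (ray \<alpha> s y)" s "{0<..}"]
    by (simp add: zw)
  with 1 show ?thesis by (rule vector_derivative_unique_at)
qed

text \<open>Rotation multiplies generators: by \<open>D_generator\<close> the derivative along ray
  \<beta> is known for s > 0. The interior form of the fundamental theorem needs no derivative at 0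
  and gives the integral equation for \<open>G_I\<close>.\<close>

lemma ray_generator:
  assumes \<alpha>: "\<bar>\<alpha>\<bar> < \<delta>" and \<beta>: "\<bar>\<beta>\<bar> < \<delta>" and xy: "(x, y) \<in> generator Y (ray \<alpha>)"
  shows "(x, cis (\<beta> - \<alpha>) *\<^sub>C y) \<in> generator Y (ray \<beta>)"
proof -
  interpret A: c0_sg Y "ray \<alpha>" by (rule ray_c0[OF \<alpha>])
  interpret B: c0_sg Y "ray \<beta>" by (rule ray_c0[OF \<beta>])
  note xyY = A.G_in[OF xy[folded A.G_def]]
  have "(x, cis (\<beta> - \<alpha>) *\<^sub>C y) \<in> B.G"
  proof (rule B.G_I[OF xyY(1) YD(4)[OF xyY(2)] zero_less_one])
    fix t :: real assume t: "0 \<le> t" "t \<le> 1"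
    have "((\<lambda>s. ray \<beta> s (cis (\<beta> - \<alpha>) *\<^sub>C y)) has_integral (ray \<beta> t x - ray \<beta> 0 x)) {0..t}"
    proof (rule fundamental_theorem_of_calculus_interior[OF t(1) B.T_cont'[OF xyY(1)]])
      fix s assume s: "s \<in> {0<..<t}"
      define z where "z = of_real s * cis \<beta>"
      have z: "z \<in> sector 0 \<delta>" using ray_sector[OF \<beta>] s by (simp add: z_def)
      have "cis \<beta> *\<^sub>C D z x = cis (\<beta> - \<alpha>) *\<^sub>C (cis \<alpha> *\<^sub>C D z x)" by (simp add: scaleC_scaleC cis_mult)
      also have "\<dots> = cis (\<beta> - \<alpha>) *\<^sub>C U z y" by (simp add: D_generator[OF \<alpha> z xy])
      also have "\<dots> = U z (cis (\<beta> - \<alpha>) *\<^sub>C y)" using bounded_operator_onD(3)[OF U_bo[OF z] Y xyY(2)] by simp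
      finally show "((\<lambda>t. ray \<beta> t x) has_vector_derivative ray \<beta> s (cis (\<beta> - \<alpha>) *\<^sub>C y)) (at s)"
        using ray_deriv[OF \<beta>, of s x UNIV] s xyY by (simp add: z_def ray_def)
    qed simp
    then show "integral {0..t} (\<lambda>s. ray \<beta> s (cis (\<beta> - \<alpha>) *\<^sub>C y)) = ray \<beta> t x - x"
      by (simp add: integral_unique ray_0[OF xyY(1)])
  qed
  then show ?thesis by (simp add: B.G_def)
qed

lemma generator_ray_0: "generator Y (ray 0) = G"
proof -
  have "(x, y) \<in> generator Y (ray 0) \<longleftrightarrow> (x, y) \<in> G" for x y
  proof (cases "x \<in> Y")
    case True
    have "\<forall>\<^sub>F h in at_right 0. (ray 0 h x - x) /\<^sub>R h = (T h x - x) /\<^sub>R h"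
      unfolding eventually_at_right_field using True U_T by (intro exI[of _ 1]) (auto simp: ray_def)
    then show ?thesis using True tendsto_cong unfolding G_iff generator_def by fast
  qed (auto simp: G_iff generator_def)
  then show ?thesis by auto
qed

lemma real_sector: "0 < r \<Longrightarrow> of_real r \<in> sector 0 \<delta>"
  using ray_sector[of 0 r] \<delta> by simp

text \<open>Smoothing: for r > 0 orbits are differentiable at every initial vector, so T(r) maps
  \<open>Y\<close> into the domain of the generator.\<close>

lemma T_G: assumes r: "0 < r" and x: "x \<in> Y" shows "(T r x, D (of_real r) x) \<in> G"
proof -
  have "((\<lambda>t. ray 0 t x) has_vector_derivative D (of_real r) x) (at r within {r..})"
    using ray_deriv[of 0 r x "{r..}"] r x \<delta> by simp
  then have "((\<lambda>t. T t x) has_vector_derivative D (of_real r) x) (at r within {r..})"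
    by (rule has_vector_derivative_transform[rotated -1]) (use r x U_T in \<open>auto simp: ray_def\<close>)
  then have q: "((\<lambda>t. (T t x - T r x) /\<^sub>R (t - r)) \<longlongrightarrow> D (of_real r) x) (at_right r)"
    by (simp add: has_vector_derivative_iff_quotient at_within_Ici_at_right)
  have "((\<lambda>h. (T (h + r) x - T r x) /\<^sub>R h) \<longlongrightarrow> D (of_real r) x) (at_right 0)"
    using q unfolding filterlim_at_right_to_0[where a = r] by simp
  moreover have "\<forall>\<^sub>F h in at_right 0. (T (h + r) x - T r x) /\<^sub>R h = (T h (T r x) - T r x) /\<^sub>R h"
    unfolding eventually_at_right_field using r x T_add by (intro exI[of _ 1]) auto
  ultimately have "((\<lambda>h. (T h (T r x) - T r x) /\<^sub>R h) \<longlongrightarrow> D (of_real r) x) (at_right 0)"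
    by (rule Lim_transform_eventually)
  then show ?thesis using T_in r x by (simp add: G_iff)
qed

lemma G_dense: "Y \<subseteq> closure (Domain G)"
proof
  fix x assume x: "x \<in> Y"
  have "((\<lambda>t. T t x) \<longlongrightarrow> T 0 x) (at 0 within {0..})"
    using T_cont[OF x] by (simp add: continuous_on)
  then have "((\<lambda>t. T t x) \<longlongrightarrow> x) (at_right 0)"
    using T_0[OF x] by (metis at_within_Ici_at_right)
  moreover have "\<forall>\<^sub>F t in at_right 0. T t x \<in> closure (Domain G)"
    unfolding eventually_at_right_field
  proof (intro exI[of _ 1] conjI allI impI)
    fix t :: real assume "0 < t"
    show "T t x \<in> closure (Domain G)" by (rule subsetD[OF closure_subset DomainI[OF T_G[OF \<open>0 < t\<close> x]]])
  qed simp
  ultimately show "x \<in> closure (Domain G)"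
    by (intro Lim_in_closed_set[OF closed_closure _ trivial_limit_at_right_real])
qed

lemma D_in: "0 < r \<Longrightarrow> x \<in> Y \<Longrightarrow> D (of_real r) x \<in> Y"
  using G_in(2)[OF T_G] .

lemma D_semigroup: assumes "0 < s" "s \<le> r" "x \<in> Y" shows "D (of_real r) x = T (r - s) (D (of_real s) x)"
proof -
  have "(T (r - s) (T s x), T (r - s) (D (of_real s) x)) \<in> G"
    using assms by (intro G_T T_G) auto
  moreover have "T (r - s) (T s x) = T r x" using T_add[of "r - s" s x] assms by simp
  ultimately show ?thesis using T_G[of r x] assms G_linear(5) by (auto simp: single_valued_def)
qed

lemma D_eq: assumes "0 < r" "(x, y) \<in> G" shows "D (of_real r) x = T r y"
  using D_generator[of 0 "of_real r" x y] assms real_sector \<delta> U_T[of r y] G_in[OF assms(2)]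
  by (simp add: generator_ray_0)

text \<open>The classical bound C / r for the generator applied to T(r): Cauchy's estimate on a disc
  of radius proportional to r, on which \<open>U\<close> is uniformly bounded.\<close>

lemma D_estimate: "\<exists>\<eta>>0. \<exists>C\<ge>0. \<forall>r x. 0 < r \<longrightarrow> r < \<eta> \<longrightarrow> x \<in> Y \<longrightarrow> norm (D (of_real r) x) \<le> C / r * norm x"
proof -
  have \<delta>2: "0 < \<delta> / 2" "\<delta> / 2 < \<delta>" "\<delta> / 2 \<le> pi / 2" using \<delta> by auto
  have sub: "sector 0 (\<delta> / 2) \<subseteq> sector 0 \<delta>" using \<delta>2 by (auto simp: sector_0_iff)
  have bo2: "bounded_operator_on Y (U z)" if "z \<in> sector 0 (\<delta> / 2)" for z using U_bo sub that by blast
  obtain \<eta> K where \<eta>0: "0 < \<eta>" "1 \<le> K"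
    "\<forall>z\<in>sector 0 (\<delta> / 2). z \<noteq> 0 \<longrightarrow> dist z 0 < \<eta> \<longrightarrow> (\<forall>x\<in>Y. norm (U z x) \<le> K * norm x)"
    using uniform_bound_near[OF Y bo2 U_lim[OF \<delta>2(1,2)]] by blast
  then have \<eta>: "0 < \<eta>" "1 \<le> K"
    "\<And>z x. z \<in> sector 0 (\<delta> / 2) \<Longrightarrow> dist z 0 < \<eta> \<Longrightarrow> x \<in> Y \<Longrightarrow> norm (U z x) \<le> K * norm x"
    using sector_0_iff by blast+
  obtain \<kappa> where \<kappa>: "0 < \<kappa>" "\<kappa> < 1" "\<And>r. 0 < r \<Longrightarrow> cball (of_real r) (\<kappa> * r) \<subseteq> sector 0 (\<delta> / 2)"
    using cball_subset_sector_0[OF \<delta>2(1,3)] by blast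
  \<comment> \<open>For x in the domain the derivative is U(w) y, hence continuous as
    \<open>cauchy_estimate\<close> requires. The condition r < \<eta> / 2 keeps the disc inside |w|
    < \<eta>, since its radius is below r.\<close>
  have main: "norm (D (of_real r) x) \<le> K / \<kappa> / r * norm x" if r: "0 < r" "r < \<eta> / 2" and xy: "(x, y) \<in> G" for r x y
  proof -
    note xyY = G_in[OF xy]
    have "norm (U (of_real r) y) \<le> K * norm x / (\<kappa> * r)"
    proof (rule cauchy_estimate[where f = "\<lambda>w. U w x" and f' = "\<lambda>w. U w y"])
      show "0 < \<kappa> * r" using \<kappa> r by simp
      fix w :: complex assume w: "w \<in> cball (of_real r) (\<kappa> * r)"
      then have ws: "w \<in> sector 0 (\<delta> / 2)" "w \<in> sector 0 \<delta>" using \<kappa>(3)[OF r(1)] sub by auto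
      have "D w x = U w y" using D_generator[of 0 w x y] ws xy \<delta> by (simp add: generator_ray_0)
      then show "((\<lambda>w. U w x) has_derivative (\<lambda>h. h *\<^sub>C U w y)) (at w)"
        using U_deriv[OF ws(2) xyY(1)] by simp
      have "norm w \<le> norm (of_real r :: complex) + dist (of_real r) w"
        using norm_triangle_sub[of w "of_real r"] by (simp add: dist_norm norm_minus_commute)
      also have "\<dots> \<le> r + \<kappa> * r" using w r by simp
      also have "\<dots> < \<eta>" using r \<kappa> mult_strict_right_mono[OF \<kappa>(2) r(1)] by linarith
      finally show "norm (U w x) \<le> K * norm x" using \<eta>(3)[OF ws(1)] xyY by simp
    next
      show "continuous_on (cball (of_real r) (\<kappa> * r)) (\<lambda>w. U w y)"
        using \<kappa>(3)[OF r(1)] sub xyY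
        by (intro continuous_at_imp_continuous_on ballI has_derivative_continuous[OF U_deriv]) auto
    qed
    then show ?thesis using D_eq[OF r(1) xy] U_T[of r y] xyY r by (simp add: field_simps)
  qed
  have "norm (D (of_real r) x) \<le> K / \<kappa> / r * norm x" if r: "0 < r" "r < \<eta> / 2" and x: "x \<in> Y" for r x
  proof -
    obtain f where f: "\<And>n. f n \<in> Domain G" "f \<longlonglongrightarrow> x"
      using subsetD[OF G_dense x] unfolding closure_sequential by blast
    then have fY: "f n \<in> Y" for n using G_in by blast
    have "(\<lambda>n. D (of_real r) (f n)) \<longlonglongrightarrow> D (of_real r) x"
      using fY by (intro bounded_operator_on_tendsto[OF D(1)[OF real_sector[OF r(1)]] Y f(2) x]) auto
    from tendsto_norm[OF this] show ?thesis
    proof (rule LIMSEQ_le)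
      show "(\<lambda>n. K / \<kappa> / r * norm (f n)) \<longlonglongrightarrow> K / \<kappa> / r * norm x" by (intro tendsto_intros f)
      show "\<exists>N. \<forall>n\<ge>N. norm (D (of_real r) (f n)) \<le> K / \<kappa> / r * norm (f n)" using main[OF r] f(1) by blast
    qed
  qed
  moreover have "\<eta> / 2 > 0" "K / \<kappa> \<ge> 0" using \<eta> \<kappa> by auto
  ultimately show ?thesis by blast
qed

text \<open>Rotate the resolvent equation by cis \<beta>: the generator of ray \<beta> is cis
  \<beta> times \<open>G\<close>, and a suitable sign of \<beta> brings cis \<beta> z into the half
  plane where \<open>G_surj\<close> and \<open>G_apriori\<close> apply. Angle and constant do not
  depend on the vertex \<omega>, which is later moved to the right.\<close>

lemma sector_resolvent:
  "\<exists>\<theta> \<omega>\<^sub>0 m. pi / 2 < \<theta> \<and> \<theta> < pi \<and> 0 < m \<and> (\<forall>\<omega>\<ge>\<omega>\<^sub>0. \<forall>z\<in>sector \<omega> \<theta>.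
     (\<forall>w\<in>Y. \<exists>x. (x, z *\<^sub>C x - w) \<in> G) \<and>
     (\<forall>x y. (x, y) \<in> G \<longrightarrow> cmod (z - of_real \<omega>) * norm x \<le> m * norm (z *\<^sub>C x - y)))"
proof -
  define a where "a = \<delta> / 2"
  have a: "0 < a" "a < \<delta>" "\<bar>a\<bar> < \<delta>" "\<bar>- a\<bar> < \<delta>" "\<bar>0\<bar> < \<delta>" "a \<le> pi / 4" using \<delta> by (auto simp: a_def)
  have ca: "cos a > 0" using a by (intro cos_gt_zero) auto
  have sa: "sin (a / 2) > 0" using a by (intro sin_gt_zero) auto
  obtain K1 \<omega>1 where 1: "K1 \<ge> 1" "\<omega>1 \<ge> 0" "\<And>t x. t \<ge> 0 \<Longrightarrow> x \<in> Y \<Longrightarrow> norm (ray a t x) \<le> K1 * exp (\<omega>1 * t) * norm x"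
    using c0_sg.exp_bound[OF ray_c0[OF a(3)]] by blast
  obtain K2 \<omega>2 where 2: "K2 \<ge> 1" "\<omega>2 \<ge> 0" "\<And>t x. t \<ge> 0 \<Longrightarrow> x \<in> Y \<Longrightarrow> norm (ray (- a) t x) \<le> K2 * exp (\<omega>2 * t) * norm x"
    using c0_sg.exp_bound[OF ray_c0[OF a(4)]] by blast
  define K \<omega>' where "K = max K1 K2" and "\<omega>' = max \<omega>1 \<omega>2"
  have K: "K \<ge> 1" "\<omega>' \<ge> 0" using 1 2 by (auto simp: K_def \<omega>'_def)
  have ray_bound: "norm (ray \<beta> t x) \<le> K * exp (\<omega>' * t) * norm x"
    if "\<beta> = a \<or> \<beta> = - a" "t \<ge> 0" "x \<in> Y" for \<beta> t x
  proof -
    have "K1 * exp (\<omega>1 * t) * norm x \<le> K * exp (\<omega>' * t) * norm x" "K2 * exp (\<omega>2 * t) * norm x \<le> K * exp (\<omega>' * t) * norm x"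
      using 1(1,2) 2(1,2) that(2) by (auto intro!: mult_right_mono mult_mono simp: K_def \<omega>'_def)
    then show ?thesis using 1(3)[OF that(2,3)] 2(3)[OF that(2,3)] that(1) by auto
  qed
  \<comment> \<open>Only half of the available rotation a is spent on widening the half plane; the
    other half leaves the margin sin (a / 2) in the real part.\<close>
  define \<theta> where "\<theta> = pi / 2 + a / 2"
  define m where "m = K / sin (a / 2)"
  have *: "(\<forall>w\<in>Y. \<exists>x. (x, z *\<^sub>C x - w) \<in> G) \<and>
     (\<forall>x y. (x, y) \<in> G \<longrightarrow> cmod (z - of_real \<omega>) * norm x \<le> m * norm (z *\<^sub>C x - y))"
    if \<omega>: "\<omega> \<ge> \<omega>' / cos a" and z: "z \<in> sector \<omega> \<theta>" for \<omega> z
  proof -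
    define \<zeta> where "\<zeta> = z - of_real \<omega>"
    define \<phi> where "\<phi> = Arg \<zeta>"
    have \<zeta>0: "\<zeta> \<noteq> 0" and \<phi>: "\<bar>\<phi>\<bar> < \<theta>" using z by (auto simp: sector_def \<zeta>_def \<phi>_def)
    \<comment> \<open>The rotation goes against the argument of z - \<omega>, so the rotated
      argument is at most \<pi> / 2 - a / 2. The vertex contributes \<omega> cos a, which explains
      the threshold \<omega>' / cos a.\<close>
    define \<beta> where "\<beta> = (if \<phi> \<ge> 0 then - a else a)"
    have \<beta>: "\<bar>\<beta>\<bar> < \<delta>" "\<bar>\<beta>\<bar> = a" "\<beta> = a \<or> \<beta> = - a" using a by (auto simp: \<beta>_def)
    have "\<bar>\<phi> + \<beta>\<bar> \<le> pi / 2 - a / 2" using \<phi> a by (auto simp: \<beta>_def \<theta>_def)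
    then have "cos (pi / 2 - a / 2) \<le> cos \<bar>\<phi> + \<beta>\<bar>" using a by (intro cos_monotone_0_pi_le) auto
    then have c: "sin (a / 2) \<le> cos (\<phi> + \<beta>)" by (simp add: cos_diff)
    have "cis \<beta> * \<zeta> = of_real (cmod \<zeta>) * cis (\<phi> + \<beta>)"
      using Arg_eq[OF \<zeta>0] by (simp add: \<phi>_def cis_conv_exp exp_add distrib_left mult_ac)
    moreover have "cis \<beta> * z = of_real \<omega> * cis \<beta> + cis \<beta> * \<zeta>" by (simp add: \<zeta>_def algebra_simps)
    ultimately have "Re (cis \<beta> * z) = \<omega> * cos a + cmod \<zeta> * cos (\<phi> + \<beta>)"
      using \<beta>(2) cos_abs_real[of \<beta>] by simp
    moreover have "\<omega>' \<le> \<omega> * cos a" using \<omega> ca by (simp add: pos_divide_le_eq)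
    moreover have "cmod \<zeta> * sin (a / 2) \<le> cmod \<zeta> * cos (\<phi> + \<beta>)" using c by (intro mult_left_mono) auto
    ultimately have Re: "Re (cis \<beta> * z) - \<omega>' \<ge> cmod \<zeta> * sin (a / 2)" by linarith
    moreover have "cmod \<zeta> * sin (a / 2) > 0" using \<zeta>0 sa by simp
    ultimately have Re': "Re (cis \<beta> * z) > \<omega>'" by linarith
    interpret B: c0_sg Y "ray \<beta>" by (rule ray_c0[OF \<beta>(1)])
    have to: "(x, cis \<beta> *\<^sub>C y) \<in> B.G" if "(x, y) \<in> G" for x y
      using ray_generator[OF a(5) \<beta>(1), of x y] that by (simp add: generator_ray_0 B.G_def)
    have fro: "(x, cis (- \<beta>) *\<^sub>C y) \<in> G" if "(x, y) \<in> B.G" for x y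
      using ray_generator[OF \<beta>(1) a(5), of x y] that by (simp add: generator_ray_0 B.G_def)
    have dom: "Domain G \<subseteq> Domain B.G" using to by blast
    show ?thesis
    proof (intro conjI ballI allI impI)
      fix w assume "w \<in> Y"
      then obtain x where "(x, (cis \<beta> * z) *\<^sub>C x - cis \<beta> *\<^sub>C w) \<in> B.G"
        using B.G_surj[OF ray_bound[OF \<beta>(3)] subset_trans[OF G_dense closure_mono[OF dom]] Re', of "cis \<beta> *\<^sub>C w"] YD(4) by blast
      from fro[OF this] show "\<exists>x. (x, z *\<^sub>C x - w) \<in> G"
        by (auto simp: scaleC.diff_right scaleC_scaleC cis_mult mult.assoc[symmetric])
    next
      fix x y assume "(x, y) \<in> G"
      from B.G_apriori[OF ray_bound[OF \<beta>(3)] to[OF this] Re']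
      have "(Re (cis \<beta> * z) - \<omega>') * norm x \<le> K * norm ((cis \<beta> * z) *\<^sub>C x - cis \<beta> *\<^sub>C y)" .
      also have "(cis \<beta> * z) *\<^sub>C x - cis \<beta> *\<^sub>C y = cis \<beta> *\<^sub>C (z *\<^sub>C x - y)" by (simp add: scaleC.diff_right scaleC_scaleC)
      finally have "cmod \<zeta> * sin (a / 2) * norm x \<le> K * norm (z *\<^sub>C x - y)"
        using mult_right_mono[OF Re, of "norm x"] by (simp add: norm_scaleC)
      then show "cmod (z - of_real \<omega>) * norm x \<le> m * norm (z *\<^sub>C x - y)"
        using sa by (simp add: m_def \<zeta>_def field_simps)
    qed
  qed
  show ?thesis
    using * a K sa by (intro exI[of _ \<theta>] exI[of _ "\<omega>' / cos a"] exI[of _ m]) (auto simp: \<theta>_def m_def)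
qed

end

lemma analytic_semigroup_imp_analytic_sg:
  assumes "closed_csubspace Y" "analytic_semigroup Y T"
  obtains \<delta> U where "analytic_sg Y T \<delta> U"
  using assms unfolding analytic_semigroup_def analytic_sg_def analytic_sg_axioms_def c0_sg_def by blast

section \<open>Operators satisfying the analytic resolvent condition\<close>

lemma part_generates_imp_c0:
  "linear_operator B \<Longrightarrow> part_generates B T \<Longrightarrow> c0_sg (closure (Domain B)) T"
  by (auto simp: part_generates_def intro!: c0_sg.intro closed_csubspace_Domain)

lemma part_generates_part_semigroup: "part_generates B T \<Longrightarrow> part_generates B (part_semigroup B)"
  unfolding part_semigroup_def by (rule someI[of "part_generates B" T])

text \<open>The semigroup picked by \<open>SOME\<close> need not be the one known to be analytic;
  uniqueness, which is \<open>semigroup_intertwining\<close> with the identity, transfers the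
  analytic extension.\<close>

lemma part_semigroup_analytic:
  assumes B: "linear_operator B" and T: "part_generates B T" "analytic_semigroup (closure (Domain B)) T"
  shows "\<exists>\<delta> U. analytic_sg (closure (Domain B)) (part_semigroup B) \<delta> U"
proof -
  let ?Y = "closure (Domain B)"
  obtain \<delta> U where "analytic_sg ?Y T \<delta> U"
    using analytic_semigroup_imp_analytic_sg[OF closed_csubspace_Domain[OF B] T(2)] .
  then interpret T: analytic_sg ?Y T \<delta> U .
  note S = part_generates_part_semigroup[OF T(1)]
  interpret S: c0_sg ?Y "part_semigroup B" by (rule part_generates_imp_c0[OF B S])
  have G: "T.G = op_part B" "S.G = op_part B"
    using T(1) S by (auto simp: part_generates_def T.G_def S.G_def)
  have eq: "part_semigroup B t x = T t x" if "0 \<le> t" "x \<in> ?Y" for t x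
    using semigroup_intertwining[OF T.c0_sg_axioms S.c0_sg_axioms bounded_linear_ident _ _ _ that]
      T.G_dense G by (simp add: T.G_def S.G_def)
  have "analytic_sg ?Y (part_semigroup B) \<delta> U"
    using T.\<delta> T.U_T eq T.U_bo T.U_add T.U_hol T.U_lim by unfold_locales auto
  then show ?thesis by blast
qed

locale analytic_operator = analytic_sg "closure (Domain B)" T \<delta> U
  for B :: "'x::complex_banach operator" and T \<delta> U +
  fixes r\<^sub>0 C\<^sub>0 \<alpha> :: real
  assumes B: "linear_operator B" and GB: "G = op_part B"
    and r0: "0 < r\<^sub>0" and res: "\<And>r. r \<ge> r\<^sub>0 \<Longrightarrow> complex_of_real r \<in> resolvent_set B"
    and C0: "C\<^sub>0 \<ge> 0"
    and R_norm': "\<And>r x. r \<ge> r\<^sub>0 \<Longrightarrow> norm (resolvent B (complex_of_real r) x) \<le> C\<^sub>0 * r powr (- \<alpha>) * norm x"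
begin

abbreviation "Y \<equiv> closure (Domain B)"

definition R where "R r = resolvent B (complex_of_real r)"

lemma R_norm: "r \<ge> r\<^sub>0 \<Longrightarrow> norm (R r x) \<le> C\<^sub>0 * r powr (- \<alpha>) * norm x"
  using R_norm' by (simp add: R_def)

lemma R_mem: "r \<ge> r\<^sub>0 \<Longrightarrow> (R r x, r *\<^sub>R R r x - x) \<in> B"
  using resolvent_mem[OF res] by (simp add: R_def scaleC_of_real)

lemma R_eq: "r \<ge> r\<^sub>0 \<Longrightarrow> (u, v) \<in> B \<Longrightarrow> R r (r *\<^sub>R u - v) = u"
  using resolvent_eq[OF res] by (simp add: R_def scaleC_of_real)

lemma R_bl: "r \<ge> r\<^sub>0 \<Longrightarrow> bounded_linear (R r)"
  unfolding R_def by (rule resolvent_bounded_linear[OF res])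

lemma R_in: "r \<ge> r\<^sub>0 \<Longrightarrow> R r x \<in> Y"
  by (rule subsetD[OF closure_subset DomainI[OF R_mem]])

lemma R_identity: "r \<ge> r\<^sub>0 \<Longrightarrow> s \<ge> r\<^sub>0 \<Longrightarrow> R r x - R s x = (s - r) *\<^sub>R R r (R s x)"
  using resolvent_identity[OF B res res, of r s x] scaleC_of_real[of "s - r"] by (simp add: R_def)

lemmas Dl = bounded_operator_onD[OF D(1)[OF real_sector] Y]

text \<open>The extension (r_0 - B_0) T(t) (r_0 - B)^-1 of T(t) from \<open>Y\<close> to the whole
  space. It makes sense for t > 0 since T(t) maps \<open>Y\<close> into the domain of B_0.\<close>

definition E where "E t x = r\<^sub>0 *\<^sub>R T t (R r\<^sub>0 x) - D (of_real t) (R r\<^sub>0 x)"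

text \<open>The resolvent identity makes the extension independent of the point \<nu>, which may
  therefore be chosen as a function of t.\<close>

lemma E_eq: assumes t: "0 < t" and \<nu>: "\<nu> \<ge> r\<^sub>0"
  shows "E t x = \<nu> *\<^sub>R T t (R \<nu> x) - D (of_real t) (R \<nu> x)"
proof -
  define y where "y = R r\<^sub>0 x"
  define w where "w = R \<nu> y"
  have yY: "y \<in> Y" and wY: "w \<in> Y" using R_in \<nu> by (auto simp: y_def w_def)
  have "(w, \<nu> *\<^sub>R w - y) \<in> B" unfolding w_def by (rule R_mem[OF \<nu>])
  moreover have "\<nu> *\<^sub>R w - y \<in> Y" using wY yY YD by auto
  ultimately have "(w, \<nu> *\<^sub>R w - y) \<in> G" by (simp add: GB op_part_def)
  then have Dw: "D (of_real t) w = \<nu> *\<^sub>R T t w - T t y"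
    using D_eq[OF t] t wY yY YD by (simp add: T_diff T_scaleR)
  have "R \<nu> x = y + (r\<^sub>0 - \<nu>) *\<^sub>R w" using R_identity[OF \<nu> order_refl, of x] by (simp add: w_def y_def algebra_simps)
  then have "\<nu> *\<^sub>R T t (R \<nu> x) - D (of_real t) (R \<nu> x)
      = \<nu> *\<^sub>R (T t y + (r\<^sub>0 - \<nu>) *\<^sub>R T t w) - (D (of_real t) y + (r\<^sub>0 - \<nu>) *\<^sub>R D (of_real t) w)"
    using t yY wY YD bounded_operator_onD(2)[OF bo Y] by (simp add: T_scaleR Dl)
  also have "\<dots> = r\<^sub>0 *\<^sub>R T t y - D (of_real t) y" by (simp add: Dw algebra_simps)
  finally show ?thesis by (simp add: E_def y_def)
qed

lemma E_diff: "0 < t \<Longrightarrow> E t (x - y) = E t x - E t y"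
  and E_scaleR: "0 < t \<Longrightarrow> E t (r *\<^sub>R x) = r *\<^sub>R E t x"
proof -
  interpret R: bounded_linear "R r\<^sub>0" by (rule R_bl) simp
  show "0 < t \<Longrightarrow> E t (x - y) = E t x - E t y" "0 < t \<Longrightarrow> E t (r *\<^sub>R x) = r *\<^sub>R E t x"
    by (simp_all add: E_def R.diff R.scaleR T_diff T_scaleR R_in Dl algebra_simps)
qed

lemma E_Y: assumes t: "0 < t" and u: "u \<in> Y" shows "E t u = T t u"
proof -
  have wY: "R r\<^sub>0 u \<in> Y" by (simp add: R_in)
  then have "r\<^sub>0 *\<^sub>R R r\<^sub>0 u - u \<in> Y" using u YD by auto
  then have "(R r\<^sub>0 u, r\<^sub>0 *\<^sub>R R r\<^sub>0 u - u) \<in> G" using R_mem[of r\<^sub>0 u] by (simp add: GB op_part_def)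
  then show ?thesis using D_eq[OF t] t u wY YD by (simp add: E_def T_diff T_scaleR)
qed

text \<open>Here v = B u may lie outside \<open>Y\<close>, where T(t) v has no meaning; the
  extension still commutes with B in the sense E(t) B u = B_0 T(t) u.\<close>

lemma E_B: assumes t: "0 < t" and uv: "(u, v) \<in> B" shows "E t v = D (of_real t) u"
proof -
  have u: "u \<in> Y" by (rule subsetD[OF closure_subset DomainI[OF uv]])
  have "E t (r\<^sub>0 *\<^sub>R u - v) = r\<^sub>0 *\<^sub>R T t u - D (of_real t) u"
    using R_eq[OF _ uv] by (simp add: E_def)
  then show ?thesis using E_Y[OF t u] by (simp add: E_diff[OF t] E_scaleR[OF t])
qed

text \<open>Near t the derivative factors through time t / 2 by \<open>D_semigroup\<close>, so
  strong continuity of T suffices.\<close>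

lemma D_continuous: assumes x: "x \<in> Y" shows "continuous_on {0<..} (\<lambda>t. D (of_real t) x)"
proof (intro continuous_at_imp_continuous_on ballI)
  fix t :: real assume "t \<in> {0<..}"
  then have t: "0 < t / 2" "t / 2 < t" by auto
  have "((\<lambda>s. T (s - t / 2) (D (of_real (t / 2)) x)) \<longlongrightarrow> T (t - t / 2) (D (of_real (t / 2)) x)) (at t)"
  proof (rule T_tendsto)
    show "((\<lambda>s. s - t / 2) \<longlongrightarrow> t - t / 2) (at t)" by (intro tendsto_intros)
    show "\<forall>\<^sub>F s in at t. 0 \<le> s - t / 2 \<and> D (of_real (t / 2)) x \<in> Y"
      using eventually_at_in_open'[of "{t/2<..}" t] D_in[OF t(1) x] t(2) by (auto elim: eventually_mono)
  qed (use t D_in[OF t(1) x] in auto)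
  moreover have "\<forall>\<^sub>F s in at t. T (s - t / 2) (D (of_real (t / 2)) x) = D (of_real s) x"
    using eventually_at_in_open'[of "{t/2<..}" t] D_semigroup[OF t(1) _ x] t(2) by (auto elim!: eventually_mono)
  ultimately have "((\<lambda>s. D (of_real s) x) \<longlongrightarrow> T (t - t / 2) (D (of_real (t / 2)) x)) (at t)"
    by (rule Lim_transform_eventually)
  then show "isCont (\<lambda>s. D (of_real s) x) t"
    using D_semigroup[OF t(1) less_imp_le[OF t(2)] x] by (simp add: isCont_def)
qed

lemma E_continuous: "continuous_on {0<..} (\<lambda>t. E t x)"
  unfolding E_def
  by (intro continuous_intros D_continuous continuous_on_subset[OF T_cont] R_in) auto

lemma T_deriv: assumes t: "0 < t" and u: "u \<in> Y"
  shows "((\<lambda>t. T t u) has_vector_derivative D (of_real t) u) (at t)"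
proof -
  have "((\<lambda>t. ray 0 t u) has_vector_derivative D (of_real t) u) (at t)"
    using ray_deriv[of 0 t u UNIV] t u \<delta> by simp
  then show ?thesis
    by (rule has_vector_derivative_transform_within_open[of _ _ _ "{0<..}"]) (use t u U_T in \<open>auto simp: ray_def\<close>)
qed

text \<open>The choice \<open>\<nu> = 1 / t\<close> balances the two terms of \<open>E_eq\<close>.\<close>

lemma E_estimate: "\<exists>\<eta>>0. \<exists>C\<ge>0. \<forall>t x. 0 < t \<longrightarrow> t < \<eta> \<longrightarrow> norm (E t x) \<le> C * t powr (\<alpha> - 1) * norm x"
proof -
  obtain K where K: "K \<ge> 1" "\<And>t x. t \<in> {0..1} \<Longrightarrow> x \<in> Y \<Longrightarrow> norm (T t x) \<le> K * norm x"
    using local_bound[of 1] by blast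
  obtain \<eta> C where \<eta>: "0 < \<eta>" "0 \<le> C" "\<And>t x. 0 < t \<Longrightarrow> t < \<eta> \<Longrightarrow> x \<in> Y \<Longrightarrow> norm (D (of_real t) x) \<le> C / t * norm x"
    using D_estimate by blast
  have "norm (E t x) \<le> (K + C) * C\<^sub>0 * t powr (\<alpha> - 1) * norm x" if t: "0 < t" "t < min \<eta> (min 1 (1 / r\<^sub>0))" for t x
  proof -
    have \<nu>: "1 / t \<ge> r\<^sub>0" using t r0 by (simp add: field_simps)
    have "norm (E t x) \<le> norm ((1 / t) *\<^sub>R T t (R (1 / t) x)) + norm (D (of_real t) (R (1 / t) x))"
      unfolding E_eq[OF t(1) \<nu>] by (rule norm_triangle_ineq4)
    also have "\<dots> \<le> (1 / t) * (K * norm (R (1 / t) x)) + C / t * norm (R (1 / t) x)"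
      using t K(2)[of t "R (1 / t) x"] \<eta>(3)[of t "R (1 / t) x"] R_in[OF \<nu>]
      by (intro add_mono) (auto intro!: divide_right_mono)
    also have "\<dots> = (K + C) * (1 / t) * norm (R (1 / t) x)" by (simp add: distrib_right add_divide_distrib)
    also have "\<dots> \<le> (K + C) * (1 / t) * (C\<^sub>0 * (1 / t) powr (- \<alpha>) * norm x)"
      using K \<eta> t by (intro mult_left_mono R_norm[OF \<nu>]) auto
    also have "(1 / t) powr (- \<alpha>) = t powr \<alpha>" using t by (simp add: powr_divide powr_minus_divide)
    also have "(K + C) * (1 / t) * (C\<^sub>0 * t powr \<alpha> * norm x) = (K + C) * C\<^sub>0 * t powr (\<alpha> - 1) * norm x"
      using t by (simp add: powr_diff)
    finally show ?thesis .
  qed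
  moreover have "min \<eta> (min 1 (1 / r\<^sub>0)) > 0" "(K + C) * C\<^sub>0 \<ge> 0" using \<eta> r0 K C0 by auto
  ultimately show ?thesis by blast
qed

section \<open>Bounded operators commuting with the resolvent of \<open>B\<close>\<close>

context
  fixes Q assumes Q: "bounded_linear Q" and QR: "\<And>x. Q (R r\<^sub>0 x) = R r\<^sub>0 (Q x)"
begin

interpretation Q: bounded_linear Q by (rule Q)

lemma commuting_B: assumes "(x, y) \<in> B" shows "(Q x, Q y) \<in> B"
proof -
  have "R r\<^sub>0 (r\<^sub>0 *\<^sub>R x - y) = x" by (rule R_eq[OF order_refl assms])
  then have "Q x = R r\<^sub>0 (r\<^sub>0 *\<^sub>R Q x - Q y)" using QR[of "r\<^sub>0 *\<^sub>R x - y"] by (simp add: Q.diff Q.scaleR)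
  then show ?thesis using R_mem[OF order_refl, of "r\<^sub>0 *\<^sub>R Q x - Q y"] by simp
qed

lemma commuting_Y: assumes "x \<in> Y" shows "Q x \<in> Y"
proof -
  obtain f where f: "\<And>n. f n \<in> Domain B" "f \<longlonglongrightarrow> x" using assms unfolding closure_sequential by blast
  have "Q (f n) \<in> Domain B" for n using f(1)[of n] commuting_B by blast
  then show ?thesis unfolding closure_sequential using Q.tendsto[OF f(2)] by (intro exI[of _ "\<lambda>n. Q (f n)"]) auto
qed

lemma commuting_G: "(x, y) \<in> G \<Longrightarrow> (Q x, Q y) \<in> G"
  using commuting_B commuting_Y by (auto simp: GB op_part_def)

lemma commuting_T: "0 \<le> t \<Longrightarrow> x \<in> Y \<Longrightarrow> Q (T t x) = T t (Q x)"
  using semigroup_intertwining[OF c0_sg_axioms c0_sg_axioms Q commuting_Y] commuting_G G_dense by (simp add: G_def)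

lemma commuting_D: assumes t: "0 < t" and x: "x \<in> Y" shows "Q (D (of_real t) x) = D (of_real t) (Q x)"
proof -
  have "(Q (T t x), Q (D (of_real t) x)) \<in> G" by (rule commuting_G[OF T_G[OF t x]])
  then show ?thesis
    using T_G[OF t commuting_Y[OF x]] commuting_T[of t x] t x G_linear(5) by (auto simp: single_valued_def)
qed

lemma commuting_E: "0 < t \<Longrightarrow> Q (E t x) = E t (Q x)"
  unfolding E_def by (simp add: Q.diff Q.scaleR commuting_T commuting_D R_in QR)

end

end

section \<open>The convolution with the integrated semigroup\<close>

text \<open>The approximants sample g at left grid points. These stay below \<tau>, where g is
  continuous, although g may be singular at \<tau>.\<close>

lemma strongly_measurable_piecewise:
  fixes g :: "real \<Rightarrow> 'x::real_normed_vector"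
  assumes cont: "continuous_on {0..<\<tau>} g" and zero: "\<And>s. \<tau> \<le> s \<Longrightarrow> g s = 0"
  shows "strongly_measurable g"
  unfolding strongly_measurable_def
proof (intro exI conjI allI)
  \<comment> \<open>The index -1 encodes s \<ge> \<tau>, where g vanishes; all other indices met on
    [0, \<infinity>) are nonnegative.\<close>
  define k where "k n s = (if s < \<tau> then \<lfloor>real (Suc n) * s\<rfloor> else - 1)" for n and s :: real
  define \<phi> where "\<phi> n j = (if j < 0 then 0 else g (of_int j / real (Suc n)))" for n and j :: int
  show "simple_function (lebesgue_on {0..}) (\<lambda>s. \<phi> n (k n s))" for n
  proof -
    have "simple_function (lebesgue_on {0..}) (k n)"
      unfolding simple_function_def
    proof (intro conjI ballI)
      have "k n s \<in> {- 1..\<lfloor>real (Suc n) * \<bar>\<tau>\<bar>\<rfloor>}" if "s \<in> {0..}" for s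
      proof (cases "s < \<tau>")
        case True
        then have "real (Suc n) * s \<le> real (Suc n) * \<bar>\<tau>\<bar>" by (intro mult_left_mono) auto
        moreover have "0 \<le> real (Suc n) * s" using that by simp
        ultimately show ?thesis using True by (simp add: k_def floor_mono del: of_nat_Suc) linarith
      next
        case False
        have "0 \<le> \<lfloor>real (Suc n) * \<bar>\<tau>\<bar>\<rfloor>" by simp
        moreover have "k n s = - 1" using False by (simp add: k_def)
        ultimately show ?thesis unfolding atLeastAtMost_iff by linarith
      qed
      then show "finite (k n ` space (lebesgue_on {0..}))"
        by (intro finite_subset[OF _ finite_atLeastAtMost_int[of "- 1" "\<lfloor>real (Suc n) * \<bar>\<tau>\<bar>\<rfloor>"]]) auto
      have "k n \<in> measurable borel (count_space UNIV)" unfolding k_def by measurable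
      then have "k n \<in> measurable (lebesgue_on {0..}) (count_space UNIV)"
        by (intro measurable_restrict_space1 measurable_completion) simp
      from measurable_sets[OF this] show "k n -` {j} \<inter> space (lebesgue_on {0..}) \<in> sets (lebesgue_on {0..})" for j
        by simp
    qed
    from simple_function_compose[OF this, of "\<phi> n"] show ?thesis by (simp add: o_def)
  qed
  have "(\<lambda>n. \<phi> n (k n t)) \<longlonglongrightarrow> g t" if t: "t \<in> {0..}" for t
  proof (cases "t < \<tau>")
    case True
    define q where "q n = of_int \<lfloor>real (Suc n) * t\<rfloor> / real (Suc n)" for n
    have q: "0 \<le> q n" "q n \<le> t" "t - 1 / real (Suc n) \<le> q n" for n
    proof -
      have p: "0 < real (Suc n)" by simp
      show "0 \<le> q n" using t by (simp add: q_def)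
      have "of_int \<lfloor>real (Suc n) * t\<rfloor> \<le> t * real (Suc n)" by (simp add: mult.commute)
      then show "q n \<le> t" unfolding q_def using p by (simp only: pos_divide_le_eq)
      have "real (Suc n) * t - 1 \<le> of_int \<lfloor>real (Suc n) * t\<rfloor>" by linarith
      then have "(real (Suc n) * t - 1) / real (Suc n) \<le> q n" unfolding q_def using p by (intro divide_right_mono) auto
      then show "t - 1 / real (Suc n) \<le> q n" using p by (simp add: diff_divide_distrib)
    qed
    have "(\<lambda>n. t - 1 / real (Suc n)) \<longlonglongrightarrow> t - 0"
      using LIMSEQ_inverse_real_of_nat by (intro tendsto_diff tendsto_const) (simp add: inverse_eq_divide)
    then have "q \<longlonglongrightarrow> t"
      by (intro tendsto_sandwich[of "\<lambda>n. t - 1 / real (Suc n)" q _ "\<lambda>n. t"]) (use q in auto)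
    then have "(\<lambda>n. g (q n)) \<longlonglongrightarrow> g t"
      using q le_less_trans[OF q(2) True] t True by (intro continuous_on_tendsto_compose[OF cont]) auto
    moreover have "\<phi> n (k n t) = g (q n)" for n
    proof -
      have "0 \<le> real (Suc n) * t" using t by simp
      then have "0 \<le> \<lfloor>real (Suc n) * t\<rfloor>" by (simp only: zero_le_floor)
      then show ?thesis using True unfolding \<phi>_def k_def q_def by (simp del: of_nat_Suc zero_le_floor floor_less_zero)
    qed
    ultimately show ?thesis by simp
  qed (auto simp: \<phi>_def k_def zero)
  then show "AE t in lebesgue_on {0..}. (\<lambda>n. \<phi> n (k n t)) \<longlonglongrightarrow> g t" by (intro AE_I2) auto
qed

lemma has_integral_reflected_powr:
  fixes \<tau> c :: real
  assumes "0 \<le> \<tau>" "c < 1"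
  shows "((\<lambda>s. (\<tau> - s) powr (- c)) has_integral (\<tau> powr (1 - c) / (1 - c))) {0..\<tau>}"
proof -
  have "((\<lambda>s. (\<tau> - s) powr (- c)) has_integral
     (- ((\<tau> - \<tau>) powr (1 - c) / (1 - c)) - - ((\<tau> - 0) powr (1 - c) / (1 - c)))) {0..\<tau>}"
  proof (rule fundamental_theorem_of_calculus_interior[OF assms(1)])
    show "continuous_on {0..\<tau>} (\<lambda>s. - ((\<tau> - s) powr (1 - c) / (1 - c)))"
      using assms(2) by (intro continuous_intros continuous_on_powr') auto
    fix s assume "s \<in> {0<..<\<tau>}"
    then have "((\<lambda>s. - ((\<tau> - s) powr (1 - c) / (1 - c))) has_real_derivative (\<tau> - s) powr (- c)) (at s)"
      using assms(2) by (auto intro!: derivative_eq_intros)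
    then show "((\<lambda>s. - ((\<tau> - s) powr (1 - c) / (1 - c))) has_vector_derivative (\<tau> - s) powr (- c)) (at s)"
      by (simp add: has_real_derivative_iff_has_vector_derivative)
  qed
  then show ?thesis by simp
qed

text \<open>The p-th power of the norm is dominated by a multiple of (\<tau> - s)^(-bp), integrable
  up to \<tau> because b p < 1.\<close>

lemma Lp_loc_piecewise:
  fixes g :: "real \<Rightarrow> 'x::real_normed_vector"
  assumes \<tau>: "0 \<le> \<tau>" and cont: "continuous_on {0..<\<tau>} g" and zero: "\<And>s. \<tau> \<le> s \<Longrightarrow> g s = 0"
    and p: "0 < p" and C: "0 \<le> C" and b: "b * p < 1"
    and bound: "\<And>s. 0 \<le> s \<Longrightarrow> s < \<tau> \<Longrightarrow> norm (g s) \<le> C * (\<tau> - s) powr (- b)"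
  shows "Lp_loc p g"
  unfolding Lp_loc_def
proof (intro conjI allI impI)
  show "strongly_measurable g" by (rule strongly_measurable_piecewise[OF cont zero])
  fix \<sigma> :: real assume "0 \<le> \<sigma>"
  define m where "m s = (if s \<in> {0..\<tau>} then C powr p * (\<tau> - s) powr (- (b * p)) else 0)" for s
  have "m integrable_on UNIV"
    unfolding m_def integrable_restrict_UNIV
    by (rule has_integral_integrable[OF has_integral_mult_right[OF has_integral_reflected_powr[OF \<tau> b]]])
  then have m: "m integrable_on {0..\<sigma>}"
    using integrable_on_subcbox[of m UNIV 0 \<sigma>] by simp
  show "set_integrable lebesgue {0..\<sigma>} (\<lambda>s. norm (g s) powr p)"
  proof (rule measurable_bounded_by_integrable_imp_absolutely_integrable[OF _ _ m])
    have "(\<lambda>s. if s \<in> {0..<\<tau>} then norm (g s) powr p else 0) \<in> borel_measurable borel"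
      using p by (intro borel_measurable_continuous_on_if continuous_intros continuous_on_powr' cont) auto
    then have "(\<lambda>s. if s \<in> {0..<\<tau>} then norm (g s) powr p else 0) \<in> borel_measurable (lebesgue_on {0..\<sigma>})"
      by (intro measurable_restrict_space1 measurable_completion) simp
    moreover have "(\<lambda>s. if s \<in> {0..<\<tau>} then norm (g s) powr p else 0) \<in> borel_measurable (lebesgue_on {0..\<sigma>})
        \<longleftrightarrow> (\<lambda>s. norm (g s) powr p) \<in> borel_measurable (lebesgue_on {0..\<sigma>})"
      by (rule measurable_cong) (auto simp: zero)
    ultimately show "(\<lambda>s. norm (g s) powr p) \<in> borel_measurable (lebesgue_on {0..\<sigma>})" by simp
    fix s assume s: "s \<in> {0..\<sigma>}"
    show "norm (norm (g s) powr p) \<le> m s"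
    proof (cases "s < \<tau>")
      case True
      have "norm (g s) powr p \<le> (C * (\<tau> - s) powr (- b)) powr p"
        using bound[of s] s True p by (intro powr_mono2) auto
      also have "\<dots> = m s" using C s True by (simp add: powr_mult powr_powr m_def)
      finally show ?thesis by simp
    qed (use zero m_def in auto)
  qed simp
qed

lemma continuous_on_tendsto_within:
  assumes "continuous_on S f" "x \<in> S" "S' \<subseteq> S" shows "(f \<longlongrightarrow> f x) (at x within S')"
  using assms(1,2) tendsto_within_subset[OF _ assms(3)] unfolding continuous_on by blast

text \<open>Trades exponential decay for a power: with y proportional to r (\<tau> - s), part of the
  decay becomes a negative power of r at the cost of a stronger singularity at \<tau>.\<close>

lemma exp_minus_le_powr:
  fixes y :: real
  assumes "0 < y" "0 \<le> c" "c \<le> 1" shows "exp (- y) \<le> y powr (- c)"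
proof -
  have "y powr c \<le> max 1 y"
  proof (cases "y \<le> 1")
    case True
    then show ?thesis using assms powr_le1[of c y] by simp
  next
    case False
    then show ?thesis using assms powr_mono[of c 1 y] by simp
  qed
  also have "\<dots> \<le> exp y" using assms(1) exp_ge_add_one_self[of y] by (intro max.boundedI) linarith+
  finally show ?thesis using assms(1) by (simp add: exp_minus powr_minus le_imp_inverse_le)
qed

text \<open>If \<open>f\<close> is not integrable, its integral has the default value 0, which also
  lies between 0 and \<open>I\<close>.\<close>

lemma integral_mono_of_integrable_majorant:
  fixes f g :: "real \<Rightarrow> real"
  assumes "(g has_integral I) S" "\<And>s. s \<in> S \<Longrightarrow> 0 \<le> f s" "\<And>s. s \<in> S \<Longrightarrow> f s \<le> g s"
  shows "0 \<le> integral S f" "integral S f \<le> I"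
proof -
  have "0 \<le> integral S f \<and> integral S f \<le> I"
  proof (cases "f integrable_on S")
    case True
    then show ?thesis using integral_nonneg[OF True] has_integral_le[OF integrable_integral[OF True] assms(1)] assms by auto
  next
    case False
    have "0 \<le> I" by (rule has_integral_nonneg[OF assms(1)]) (use assms order_trans in blast)
    then show ?thesis using False by (simp add: not_integrable_integral)
  qed
  then show "0 \<le> integral S f" "integral S f \<le> I" by auto
qed

context hille_yosida_operator
begin

lemma part_semigroup_generates: "part_generates A (part_semigroup A)"
  using hille_yosida_generation part_generates_part_semigroup by blast

sublocale T: c0_sg Y "part_semigroup A"
  unfolding Y_def by (rule part_generates_imp_c0[OF A part_semigroup_generates])

lemma T_G: "T.G = op_part A"
  unfolding T.G_def using part_semigroup_generates by (simp add: part_generates_def Y_def)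

lemma R_G: "r > \<omega> \<Longrightarrow> y \<in> Y \<Longrightarrow> (R r y, r *\<^sub>R R r y - y) \<in> T.G"
  using R_mem[of r y] YD(5,7) R_in by (simp add: T_G op_part_def Y_def[symmetric])

lemma Domain_in: "(u, v) \<in> A \<Longrightarrow> u \<in> Y"
  unfolding Y_def by (rule subsetD[OF closure_subset DomainI])

section \<open>The integrated semigroup and its convolutions\<close>

context
  fixes \<mu> assumes \<mu>: "\<mu> > \<omega>"
begin

lemma integrated_semigroup_eq: "integrated_semigroup A \<mu> t x =
   \<mu> *\<^sub>R integral {0..t} (\<lambda>s. part_semigroup A s (R \<mu> x)) + R \<mu> x - part_semigroup A t (R \<mu> x)"
  by (simp add: integrated_semigroup_def Let_def R_def)

interpretation R: bounded_linear "R \<mu>" by (rule R_bl[OF \<mu>])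

lemma T_integrable: "x \<in> Y \<Longrightarrow> (\<lambda>s. part_semigroup A s x) integrable_on {0..t}"
  by (intro integrable_continuous_real T.T_cont') auto

lemma T_integral_diff: "x \<in> Y \<Longrightarrow> y \<in> Y \<Longrightarrow>
  integral {0..t} (\<lambda>s. part_semigroup A s (x - y)) = integral {0..t} (\<lambda>s. part_semigroup A s x) - integral {0..t} (\<lambda>s. part_semigroup A s y)"
  unfolding integral_diff[OF T_integrable T_integrable, symmetric] by (intro integral_cong) (simp add: T.T_diff)

lemma T_integral_scaleR: "x \<in> Y \<Longrightarrow>
  integral {0..t} (\<lambda>s. part_semigroup A s (r *\<^sub>R x)) = r *\<^sub>R integral {0..t} (\<lambda>s. part_semigroup A s x)"
  unfolding integral_cmul[symmetric] by (intro integral_cong) (simp add: T.T_scaleR)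

lemma integrated_semigroup_diff: "0 \<le> t \<Longrightarrow>
  integrated_semigroup A \<mu> t (x - y) = integrated_semigroup A \<mu> t x - integrated_semigroup A \<mu> t y"
  by (simp add: integrated_semigroup_eq R.diff T_integral_diff R_in[OF \<mu>] T.T_diff algebra_simps)

text \<open>For y in \<open>Y\<close>, R(\<mu>) y lies in the domain of the generator, so
  \<open>G_integral\<close> evaluates T(t) R(\<mu>) y - R(\<mu>) y and the resolvent terms
  cancel.\<close>

lemma integrated_semigroup_on_Y: assumes "0 \<le> t" "y \<in> Y"
  shows "integrated_semigroup A \<mu> t y = integral {0..t} (\<lambda>s. part_semigroup A s y)"
proof -
  have "part_semigroup A t (R \<mu> y) - R \<mu> y = integral {0..t} (\<lambda>s. part_semigroup A s (\<mu> *\<^sub>R R \<mu> y - y))"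
    using T.G_integral[OF R_G[OF \<mu> assms(2)] assms(1)] by (simp add: integral_unique)
  also have "\<dots> = \<mu> *\<^sub>R integral {0..t} (\<lambda>s. part_semigroup A s (R \<mu> y)) - integral {0..t} (\<lambda>s. part_semigroup A s y)"
    using assms R_in[OF \<mu>] by (simp add: T_integral_diff T_integral_scaleR YD(5))
  finally show ?thesis by (simp add: integrated_semigroup_eq algebra_simps)
qed

text \<open>Although v = A u may leave \<open>Y\<close>, R(\<mu>) v = \<mu> R(\<mu>) u - u is the
  generator applied to R(\<mu>) u. Hence the integral in the definition is again explicit.\<close>

lemma integrated_semigroup_A: assumes "0 \<le> t" "(u, v) \<in> A"
  shows "integrated_semigroup A \<mu> t v = part_semigroup A t u - u"
proof -
  have u: "u \<in> Y" by (rule Domain_in[OF assms(2)])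
  define w where "w = R \<mu> u"
  have w: "w \<in> Y" by (simp add: w_def R_in \<mu>)
  have v: "R \<mu> v = \<mu> *\<^sub>R w - u" using R_eq[OF \<mu> assms(2)] by (simp add: w_def R.diff R.scaleR algebra_simps)
  have "integral {0..t} (\<lambda>s. part_semigroup A s (R \<mu> v)) = part_semigroup A t w - w"
    using T.G_integral[OF R_G[OF \<mu> u] assms(1)] v by (simp add: w_def integral_unique)
  then show ?thesis
    unfolding integrated_semigroup_eq
    using assms u w YD(5) by (simp add: v T.T_diff T.T_scaleR scaleR_diff_right)
qed

text \<open>If \<open>h' = A h + g\<close> on \<open>[0, \<tau>)\<close>, then \<open>s \<mapsto> S_A(s) g(t - s)\<close> has the antiderivative
  \<open>s \<mapsto> - \<Sigma>(s) h(t - s) - H(t - s)\<close>, where \<open>\<Sigma>(s) = \<integral>\<^sub>0\<^sup>s T(r) dr\<close> and \<open>H(s) = \<integral>\<^sub>0\<^sup>s h(r) dr\<close>.\<close>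

lemma convolution_solution:
  assumes h: "continuous_on {0..\<tau>} h"
    and hA: "\<And>s. 0 \<le> s \<Longrightarrow> s < \<tau> \<Longrightarrow> (h s, a s) \<in> A"
    and dh: "\<And>s. 0 \<le> s \<Longrightarrow> s < \<tau> \<Longrightarrow> (h has_vector_derivative h' s) (at s within {0..<\<tau>})"
    and g: "\<And>s. 0 \<le> s \<Longrightarrow> s < \<tau> \<Longrightarrow> g s = h' s - a s"
    and t: "0 \<le> t" "t < \<tau>"
  shows "convolution (integrated_semigroup A \<mu>) g t = integral {0..t} h - integral {0..t} (\<lambda>s. part_semigroup A s (h 0))"
proof -
  let ?T = "part_semigroup A"
  define \<Sigma> where "\<Sigma> s y = integral {0..s} (\<lambda>r. ?T r y)" for s y
  define H where "H s = integral {0..s} h" for s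
  have hY: "h s \<in> Y" if "0 \<le> s" "s < \<tau>" for s using Domain_in[OF hA[OF that]] .
  \<comment> \<open>The derivative is a limit of forward quotients of elements of \<open>Y\<close>.
    The midpoint between s and \<tau> keeps these inside the half-open interval.\<close>
  have h'Y: "h' s \<in> Y" if s: "0 \<le> s" "s < \<tau>" for s
  proof -
    define \<sigma> where "\<sigma> = (s + \<tau>) / 2"
    have \<sigma>: "s < \<sigma>" "\<sigma> < \<tau>" using s by (auto simp: \<sigma>_def)
    have "(h has_vector_derivative h' s) (at s within {s..\<sigma>})"
      using s \<sigma> by (intro has_vector_derivative_within_subset[OF dh[OF s]]) auto
    then have "((\<lambda>y. (h y - h s) /\<^sub>R (y - s)) \<longlongrightarrow> h' s) (at_right s)"
      using \<sigma> by (simp add: has_vector_derivative_iff_quotient at_within_Icc_at_right)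
    moreover have "\<forall>\<^sub>F y in at_right s. (h y - h s) /\<^sub>R (y - s) \<in> Y"
      unfolding eventually_at_right_field using s by (intro exI[of _ \<tau>]) (auto intro!: YD(5,7) hY)
    ultimately show ?thesis by (intro Lim_in_closed_set[OF YD(1) _ trivial_limit_at_right_real])
  qed
  obtain K where K: "\<And>s x. s \<in> {0..t} \<Longrightarrow> x \<in> Y \<Longrightarrow> norm (?T s x) \<le> K * norm x" and K1: "K \<ge> 1"
    using T.local_bound[of t] by blast
  have \<Sigma>d: "((\<lambda>s. \<Sigma> s y) has_vector_derivative ?T s y) (at s within {0..t})" if "y \<in> Y" "s \<in> {0..t}" for s y
    unfolding \<Sigma>_def using that by (intro integral_has_vector_derivative T.T_cont') auto
  have refl: "((\<lambda>s. t - s) has_vector_derivative - 1) (at s within {0..t})" for s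
    by (auto intro!: derivative_eq_intros)
  have dv: "((\<lambda>s. h (t - s)) has_vector_derivative - h' (t - s)) (at s within {0..t})" if s: "s \<in> {0..t}" for s
  proof -
    have "(h has_vector_derivative h' (t - s)) (at (t - s) within (\<lambda>s. t - s) ` {0..t})"
      using s t by (intro has_vector_derivative_within_subset[OF dh]) auto
    from vector_diff_chain_within[OF refl this] show ?thesis by (simp add: o_def)
  qed
  have dH: "((\<lambda>s. H (t - s)) has_vector_derivative - h (t - s)) (at s within {0..t})" if s: "s \<in> {0..t}" for s
  proof -
    have "(H has_vector_derivative h (t - s)) (at (t - s) within {0..\<tau>})"
      unfolding H_def using s t by (intro integral_has_vector_derivative h) auto
    then have "(H has_vector_derivative h (t - s)) (at (t - s) within (\<lambda>s. t - s) ` {0..t})"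
      by (rule has_vector_derivative_within_subset) (use s t in auto)
    from vector_diff_chain_within[OF refl this] show ?thesis by (simp add: o_def)
  qed
  have d: "((\<lambda>s. - \<Sigma> s (h (t - s)) - H (t - s)) has_vector_derivative integrated_semigroup A \<mu> s (g (t - s))) (at s within {0..t})"
    if s: "s \<in> {0..t}" for s
  proof -
    have ts: "0 \<le> t - s" "t - s < \<tau>" "0 \<le> s" using s t by auto
    have "((\<lambda>s. \<Sigma> s (h (t - s))) has_vector_derivative (?T s (h (t - s)) + \<Sigma> s (- h' (t - s)))) (at s within {0..t})"
    proof (rule product_rule_on[OF Y, where K = "K * t" and v' = "- h' (t - s)" and F = \<Sigma> and v = "\<lambda>s. h (t - s)"])
      show "norm (\<Sigma> \<sigma> x) \<le> K * t * norm x" if "\<sigma> \<in> {0..t}" "x \<in> Y" for \<sigma> x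
      proof -
        have "norm (\<Sigma> \<sigma> x) \<le> K * \<sigma> * norm x"
          unfolding \<Sigma>_def using that K by (intro T.T_integral_bound) auto
        also have "\<dots> \<le> K * t * norm x" using that K1 by (intro mult_right_mono mult_left_mono) auto
        finally show ?thesis .
      qed
      show "((\<lambda>\<sigma>. \<Sigma> \<sigma> (- h' (t - s))) \<longlongrightarrow> \<Sigma> s (- h' (t - s))) (at s within {0..t})"
        using has_vector_derivative_continuous[OF \<Sigma>d[OF YD(6)[OF h'Y[OF ts(1,2)]] s]] by (simp add: continuous_within)
    qed (use s t ts hY h'Y dv \<Sigma>d YD(6) in \<open>auto simp: \<Sigma>_def T_integral_diff T_integral_scaleR\<close>)
    from has_vector_derivative_diff[OF has_vector_derivative_minus[OF this] dH[OF s]]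
    show ?thesis
    proof (rule has_vector_derivative_eq_rhs)
      have "\<Sigma> s (- h' (t - s)) = - \<Sigma> s (h' (t - s))"
        unfolding \<Sigma>_def using T_integral_scaleR[OF h'Y[OF ts(1,2)], of s "- 1"] by simp
      \<comment> \<open>The two parts of g are treated differently: h' lies in \<open>Y\<close>,
        where the integrated semigroup is \<Sigma>, while the values of A are handled by
        \<open>integrated_semigroup_A\<close>.\<close>
      moreover have "integrated_semigroup A \<mu> s (g (t - s)) = \<Sigma> s (h' (t - s)) - (?T s (h (t - s)) - h (t - s))"
        unfolding g[OF ts(1,2)] integrated_semigroup_diff[OF ts(3)] \<Sigma>_def
        using integrated_semigroup_on_Y[OF ts(3) h'Y[OF ts(1,2)]] integrated_semigroup_A[OF ts(3) hA[OF ts(1,2)]] by simp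
      ultimately show "- (?T s (h (t - s)) + \<Sigma> s (- h' (t - s))) - - h (t - s) = integrated_semigroup A \<mu> s (g (t - s))"
        by simp
    qed
  qed
  have "((\<lambda>s. integrated_semigroup A \<mu> s (g (t - s))) has_integral
      ((- \<Sigma> t (h (t - t)) - H (t - t)) - (- \<Sigma> 0 (h (t - 0)) - H (t - 0)))) {0..t}"
    by (rule fundamental_theorem_of_calculus[OF t(1) d])
  then show ?thesis unfolding convolution_def by (simp add: integral_unique \<Sigma>_def H_def)
qed

text \<open>Below \<tau> this is the derivative of \<open>convolution_solution\<close>. At \<tau>,
  where g may be singular, the value is reached from the left by continuity of both sides.\<close>

lemma diamond_solution:
  assumes \<tau>: "0 < \<tau>" and h: "continuous_on {0..\<tau>} h"
    and hA: "\<And>s. 0 \<le> s \<Longrightarrow> s < \<tau> \<Longrightarrow> (h s, a s) \<in> A"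
    and dh: "\<And>s. 0 \<le> s \<Longrightarrow> s < \<tau> \<Longrightarrow> (h has_vector_derivative h' s) (at s within {0..<\<tau>})"
    and g: "\<And>s. 0 \<le> s \<Longrightarrow> s < \<tau> \<Longrightarrow> g s = h' s - a s"
    and cont: "continuous_on {0..} (diamond (integrated_semigroup A \<mu>) g)"
  shows "diamond (integrated_semigroup A \<mu>) g \<tau> = h \<tau> - part_semigroup A \<tau> (h 0)"
proof -
  let ?T = "part_semigroup A" and ?d = "diamond (integrated_semigroup A \<mu>) g"
  have h0: "h 0 \<in> Y" using Domain_in[OF hA[of 0]] \<tau> by simp
  have eq: "?d t = h t - ?T t (h 0)" if t: "0 < t" "t < \<tau>" for t
  proof -
    have "((\<lambda>t. integral {0..t} h - integral {0..t} (\<lambda>s. ?T s (h 0))) has_vector_derivative (h t - ?T t (h 0))) (at t within {0..\<tau>})"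
      using t h0 by (intro has_vector_derivative_diff integral_has_vector_derivative h T.T_cont') auto
    then have "((\<lambda>t. integral {0..t} h - integral {0..t} (\<lambda>s. ?T s (h 0))) has_vector_derivative (h t - ?T t (h 0))) (at t)"
      using t by (simp add: at_within_Icc_at)
    then have "(convolution (integrated_semigroup A \<mu>) g has_vector_derivative (h t - ?T t (h 0))) (at t)"
      by (rule has_vector_derivative_transform_within_open[of _ _ _ "{0<..<\<tau>}"])
         (use t convolution_solution[OF h hA dh g] in auto)
    moreover have "at t within {0..} = at t" using t by (intro at_within_interior) (simp add: interior_real_atLeast)
    ultimately show ?thesis unfolding diamond_def by (simp add: vector_derivative_at)
  qed
  have b: "at \<tau> within {0<..<\<tau>} \<noteq> bot" using \<tau> by (simp add: trivial_limit_within islimpt_greaterThanLessThan2)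
  have "(?d \<longlongrightarrow> ?d \<tau>) (at \<tau> within {0<..<\<tau>})"
    using \<tau> by (intro continuous_on_tendsto_within[OF cont]) auto
  moreover have "((\<lambda>t. h t - ?T t (h 0)) \<longlongrightarrow> h \<tau> - ?T \<tau> (h 0)) (at \<tau> within {0<..<\<tau>})"
  proof (intro tendsto_diff)
    show "(h \<longlongrightarrow> h \<tau>) (at \<tau> within {0<..<\<tau>})"
      using \<tau> by (intro continuous_on_tendsto_within[OF h]) auto
    show "((\<lambda>t. ?T t (h 0)) \<longlongrightarrow> ?T \<tau> (h 0)) (at \<tau> within {0<..<\<tau>})"
      using \<tau> by (intro continuous_on_tendsto_within[OF T.T_cont[OF h0]]) auto
  qed
  then have "(?d \<longlongrightarrow> h \<tau> - ?T \<tau> (h 0)) (at \<tau> within {0<..<\<tau>})"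
    by (rule Lim_transform_eventually) (auto simp: eventually_at_filter eq)
  ultimately show ?thesis using tendsto_unique[OF b] by blast
qed

end

end

section \<open>The a priori estimate\<close>

locale commuting_pair =
  A: hille_yosida_operator A \<omega> M + B: analytic_operator B TB \<delta> U r\<^sub>0 C\<^sub>0 \<alpha>
  for A B :: "'x::complex_banach operator" and \<omega> M TB \<delta> U r\<^sub>0 C\<^sub>0 \<alpha> +
  assumes \<omega>r0: "\<omega> < r\<^sub>0"
    and comm: "\<And>\<mu> \<nu> x. r\<^sub>0 \<le> \<mu> \<Longrightarrow> r\<^sub>0 \<le> \<nu> \<Longrightarrow> A.R \<mu> (B.R \<nu> x) = B.R \<nu> (A.R \<mu> x)"
begin

abbreviation "TA \<equiv> part_semigroup A"

lemma RA_bl: "bounded_linear (A.R r\<^sub>0)" by (rule A.R_bl[OF \<omega>r0])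

text \<open>(r_0 - A)^-1 commutes with the resolvent of B, hence with its whole calculus and in
  particular with E(t); so E(t) preserves D(A) and commutes with A there.\<close>

lemma E_A: assumes t: "0 < t" and ua: "(u, a) \<in> A" shows "(B.E t u, B.E t a) \<in> A"
proof -
  have QR: "A.R r\<^sub>0 (B.R r\<^sub>0 x) = B.R r\<^sub>0 (A.R r\<^sub>0 x)" for x by (rule comm) simp_all
  have "u = A.R r\<^sub>0 (r\<^sub>0 *\<^sub>R u - a)" using A.R_eq[OF \<omega>r0 ua] by simp
  then have "B.E t u = A.R r\<^sub>0 (r\<^sub>0 *\<^sub>R B.E t u - B.E t a)"
    using B.commuting_E[OF RA_bl QR t, of "r\<^sub>0 *\<^sub>R u - a"] by (simp add: B.E_diff[OF t] B.E_scaleR[OF t])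
  then show ?thesis using A.R_mem[OF \<omega>r0, of "r\<^sub>0 *\<^sub>R B.E t u - B.E t a"] by simp
qed

text \<open>With \<open>f = (r - A - B) u\<close> the function \<open>h(s) = e\<^bsup>-r(\<tau>-s)\<^esup> T\<^sub>B(\<tau> - s) u\<close> solves
  \<open>h' = A h + g\<close> with \<open>g(s) = e\<^bsup>-r(\<tau>-s)\<^esup> T\<^sub>B(\<tau> - s) f\<close>, so \<open>u = h(\<tau>) = T\<^sub>A(\<tau>) h(0) + (S\<^sub>A \<diamondop> g)(\<tau>)\<close>.
  For large \<open>r\<close> the first summand is at most \<open>\<parallel>u\<parallel> / 2\<close>.\<close>

lemma apriori:
  assumes \<mu>: "\<mu> > \<omega>" and p: "1 \<le> p" and \<gamma>: "0 < \<gamma>" "\<gamma> + (1 - \<alpha>) < 1 / p" and \<alpha>: "\<alpha> \<le> 1"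
    and cont: "\<And>f. Lp_loc p f \<Longrightarrow> continuous_on {0..} (diamond (integrated_semigroup A \<mu>) f)"
    and est: "\<And>f t. Lp_loc p f \<Longrightarrow> 0 \<le> t \<Longrightarrow> norm (diamond (integrated_semigroup A \<mu>) f t) \<le>
             M * (integral {0..t} (\<lambda>s. exp (p * \<omega> * (t - s)) * norm (f s) powr p)) powr (1 / p)"
  shows "\<exists>K\<ge>0. \<exists>r\<^sub>1\<ge>r\<^sub>0. \<forall>r\<ge>r\<^sub>1. \<forall>u a b. (u, a) \<in> A \<longrightarrow> (u, b) \<in> B \<longrightarrow>
           norm u \<le> K * r powr (- \<gamma>) * norm (r *\<^sub>R u - a - b)"
proof -
  obtain \<eta> C where \<eta>: "0 < \<eta>" "0 \<le> C" "\<And>t x. 0 < t \<Longrightarrow> t < \<eta> \<Longrightarrow> norm (B.E t x) \<le> C * t powr (\<alpha> - 1) * norm x"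
    using B.E_estimate by blast
  \<comment> \<open>The estimate for E holds only below \<eta>, and the argument \<tau> - s runs up
    to \<tau> itself.\<close>
  define \<tau> where "\<tau> = \<eta> / 2"
  have \<tau>: "0 < \<tau>" "\<tau> < \<eta>" using \<eta> by (auto simp: \<tau>_def)
  obtain KA where KA: "KA \<ge> 1" "\<And>x. x \<in> A.Y \<Longrightarrow> norm (TA \<tau> x) \<le> KA * norm x"
    using A.T.local_bound[of \<tau>] \<tau> by (metis atLeastAtMost_iff less_imp_le order_refl)
  obtain KB where KB: "KB \<ge> 1" "\<And>x. x \<in> B.Y \<Longrightarrow> norm (TB \<tau> x) \<le> KB * norm x"
    using B.local_bound[of \<tau>] \<tau> by (metis atLeastAtMost_iff less_imp_le order_refl)
  define b where "b = 1 - \<alpha>"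
  \<comment> \<open>The total singular exponent at \<tau>: b p comes from E, and p \<gamma> is the
    price of the factor r^(-\<gamma>). The hypothesis on \<gamma> says exactly c < 1.\<close>
  define c where "c = p * \<gamma> + b * p"
  have "p * (\<gamma> + b) < p * (1 / p)" using \<gamma> p by (intro mult_strict_left_mono) (auto simp: b_def)
  then have c: "c < 1" using p by (simp add: c_def distrib_left mult.commute)
  have b0: "0 \<le> b * p" using p \<alpha> by (simp add: b_def)
  have p\<gamma>: "0 < p * \<gamma>" "p * \<gamma> < 1" "b * p < 1" using \<gamma> p c b0 by (auto simp: c_def) (smt (verit) mult_pos_pos)+
  define I0 where "I0 = \<tau> powr (1 - c) / (1 - c)"
  have I0: "0 \<le> I0" using c by (simp add: I0_def)
  \<comment> \<open>The factor 2 pays for absorbing half of the norm of u on the left, and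
    2^\<gamma> for replacing \<open>X\<close> by r / 2.\<close>
  define K where "K = 2 * M * C * 2 powr \<gamma> * I0 powr (1 / p)"
  \<comment> \<open>The bound 2 |\<omega>| gives r - \<omega> \<ge> r / 2; the logarithm makes KA KB
    e^(-r \<tau>) at most 1/2.\<close>
  define r\<^sub>1 where "r\<^sub>1 = max r\<^sub>0 (max (2 * \<bar>\<omega>\<bar>) (ln (2 * KA * KB) / \<tau>))"
  have K: "K \<ge> 0" using A.M \<eta> by (simp add: K_def)
  have "norm u \<le> K * r powr (- \<gamma>) * norm (r *\<^sub>R u - a - v)"
    if r: "r \<ge> r\<^sub>1" and ua: "(u, a) \<in> A" and uv: "(u, v) \<in> B" for r u a v
  proof -
    have l: "r \<ge> r\<^sub>0" "r > 0" "r \<ge> 2 * \<bar>\<omega>\<bar>" "ln (2 * KA * KB) / \<tau> \<le> r"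
      using r B.r0 by (auto simp: r\<^sub>1_def)
    have r\<omega>: "r / 2 \<le> r - \<omega>" using l(3) by (simp add: abs_if split: if_splits)
    have uY: "u \<in> B.Y" by (rule subsetD[OF closure_subset DomainI[OF uv]])
    define f where "f = r *\<^sub>R u - a - v"
    define e where "e s = exp (- (r * (\<tau> - s)))" for s
    define h where "h s = e s *\<^sub>R TB (\<tau> - s) u" for s
    define g where "g s = (if s < \<tau> then e s *\<^sub>R B.E (\<tau> - s) f else 0)" for s
    have e_deriv: "(e has_real_derivative (r * e s)) (at s within S)" for s S
      unfolding e_def by (auto intro!: derivative_eq_intros)
    have e_cont: "continuous_on S e" for S unfolding e_def by (intro continuous_intros)
    have hc: "continuous_on {0..\<tau>} h"
      unfolding h_def
      by (intro continuous_intros e_cont continuous_on_compose2[OF B.T_cont[OF uY], of _ "\<lambda>s. \<tau> - s"]) auto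
    have hA: "(h s, e s *\<^sub>R B.E (\<tau> - s) a) \<in> A" if "0 \<le> s" "s < \<tau>" for s
      using linear_operatorD(5)[OF A.A E_A[OF _ ua, of "\<tau> - s"], of "e s"] that
      by (simp add: h_def B.E_Y[OF _ uY])
    have dh: "(h has_vector_derivative (r *\<^sub>R h s - e s *\<^sub>R B.D (of_real (\<tau> - s)) u)) (at s within {0..<\<tau>})"
      if s: "0 \<le> s" "s < \<tau>" for s
    proof -
      have rf: "((\<lambda>s. \<tau> - s) has_vector_derivative - 1) (at s within {0..<\<tau>})"
        by (auto intro!: derivative_eq_intros)
      have "((\<lambda>t. TB t u) has_vector_derivative B.D (of_real (\<tau> - s)) u) (at (\<tau> - s) within (\<lambda>s. \<tau> - s) ` {0..<\<tau>})"
        by (rule has_vector_derivative_at_within[OF B.T_deriv[OF _ uY]]) (use s in simp)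
      from vector_diff_chain_within[OF rf this]
      have "((\<lambda>s. TB (\<tau> - s) u) has_vector_derivative - B.D (of_real (\<tau> - s)) u) (at s within {0..<\<tau>})"
        by (simp add: o_def)
      from has_vector_derivative_scaleR[OF e_deriv this]
      show ?thesis unfolding h_def by (rule has_vector_derivative_eq_rhs) simp
    qed
    have g: "g s = (r *\<^sub>R h s - e s *\<^sub>R B.D (of_real (\<tau> - s)) u) - e s *\<^sub>R B.E (\<tau> - s) a" if s: "0 \<le> s" "s < \<tau>" for s
    proof -
      have ts: "0 < \<tau> - s" using s by simp
      have "B.E (\<tau> - s) f = r *\<^sub>R TB (\<tau> - s) u - B.E (\<tau> - s) a - B.D (of_real (\<tau> - s)) u"
        by (simp add: f_def B.E_diff[OF ts] B.E_scaleR[OF ts] B.E_Y[OF ts uY] B.E_B[OF ts uv])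
      then show ?thesis using s by (simp add: g_def h_def scaleR_diff_right)
    qed
    have gb: "norm (g s) \<le> e s * (C * norm f * (\<tau> - s) powr (- b))" if s: "0 \<le> s" "s < \<tau>" for s
    proof -
      have "norm (B.E (\<tau> - s) f) \<le> C * (\<tau> - s) powr (\<alpha> - 1) * norm f"
        using s \<tau> by (intro \<eta>(3)) auto
      then have "e s * norm (B.E (\<tau> - s) f) \<le> e s * (C * (\<tau> - s) powr (\<alpha> - 1) * norm f)"
        by (intro mult_left_mono) (auto simp: e_def)
      then show ?thesis using s by (simp add: g_def b_def e_def mult_ac)
    qed
    have Lp: "Lp_loc p g"
    proof (rule Lp_loc_piecewise[where \<tau> = \<tau> and C = "C * norm f" and b = b])
      have "continuous_on {0..<\<tau>} (\<lambda>s. e s *\<^sub>R B.E (\<tau> - s) f)"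
        by (intro continuous_intros e_cont continuous_on_compose2[OF B.E_continuous, of _ "\<lambda>s. \<tau> - s"]) auto
      then show "continuous_on {0..<\<tau>} g" by (rule continuous_on_eq) (simp add: g_def)
      fix s assume s: "0 \<le> s" "s < \<tau>"
      have "e s \<le> 1" using s l by (simp add: e_def)
      then have "e s * (C * norm f * (\<tau> - s) powr (- b)) \<le> 1 * (C * norm f * (\<tau> - s) powr (- b))"
        using \<eta>(2) by (intro mult_right_mono) auto
      then show "norm (g s) \<le> C * norm f * (\<tau> - s) powr (- b)" using gb[OF s] by simp
    qed (use \<tau> p p\<gamma> \<eta> in \<open>auto simp: g_def\<close>)
    \<comment> \<open>The decay rate of the p-th power of the integrand: p r from the weight e(s),
      diminished by p \<omega> from the convolution estimate.\<close>
    define X where "X = p * (r - \<omega>)"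
    have "r / 2 * 1 \<le> (r - \<omega>) * p" using r\<omega> p l by (intro mult_mono) auto
    then have X: "r / 2 \<le> X" "0 < X" using l by (auto simp: X_def mult.commute)
    define W where "W = (C * norm f) powr p * X powr (- (p * \<gamma>))"
    have maj: "((\<lambda>s. W * (\<tau> - s) powr (- c)) has_integral (W * I0)) {0..\<tau>}"
      unfolding I0_def by (intro has_integral_mult_right has_integral_reflected_powr) (use \<tau> c in auto)
    \<comment> \<open>The weights combine to e^(-y) with y = X (\<tau> - s). Bounding it by y^(-p
      \<gamma>) separates the r-dependent factor, collected in \<open>W\<close>, from the
      singularity (\<tau> - s)^(-c).\<close>
    have le: "exp (p * \<omega> * (\<tau> - s)) * norm (g s) powr p \<le> W * (\<tau> - s) powr (- c)" if s: "s \<in> {0..\<tau>}" for s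
    proof (cases "s < \<tau>")
      case True
      define y where "y = X * (\<tau> - s)"
      have y: "0 < y" using True X by (simp add: y_def)
      have "norm (g s) powr p \<le> (e s * (C * norm f * (\<tau> - s) powr (- b))) powr p"
        using gb[of s] s True p by (intro powr_mono2) auto
      also have "\<dots> = e s powr p * ((C * norm f) powr p * (\<tau> - s) powr (- (b * p)))"
        using \<eta>(2) s True by (simp add: powr_mult powr_powr e_def)
      finally have "exp (p * \<omega> * (\<tau> - s)) * norm (g s) powr p
          \<le> (exp (p * \<omega> * (\<tau> - s)) * e s powr p) * ((C * norm f) powr p * (\<tau> - s) powr (- (b * p)))"
        by (simp add: mult.assoc)
      also have "exp (p * \<omega> * (\<tau> - s)) * e s powr p = exp (- y)"
        by (simp add: e_def powr_def exp_add[symmetric] y_def X_def algebra_simps)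
      also have "exp (- y) * ((C * norm f) powr p * (\<tau> - s) powr (- (b * p)))
          \<le> y powr (- (p * \<gamma>)) * ((C * norm f) powr p * (\<tau> - s) powr (- (b * p)))"
        using p\<gamma> by (intro mult_right_mono exp_minus_le_powr y) auto
      also have "y powr (- (p * \<gamma>)) = X powr (- (p * \<gamma>)) * (\<tau> - s) powr (- (p * \<gamma>))"
        using X True by (simp add: y_def powr_mult)
      also have "X powr (- (p * \<gamma>)) * (\<tau> - s) powr (- (p * \<gamma>)) * ((C * norm f) powr p * (\<tau> - s) powr (- (b * p)))
          = W * ((\<tau> - s) powr (- (p * \<gamma>)) * (\<tau> - s) powr (- (b * p)))" by (simp add: W_def mult_ac)
      also have "(\<tau> - s) powr (- (p * \<gamma>)) * (\<tau> - s) powr (- (b * p)) = (\<tau> - s) powr (- c)"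
        by (simp add: powr_add[symmetric] c_def)
      finally show ?thesis .
    qed (use s p in \<open>auto simp: g_def W_def\<close>)
    let ?J = "integral {0..\<tau>} (\<lambda>s. exp (p * \<omega> * (\<tau> - s)) * norm (g s) powr p)"
    have J: "0 \<le> ?J" "?J \<le> W * I0"
      by (rule integral_mono_of_integrable_majorant[OF maj _ le]; simp)+
    have "?J powr (1 / p) \<le> (W * I0) powr (1 / p)" using J p by (intro powr_mono2) auto
    also have "\<dots> = C * norm f * X powr (- \<gamma>) * I0 powr (1 / p)"
      using \<eta>(2) p I0 by (simp add: W_def powr_mult powr_powr)
    also have "\<dots> \<le> C * norm f * (2 powr \<gamma> * r powr (- \<gamma>)) * I0 powr (1 / p)"
    proof -
      have "X powr (- \<gamma>) \<le> (r / 2) powr (- \<gamma>)" using X l \<gamma> by (intro powr_mono2') auto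
      also have "\<dots> = 2 powr \<gamma> * r powr (- \<gamma>)" using l by (simp add: powr_divide powr_minus field_simps)
      finally show ?thesis using \<eta>(2) by (intro mult_right_mono mult_left_mono) auto
    qed
    finally have "M * ?J powr (1 / p) \<le> M * (C * norm f * (2 powr \<gamma> * r powr (- \<gamma>)) * I0 powr (1 / p))"
      using A.M by (intro mult_left_mono) auto
    then have d: "norm (diamond (integrated_semigroup A \<mu>) g \<tau>) \<le> K / 2 * r powr (- \<gamma>) * norm f"
      using est[OF Lp less_imp_le[OF \<tau>(1)]] by (simp add: K_def mult_ac)
    have "diamond (integrated_semigroup A \<mu>) g \<tau> = h \<tau> - TA \<tau> (h 0)"
      by (rule A.diamond_solution[OF \<mu> \<tau>(1) hc hA dh g cont[OF Lp]])
    moreover have "h \<tau> = u" using B.T_0[OF uY] by (simp add: h_def e_def)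
    ultimately have "norm u \<le> norm (diamond (integrated_semigroup A \<mu>) g \<tau>) + norm (TA \<tau> (h 0))"
      by (metis diff_add_cancel norm_triangle_ineq)
    \<comment> \<open>h(0) carries the factor e^(-r \<tau>), which beats both semigroup bounds at
      time \<tau> by the choice of \<open>r\<^sub>1\<close>.\<close>
    moreover have "norm (TA \<tau> (h 0)) \<le> norm u / 2"
    proof -
      have "h 0 \<in> A.Y" using A.Domain_in[OF hA[of 0]] \<tau> by simp
      then have "norm (TA \<tau> (h 0)) \<le> KA * norm (h 0)" by (rule KA(2))
      also have "\<dots> \<le> KA * (exp (- (r * \<tau>)) * (KB * norm u))"
        using KA(1) KB(2)[OF uY] by (intro mult_left_mono) (auto simp: h_def e_def)
      also have "\<dots> = (KA * KB) * exp (- (r * \<tau>)) * norm u" by simp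
      also have "\<dots> \<le> 1 / 2 * norm u"
      proof (intro mult_right_mono)
        have KK: "0 < 2 * KA * KB" using KA(1) KB(1) by simp
        have "ln (2 * KA * KB) \<le> r * \<tau>" using l(4) \<tau> by (simp add: pos_divide_le_eq)
        then have "2 * KA * KB \<le> exp (r * \<tau>)" using KK by (metis exp_le_cancel_iff exp_ln)
        then show "(KA * KB) * exp (- (r * \<tau>)) \<le> 1 / 2" by (simp add: exp_minus field_simps)
      qed simp
      finally show ?thesis by simp
    qed
    ultimately have "norm u \<le> K * r powr (- \<gamma>) * norm f" using d by simp
    then show ?thesis by (simp add: f_def)
  qed
  moreover have "r\<^sub>1 \<ge> r\<^sub>0" by (simp add: r\<^sub>1_def)
  ultimately show ?thesis using K by blast
qed

end

section \<open>The closure of the sum\<close>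

lemma closure_pair_sequence:
  "(x, y) \<in> closure S \<longleftrightarrow> (\<exists>u v. (\<forall>n::nat. (u n, v n) \<in> S) \<and> u \<longlonglongrightarrow> x \<and> v \<longlonglongrightarrow> y)"
  for S :: "('a::metric_space \<times> 'b::metric_space) set"
proof
  assume "(x, y) \<in> closure S"
  then obtain f where f: "\<And>n. f n \<in> S" "f \<longlonglongrightarrow> (x, y)" unfolding closure_sequential by blast
  show "\<exists>u v. (\<forall>n. (u n, v n) \<in> S) \<and> u \<longlonglongrightarrow> x \<and> v \<longlonglongrightarrow> y"
    using f(1) tendsto_fst[OF f(2)] tendsto_snd[OF f(2)]
    by (intro exI[of _ "\<lambda>n. fst (f n)"] exI[of _ "\<lambda>n. snd (f n)"]) simp
next
  assume "\<exists>u v. (\<forall>n. (u n, v n) \<in> S) \<and> u \<longlonglongrightarrow> x \<and> v \<longlonglongrightarrow> y"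
  then obtain u v where "\<And>n. (u n, v n) \<in> S" "u \<longlonglongrightarrow> x" "v \<longlonglongrightarrow> y" by blast
  then show "(x, y) \<in> closure S"
    unfolding closure_sequential by (intro exI[of _ "\<lambda>n. (u n, v n)"]) (auto intro: tendsto_Pair)
qed

lemma linear_operator_op_sum:
  assumes "linear_operator A" "linear_operator B" shows "linear_operator (op_sum A B)"
  unfolding linear_operator_def
proof (intro conjI allI impI)
  note AD = linear_operatorD[OF assms(1)] and BD = linear_operatorD[OF assms(2)]
  show "single_valued (op_sum A B)"
    using AD(1) BD(1) unfolding op_sum_def by (intro single_valuedI) blast
  show "(0, 0) \<in> op_sum A B" using AD(2) BD(2) unfolding op_sum_def by force
next
  note AD = linear_operatorD[OF assms(1)] and BD = linear_operatorD[OF assms(2)]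
  fix x y x' y' assume "(x, y) \<in> op_sum A B" "(x', y') \<in> op_sum A B"
  then obtain a b a' b' where *: "(x, a) \<in> A" "(x, b) \<in> B" "(x', a') \<in> A" "(x', b') \<in> B" "y = a + b" "y' = a' + b'"
    by (auto simp: op_sum_def)
  have "y + y' = (a + a') + (b + b')" by (simp add: *(5,6))
  then show "(x + x', y + y') \<in> op_sum A B"
    using AD(3)[OF *(1,3)] BD(3)[OF *(2,4)] unfolding op_sum_def by blast
next
  note AD = linear_operatorD[OF assms(1)] and BD = linear_operatorD[OF assms(2)]
  fix c x y assume "(x, y) \<in> op_sum A B"
  then obtain a b where *: "(x, a) \<in> A" "(x, b) \<in> B" "y = a + b" by (auto simp: op_sum_def)
  then show "(c *\<^sub>C x, c *\<^sub>C y) \<in> op_sum A B"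
    using AD(4)[OF *(1), of c] BD(4)[OF *(2), of c] scaleC_add_right[of c a b] unfolding op_sum_def by blast
qed

text \<open>By linearity, single-valuedness of the graph closure only has to be checked over
  0.\<close>

lemma closed_operator_closure:
  assumes S: "linear_operator S" and sv: "\<And>y. (0, y) \<in> closure S \<Longrightarrow> y = 0"
  shows "closed_operator (closure S)" "closable S" "op_closure S = closure S"
proof -
  note SD = linear_operatorD[OF S]
  have add: "(x + x', y + y') \<in> closure S" if xy: "(x, y) \<in> closure S" "(x', y') \<in> closure S" for x y x' y'
  proof -
    from xy obtain u v u' v' where "\<And>n::nat. (u n, v n) \<in> S" "u \<longlonglongrightarrow> x" "v \<longlonglongrightarrow> y"
      "\<And>n::nat. (u' n, v' n) \<in> S" "u' \<longlonglongrightarrow> x'" "v' \<longlonglongrightarrow> y'" unfolding closure_pair_sequence by blast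
    then show ?thesis unfolding closure_pair_sequence
      by (intro exI[of _ "\<lambda>n. u n + u' n"] exI[of _ "\<lambda>n. v n + v' n"]) (auto intro: SD(3) tendsto_add)
  qed
  have sc: "(a *\<^sub>C x, a *\<^sub>C y) \<in> closure S" if xy: "(x, y) \<in> closure S" for a x y
  proof -
    from xy obtain u v where "\<And>n::nat. (u n, v n) \<in> S" "u \<longlonglongrightarrow> x" "v \<longlonglongrightarrow> y"
      unfolding closure_pair_sequence by blast
    then show ?thesis unfolding closure_pair_sequence
      by (intro exI[of _ "\<lambda>n. a *\<^sub>C u n"] exI[of _ "\<lambda>n. a *\<^sub>C v n"]) (auto intro: SD(4) scaleC.tendsto[OF tendsto_const])
  qed
  have "single_valued (closure S)"
  proof (rule single_valuedI)
    fix x y z assume "(x, y) \<in> closure S" "(x, z) \<in> closure S"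
    then have "(x + (- 1) *\<^sub>C x, y + (- 1) *\<^sub>C z) \<in> closure S" using add sc by blast
    then have "(0, y - z) \<in> closure S" by (simp add: scaleC.minus_left)
    then show "y = z" using sv[of "y - z"] by simp
  qed
  moreover have "(0, 0) \<in> closure S" by (rule subsetD[OF closure_subset SD(2)])
  ultimately show cl: "closed_operator (closure S)"
    unfolding closed_operator_def linear_operator_def using add sc by simp
  show "closable S" unfolding closable_def using cl closure_subset by (intro exI[of _ "closure S"]) simp
  show "op_closure S = closure S"
  proof
    show "op_closure S \<subseteq> closure S" unfolding op_closure_def using cl closure_subset[of S] by (intro Inter_lower) simp
    show "closure S \<subseteq> op_closure S" unfolding op_closure_def
      by (intro Inter_greatest closure_minimal) (auto simp: closed_operator_def)
  qed
qed

text \<open>As for A, but the convergence of R(r) y to 0 now comes from the decay r^(-\<alpha>) with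
  \<alpha> > 0.\<close>

lemma (in analytic_operator) R_approx_domain:
  assumes "0 < \<alpha>" "x \<in> Domain B" shows "((\<lambda>r. r *\<^sub>R R r x) \<longlongrightarrow> x) at_top"
proof -
  obtain y where xy: "(x, y) \<in> B" using assms by blast
  have "((\<lambda>r. r *\<^sub>R R r x - x) \<longlongrightarrow> 0) at_top"
  proof (rule Lim_null_comparison)
    show "\<forall>\<^sub>F r in at_top. norm (r *\<^sub>R R r x - x) \<le> C\<^sub>0 * r powr (- \<alpha>) * norm y"
      using eventually_ge_at_top[of r\<^sub>0]
    proof eventually_elim
      case (elim r)
      interpret bounded_linear "R r" by (rule R_bl[OF elim])
      have "r *\<^sub>R R r x - x = R r y" using R_eq[OF elim xy] by (simp add: diff scaleR algebra_simps)
      then show ?case using R_norm[OF elim] by simp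
    qed
    have "((\<lambda>r::real. r powr (- \<alpha>)) \<longlongrightarrow> 0) at_top" using assms(1) by (intro tendsto_neg_powr filterlim_ident) simp
    from tendsto_mult[OF tendsto_mult[OF tendsto_const this] tendsto_const]
    show "((\<lambda>r. C\<^sub>0 * r powr (- \<alpha>) * norm y) \<longlongrightarrow> 0) at_top" by simp
  qed
  then show ?thesis by (simp add: LIM_zero_iff)
qed

section \<open>The closure of A + B and products of resolvents\<close>

context commuting_pair
begin

definition X0 where "X0 = closure (Domain A \<inter> Domain B)"
definition C where "C = closure (op_sum A B)"

lemma sum_linear: "linear_operator (op_sum A B)"
  by (rule linear_operator_op_sum[OF A.A B.B])

lemma Domain_sum: "Domain (op_sum A B) = Domain A \<inter> Domain B"
  unfolding op_sum_def by blast

lemma X0: "closed_csubspace X0"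
  using closed_csubspace_Domain[OF sum_linear] by (simp add: Domain_sum X0_def)

lemmas X0D = closed_csubspaceD[OF X0]

lemma X0_subset: "X0 \<subseteq> A.Y" "X0 \<subseteq> B.Y"
  unfolding X0_def A.Y_def by (intro closure_mono; simp)+

lemma X0_I: "(u, a) \<in> A \<Longrightarrow> (u, b) \<in> B \<Longrightarrow> u \<in> X0"
  unfolding X0_def by (rule subsetD[OF closure_subset]) blast

text \<open>On D(A) \<inter> D(B) commutation exhibits each resolvent value as being in the range of
  both resolvents, hence again in D(A) \<inter> D(B); boundedness passes this to the
  closure.\<close>

lemma RA_X0: assumes "\<mu> \<ge> r\<^sub>0" "x \<in> X0" shows "A.R \<mu> x \<in> X0" and RB_X0: "B.R \<mu> x \<in> X0"
proof -
  have \<mu>: "\<mu> > \<omega>" using assms \<omega>r0 by simp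
  obtain f where f: "\<And>n::nat. f n \<in> Domain A \<inter> Domain B" "f \<longlonglongrightarrow> x"
    using assms(2) unfolding X0_def closure_sequential by blast
  have m: "A.R \<mu> (f n) \<in> Domain A \<inter> Domain B" "B.R \<mu> (f n) \<in> Domain A \<inter> Domain B" for n
  proof -
    obtain a b where ab: "(f n, a) \<in> A" "(f n, b) \<in> B" using f(1)[of n] by blast
    have 1: "A.R \<mu> (f n) = B.R \<mu> (A.R \<mu> (\<mu> *\<^sub>R f n - b))"
      using B.R_eq[OF assms(1) ab(2)] comm[OF assms(1) assms(1)] by metis
    have 2: "B.R \<mu> (f n) = A.R \<mu> (B.R \<mu> (\<mu> *\<^sub>R f n - a))"
      using A.R_eq[OF \<mu> ab(1)] comm[OF assms(1) assms(1)] by metis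
    show "A.R \<mu> (f n) \<in> Domain A \<inter> Domain B"
      using DomainI[OF A.R_mem[OF \<mu>, of "f n"]] DomainI[OF B.R_mem[OF assms(1), of "A.R \<mu> (\<mu> *\<^sub>R f n - b)"]] 1 by simp
    show "B.R \<mu> (f n) \<in> Domain A \<inter> Domain B"
      using DomainI[OF B.R_mem[OF assms(1), of "f n"]] DomainI[OF A.R_mem[OF \<mu>, of "B.R \<mu> (\<mu> *\<^sub>R f n - a)"]] 2 by simp
  qed
  have "(\<lambda>n. A.R \<mu> (f n)) \<longlonglongrightarrow> A.R \<mu> x" by (rule bounded_linear.tendsto[OF A.R_bl[OF \<mu>] f(2)])
  then show "A.R \<mu> x \<in> X0" unfolding X0_def closure_sequential
    by (intro exI[of _ "\<lambda>n. A.R \<mu> (f n)"] conjI allI m)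
  have "(\<lambda>n. B.R \<mu> (f n)) \<longlonglongrightarrow> B.R \<mu> x" by (rule bounded_linear.tendsto[OF B.R_bl[OF assms(1)] f(2)])
  then show "B.R \<mu> x \<in> X0" unfolding X0_def closure_sequential
    by (intro exI[of _ "\<lambda>n. B.R \<mu> (f n)"] conjI allI m)
qed

text \<open>An injective regularisation mapping the whole space into D(A) \<inter> D(B); it turns
  elements of the closure of A + B into elements of A + B itself.\<close>

definition J where "J \<mu> \<nu> x = A.R \<mu> (B.R \<nu> x)"

context
  fixes \<mu> \<nu> assumes \<mu>\<nu>: "\<mu> \<ge> r\<^sub>0" "\<nu> \<ge> r\<^sub>0"
begin

lemma \<mu>': "\<mu> > \<omega>" using \<mu>\<nu> \<omega>r0 by simp

lemma J_bl: "bounded_linear (J \<mu> \<nu>)"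
  unfolding J_def[abs_def] by (rule bounded_linear_compose[OF A.R_bl[OF \<mu>'] B.R_bl[OF \<mu>\<nu>(2)]])

interpretation J: bounded_linear "J \<mu> \<nu>" by (rule J_bl)
interpretation RA: bounded_linear "A.R \<mu>" by (rule A.R_bl[OF \<mu>'])
interpretation RB: bounded_linear "B.R \<nu>" by (rule B.R_bl[OF \<mu>\<nu>(2)])

lemma J_inj: "J \<mu> \<nu> x = 0 \<Longrightarrow> x = 0"
proof -
  assume "J \<mu> \<nu> x = 0"
  then have "A.R \<mu> (B.R \<nu> x) = A.R \<mu> 0" by (simp add: J_def RA.zero)
  then have "B.R \<nu> x = B.R \<nu> 0"
    unfolding A.R_def RB.zero using resolvent_inj[OF A.res[OF \<mu>'] _ A.A] by blast
  then show "x = 0" unfolding B.R_def using resolvent_inj[OF B.res[OF \<mu>\<nu>(2)] _ B.B] by blast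
qed

lemma J_mem: "(J \<mu> \<nu> x, \<mu> *\<^sub>R J \<mu> \<nu> x - B.R \<nu> x) \<in> A" "(J \<mu> \<nu> x, \<nu> *\<^sub>R J \<mu> \<nu> x - A.R \<mu> x) \<in> B"
  unfolding J_def using A.R_mem[OF \<mu>', of "B.R \<nu> x"] B.R_mem[OF \<mu>\<nu>(2), of "A.R \<mu> x"] comm[OF \<mu>\<nu>, of x] by simp_all

lemma J_sum:
  assumes "(u, a) \<in> A" "(u, b) \<in> B"
  shows "(J \<mu> \<nu> u, J \<mu> \<nu> a) \<in> A" "(J \<mu> \<nu> u, J \<mu> \<nu> b) \<in> B"
    "J \<mu> \<nu> (a + b) = (\<mu> + \<nu>) *\<^sub>R J \<mu> \<nu> u - B.R \<nu> u - A.R \<mu> u"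
proof -
  have "A.R \<mu> a = \<mu> *\<^sub>R A.R \<mu> u - u" using A.R_eq[OF \<mu>' assms(1)] by (simp add: RA.diff RA.scaleR algebra_simps)
  then have a: "J \<mu> \<nu> a = \<mu> *\<^sub>R J \<mu> \<nu> u - B.R \<nu> u"
    unfolding J_def comm[OF \<mu>\<nu>] by (simp add: RB.diff RB.scaleR)
  have "B.R \<nu> b = \<nu> *\<^sub>R B.R \<nu> u - u" using B.R_eq[OF \<mu>\<nu>(2) assms(2)] by (simp add: RB.diff RB.scaleR algebra_simps)
  then have b: "J \<mu> \<nu> b = \<nu> *\<^sub>R J \<mu> \<nu> u - A.R \<mu> u"
    unfolding J_def by (simp add: RA.diff RA.scaleR)
  show "(J \<mu> \<nu> u, J \<mu> \<nu> a) \<in> A" "(J \<mu> \<nu> u, J \<mu> \<nu> b) \<in> B" unfolding a b by (rule J_mem)+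
  show "J \<mu> \<nu> (a + b) = (\<mu> + \<nu>) *\<^sub>R J \<mu> \<nu> u - B.R \<nu> u - A.R \<mu> u" by (simp add: J.add a b algebra_simps)
qed

text \<open>After applying J, the sum a + b is expressed by bounded operators in u alone
  (\<open>J_sum\<close>). Such an identity survives limits of (u, a + b), even though a and b need
  not converge separately.\<close>

lemma J_C: assumes "(u, y) \<in> C"
  shows "(J \<mu> \<nu> u, J \<mu> \<nu> y) \<in> op_sum A B" "J \<mu> \<nu> y = (\<mu> + \<nu>) *\<^sub>R J \<mu> \<nu> u - B.R \<nu> u - A.R \<mu> u"
proof -
  obtain f g where fg: "\<And>n::nat. (f n, g n) \<in> op_sum A B" "f \<longlonglongrightarrow> u" "g \<longlonglongrightarrow> y"
    using assms unfolding C_def closure_pair_sequence by blast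
  have "J \<mu> \<nu> (g n) = (\<mu> + \<nu>) *\<^sub>R J \<mu> \<nu> (f n) - B.R \<nu> (f n) - A.R \<mu> (f n)" for n
  proof -
    obtain a b where ab: "(f n, a) \<in> A" "(f n, b) \<in> B" "g n = a + b" using fg(1)[of n] unfolding op_sum_def by blast
    then show ?thesis using J_sum(3)[OF ab(1,2)] by simp
  qed
  moreover have "(\<lambda>n. (\<mu> + \<nu>) *\<^sub>R J \<mu> \<nu> (f n) - B.R \<nu> (f n) - A.R \<mu> (f n)) \<longlonglongrightarrow> (\<mu> + \<nu>) *\<^sub>R J \<mu> \<nu> u - B.R \<nu> u - A.R \<mu> u"
    by (intro tendsto_intros J.tendsto RB.tendsto RA.tendsto fg)
  ultimately show e: "J \<mu> \<nu> y = (\<mu> + \<nu>) *\<^sub>R J \<mu> \<nu> u - B.R \<nu> u - A.R \<mu> u"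
    using J.tendsto[OF fg(3)] LIMSEQ_unique by simp
  have "J \<mu> \<nu> y = (\<mu> *\<^sub>R J \<mu> \<nu> u - B.R \<nu> u) + (\<nu> *\<^sub>R J \<mu> \<nu> u - A.R \<mu> u)" by (simp add: e algebra_simps)
  then show "(J \<mu> \<nu> u, J \<mu> \<nu> y) \<in> op_sum A B" unfolding op_sum_def using J_mem[of u] by blast
qed

end

lemma C_closed: "closed_operator C" and sum_closable: "closable (op_sum A B)"
  and op_closure_sum: "op_closure (op_sum A B) = C"
proof -
  \<comment> \<open>Over u = 0 the identity of \<open>J_C\<close> reads J y = 0, and J is injective.
    No resolvent of the sum is involved yet.\<close>
  have sv: "y = 0" if y: "(0, y) \<in> closure (op_sum A B)" for y
  proof -
    have "J r\<^sub>0 r\<^sub>0 y = 0"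
      using J_C(2)[of r\<^sub>0 r\<^sub>0 0 y] y bounded_linear.linear[OF J_bl[of r\<^sub>0 r\<^sub>0], THEN linear_0]
        bounded_linear.linear[OF A.R_bl[OF \<omega>r0], THEN linear_0] bounded_linear.linear[OF B.R_bl[OF order_refl], THEN linear_0]
      by (simp add: C_def)
    then show ?thesis by (rule J_inj[OF order_refl order_refl])
  qed
  note cl = closed_operator_closure[OF sum_linear sv]
  show "closed_operator C" "closable (op_sum A B)" "op_closure (op_sum A B) = C"
    using cl by (simp_all add: C_def)
qed

lemma C_linear: "linear_operator C" using C_closed by (simp add: closed_operator_def)
lemmas CD = linear_operatorD[OF C_linear]

lemma C_in: "(u, y) \<in> C \<Longrightarrow> u \<in> X0"
proof -
  assume "(u, y) \<in> C"
  then obtain f g where fg: "\<And>n::nat. (f n, g n) \<in> op_sum A B" "f \<longlonglongrightarrow> u"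
    unfolding C_def closure_pair_sequence by blast
  have "f n \<in> Domain A \<inter> Domain B" for n using fg(1)[of n] Domain_sum by blast
  then show "u \<in> X0" unfolding X0_def closure_sequential using fg(2) by blast
qed

lemma closure_Domain_C: "closure (Domain C) = X0"
proof
  have "Domain C \<subseteq> X0" using C_in by blast
  then show "closure (Domain C) \<subseteq> X0" using X0D(1) by (rule closure_minimal)
  show "X0 \<subseteq> closure (Domain C)" unfolding X0_def Domain_sum[symmetric]
    by (intro closure_mono Domain_mono) (simp add: C_def closure_subset)
qed

lemma op_part_C: "(x, y) \<in> op_part C \<longleftrightarrow> (x, y) \<in> C \<and> y \<in> X0"
  by (simp add: op_part_def closure_Domain_C)

section \<open>The resolvent of the closure on the real half line\<close>

context
  fixes K r\<^sub>1 \<gamma> :: real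
  assumes r1: "r\<^sub>0 \<le> r\<^sub>1" and \<gamma>: "0 < \<gamma>" and K: "0 \<le> K"
    and ap: "\<And>r u a b. r\<^sub>1 \<le> r \<Longrightarrow> (u, a) \<in> A \<Longrightarrow> (u, b) \<in> B \<Longrightarrow>
           norm u \<le> K * r powr (- \<gamma>) * norm (r *\<^sub>R u - a - b)"
    and dense: "\<And>r. r\<^sub>1 \<le> r \<Longrightarrow> closure (Range (shifted (complex_of_real r) (op_sum A B))) = UNIV"
    and \<alpha>: "0 < \<alpha>"
begin

lemma apriori_C: assumes "r\<^sub>1 \<le> r" "(u, y) \<in> C" shows "norm u \<le> K * r powr (- \<gamma>) * norm (r *\<^sub>R u - y)"
proof -
  obtain f g where fg: "\<And>n::nat. (f n, g n) \<in> op_sum A B" "f \<longlonglongrightarrow> u" "g \<longlonglongrightarrow> y"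
    using assms(2) unfolding C_def closure_pair_sequence by blast
  have le: "norm (f n) \<le> K * r powr (- \<gamma>) * norm (r *\<^sub>R f n - g n)" for n
  proof -
    obtain a b where ab: "(f n, a) \<in> A" "(f n, b) \<in> B" "g n = a + b" using fg(1)[of n] unfolding op_sum_def by blast
    then show ?thesis using ap[OF assms(1) ab(1,2)] by (simp add: diff_diff_add)
  qed
  show ?thesis
  proof (rule LIMSEQ_le)
    show "(\<lambda>n. norm (f n)) \<longlonglongrightarrow> norm u" by (intro tendsto_intros fg)
    show "(\<lambda>n. K * r powr (- \<gamma>) * norm (r *\<^sub>R f n - g n)) \<longlonglongrightarrow> K * r powr (- \<gamma>) * norm (r *\<^sub>R u - y)"
      by (intro tendsto_intros fg)
  qed (use le in blast)
qed

text \<open>The range is closed by the a priori estimate, and it contains the dense range of r - (A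
  + B).\<close>

lemma surj_C: assumes r: "r\<^sub>1 \<le> r" shows "\<exists>u. (u, r *\<^sub>R u - x) \<in> C"
proof -
  define Z where "Z = {w. \<exists>u. (u, of_real r *\<^sub>C u - w) \<in> C}"
  have "closed Z" unfolding Z_def
  proof (rule closed_range_of_apriori)
    show "closed C" using C_closed by (simp add: closed_operator_def)
    show "norm u \<le> (K * r powr (- \<gamma>)) * norm (of_real r *\<^sub>C u - v)" if "(u, v) \<in> C" for u v
      using apriori_C[OF r that] by (simp add: scaleC_of_real)
  qed (rule CD(6))
  moreover have "Range (shifted (complex_of_real r) (op_sum A B)) \<subseteq> Z"
  proof
    fix w assume "w \<in> Range (shifted (complex_of_real r) (op_sum A B))"
    then obtain u y where uy: "(u, y) \<in> op_sum A B" "w = of_real r *\<^sub>C u - y" by (auto simp: shifted_def)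
    have "(u, y) \<in> C" unfolding C_def by (rule subsetD[OF closure_subset uy(1)])
    then show "w \<in> Z" unfolding Z_def uy(2) by (intro CollectI exI[of _ u]) simp
  qed
  ultimately have "UNIV \<subseteq> Z" using closure_minimal dense[OF r] by metis
  then show ?thesis by (auto simp: Z_def scaleC_of_real)
qed

lemma resolvent_C: assumes r: "r\<^sub>1 \<le> r"
  shows "complex_of_real r \<in> resolvent_set C" "norm (resolvent C (complex_of_real r) x) \<le> K * r powr (- \<gamma>) * norm x"
proof -
  have ex: "\<exists>u. (u, of_real r *\<^sub>C u - x) \<in> C" for x using surj_C[OF r] by (simp add: scaleC_of_real)
  have le: "norm u \<le> K * r powr (- \<gamma>) * norm (of_real r *\<^sub>C u - v)" if "(u, v) \<in> C" for u v
    using apriori_C[OF r that] by (simp add: scaleC_of_real)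
  show "complex_of_real r \<in> resolvent_set C" by (rule resolvent_setI(1)[OF C_linear ex le])
  show "norm (resolvent C (complex_of_real r) x) \<le> K * r powr (- \<gamma>) * norm x"
    by (rule resolvent_setI(2)[OF C_linear ex le])
qed

definition RC where "RC r = resolvent C (complex_of_real r)"

lemma RC_mem: "r\<^sub>1 \<le> r \<Longrightarrow> (RC r x, r *\<^sub>R RC r x - x) \<in> C"
  using resolvent_mem[OF resolvent_C(1)] by (simp add: RC_def scaleC_of_real)

lemma RC_eq: "r\<^sub>1 \<le> r \<Longrightarrow> (u, v) \<in> C \<Longrightarrow> RC r (r *\<^sub>R u - v) = u"
  using resolvent_eq[OF resolvent_C(1)] by (simp add: RC_def scaleC_of_real)

lemma RC_bl: "r\<^sub>1 \<le> r \<Longrightarrow> bounded_linear (RC r)"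
  unfolding RC_def by (rule resolvent_bounded_linear[OF resolvent_C(1)])

section \<open>The part of the closure as generator of the product semigroup\<close>

context
  fixes \<delta>P UP
  assumes P: "analytic_sg X0 (\<lambda>t x. TA t (TB t x)) \<delta>P UP"
begin

interpretation P: analytic_sg X0 "\<lambda>t x. TA t (TB t x)" \<delta>P UP by (rule P)

text \<open>Product rule at time 0: the quotient of T_A T_B splits into T_A(h) applied to the
  quotient of T_B plus the quotient of T_A. Both a and b must lie in \<open>X0\<close> for w to be
  in the two generators.\<close>

lemma sum_generator:
  assumes wa: "(w, a) \<in> A" and wb: "(w, b) \<in> B" and ab: "a \<in> X0" "b \<in> X0"
  shows "(w, a + b) \<in> P.G"
proof -
  have w: "w \<in> X0" "w \<in> A.Y" "w \<in> B.Y" using X0_I[OF wa wb] X0_subset by auto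
  have GA: "(w, a) \<in> A.T.G" using wa ab X0_subset by (auto simp: A.T_G op_part_def A.Y_def[symmetric])
  have GB: "(w, b) \<in> B.G" using wb ab X0_subset by (auto simp: B.GB op_part_def)
  \<comment> \<open>T_B(h) w is E(h) w, and E(h) preserves D(A); thus T_A may be applied to each
    term separately.\<close>
  have TBw: "TB h w \<in> A.Y" if "0 < h" for h
    using A.Domain_in[OF E_A[OF that wa]] B.E_Y[OF that w(3)] by simp
  have q: "((\<lambda>h. TA h ((TB h w - w) /\<^sub>R h)) \<longlongrightarrow> TA 0 b) (at_right 0)"
  proof (rule A.T.T_tendsto)
    show "((\<lambda>h. (TB h w - w) /\<^sub>R h) \<longlongrightarrow> b) (at_right 0)" using GB by (simp add: B.G_iff)
    show "\<forall>\<^sub>F h in at_right 0. 0 \<le> h \<and> (TB h w - w) /\<^sub>R h \<in> A.Y"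
      unfolding eventually_at_right_field using TBw w by (intro exI[of _ 1]) (auto intro!: A.YD(5,7))
  qed (use ab X0_subset in auto)
  have "((\<lambda>h. TA h ((TB h w - w) /\<^sub>R h) + (TA h w - w) /\<^sub>R h) \<longlongrightarrow> TA 0 b + a) (at_right 0)"
    by (rule tendsto_add[OF q]) (use GA in \<open>simp add: A.T.G_iff\<close>)
  moreover have "\<forall>\<^sub>F h in at_right 0. TA h ((TB h w - w) /\<^sub>R h) + (TA h w - w) /\<^sub>R h = (TA h (TB h w) - w) /\<^sub>R h"
    unfolding eventually_at_right_field
  proof (intro exI[of _ 1] conjI allI impI)
    fix h :: real assume h: "0 < h"
    have "TA h ((TB h w - w) /\<^sub>R h) = (TA h (TB h w) - TA h w) /\<^sub>R h"
      using h TBw[OF h] w A.YD(7)[OF TBw[OF h] w(2)] by (simp only: A.T.T_scaleR A.T.T_diff less_imp_le)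
    then show "TA h ((TB h w - w) /\<^sub>R h) + (TA h w - w) /\<^sub>R h = (TA h (TB h w) - w) /\<^sub>R h"
      by (simp add: scaleR_diff_right)
  qed simp
  ultimately have "((\<lambda>h. (TA h (TB h w) - w) /\<^sub>R h) \<longlongrightarrow> TA 0 b + a) (at_right 0)"
    by (rule Lim_transform_eventually)
  moreover have "TA 0 b = b" using ab X0_subset by (intro A.T.T_0) auto
  ultimately show ?thesis using w(1) by (simp add: P.G_iff add.commute)
qed

text \<open>The solution for the right-hand side J y is J v with v = \<open>RC r y\<close>. The A-
  and B-images of J v are combinations of J v and resolvents of v, all in \<open>X0\<close>, so
  \<open>sum_generator\<close> applies.\<close>

lemma RC_J_generator:
  assumes r: "r\<^sub>1 \<le> r" and \<mu>\<nu>: "\<mu> \<ge> r\<^sub>0" "\<nu> \<ge> r\<^sub>0" and y: "y \<in> X0"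
  shows "(RC r (J \<mu> \<nu> y), r *\<^sub>R RC r (J \<mu> \<nu> y) - J \<mu> \<nu> y) \<in> P.G"
proof -
  interpret J: bounded_linear "J \<mu> \<nu>" by (rule J_bl[OF \<mu>\<nu>])
  define v where "v = RC r y"
  have vC: "(v, r *\<^sub>R v - y) \<in> C" unfolding v_def by (rule RC_mem[OF r])
  have v: "v \<in> X0" by (rule C_in[OF vC])
  have JvX: "J \<mu> \<nu> v \<in> X0" unfolding J_def by (intro RA_X0 RB_X0 \<mu>\<nu> v)
  have 1: "(J \<mu> \<nu> v, (\<mu> *\<^sub>R J \<mu> \<nu> v - B.R \<nu> v) + (\<nu> *\<^sub>R J \<mu> \<nu> v - A.R \<mu> v)) \<in> P.G"
    by (intro sum_generator J_mem \<mu>\<nu> X0D(5,7) JvX RA_X0 RB_X0 v)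
  have e: "J \<mu> \<nu> (r *\<^sub>R v - y) = r *\<^sub>R J \<mu> \<nu> v - J \<mu> \<nu> y" by (simp add: J.diff J.scaleR)
  have "(J \<mu> \<nu> v, r *\<^sub>R J \<mu> \<nu> v - J \<mu> \<nu> y) \<in> C"
    using J_C(1)[OF \<mu>\<nu> vC] unfolding C_def e by (rule subsetD[OF closure_subset])
  from RC_eq[OF r this] have 2: "RC r (J \<mu> \<nu> y) = J \<mu> \<nu> v" by simp
  have "r *\<^sub>R J \<mu> \<nu> v - J \<mu> \<nu> y = (\<mu> *\<^sub>R J \<mu> \<nu> v - B.R \<nu> v) + (\<nu> *\<^sub>R J \<mu> \<nu> v - A.R \<mu> v)"
    using J_C(2)[OF \<mu>\<nu> vC] unfolding e by (simp add: algebra_simps)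
  then show ?thesis using 1 unfolding 2 by simp
qed

text \<open>The admissible y form a closed set since the generator is closed. For y in D(A) \<inter>
  D(B) the regularisation is removed in two limits, first \<nu> \<rightarrow> \<infinity> and then
  \<mu> \<rightarrow> \<infinity>.\<close>

lemma RC_generator:
  assumes r: "r\<^sub>1 \<le> r" and y: "y \<in> X0" shows "(RC r y, r *\<^sub>R RC r y - y) \<in> P.G"
proof -
  interpret RC: bounded_linear "RC r" by (rule RC_bl[OF r])
  define Z where "Z = {y. (RC r y, r *\<^sub>R RC r y - y) \<in> P.G}"
  have "closed Z"
    unfolding closed_sequential_limits
  proof (intro allI impI, elim conjE)
    fix f l assume f: "\<forall>n. f n \<in> Z" "f \<longlonglongrightarrow> l"
    have "(\<lambda>n. (RC r (f n), r *\<^sub>R RC r (f n) - f n)) \<longlonglongrightarrow> (RC r l, r *\<^sub>R RC r l - l)"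
      by (intro tendsto_intros RC.tendsto f)
    then show "l \<in> Z"
      using closed_sequentially[OF P.G_closed, of "\<lambda>n. (RC r (f n), r *\<^sub>R RC r (f n) - f n)"] f(1) by (simp add: Z_def)
  qed
  have scale: "c *\<^sub>R y \<in> Z" if "y \<in> Z" for c y
  proof -
    have "(c *\<^sub>R RC r y, c *\<^sub>R (r *\<^sub>R RC r y - y)) \<in> P.G"
      using subspace_scale[OF P.G_linear(4), of _ c] that by (force simp: Z_def)
    then show ?thesis by (simp add: Z_def RC.scaleR scaleR_diff_right mult.commute)
  qed
  have D: "y \<in> Z" if y: "y \<in> Domain A \<inter> Domain B" for y
  proof -
    have yX: "y \<in> X0" using y X0_I by blast
    have JZ: "J \<mu> \<nu> y \<in> Z" if "\<mu> \<ge> r\<^sub>0" "\<nu> \<ge> r\<^sub>0" for \<mu> \<nu>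
      unfolding Z_def using RC_J_generator[OF r that yX] by simp
    have "A.R \<mu> y \<in> Z" if \<mu>: "\<mu> \<ge> r\<^sub>0" for \<mu>
    proof -
      have \<mu>': "\<mu> > \<omega>" using \<mu> \<omega>r0 by simp
      interpret RA: bounded_linear "A.R \<mu>" by (rule A.R_bl[OF \<mu>'])
      \<comment> \<open>With \<mu> fixed, (\<mu> - A)^-1 is bounded and carries the limit \<nu>
        (\<nu> - B)^-1 y \<rightarrow> y through.\<close>
      have "((\<lambda>\<nu>. \<nu> *\<^sub>R J \<mu> \<nu> y) \<longlongrightarrow> A.R \<mu> y) at_top"
        unfolding J_def RA.scaleR[symmetric] using y by (intro RA.tendsto B.R_approx_domain \<alpha>) auto
      moreover have "\<forall>\<^sub>F \<nu> in at_top. \<nu> *\<^sub>R J \<mu> \<nu> y \<in> Z"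
        using eventually_ge_at_top[of r\<^sub>0] by eventually_elim (intro scale JZ \<mu>)
      ultimately show ?thesis by (intro Lim_in_closed_set[OF \<open>closed Z\<close>]) auto
    qed
    then have "\<forall>\<^sub>F \<mu> in at_top. \<mu> *\<^sub>R A.R \<mu> y \<in> Z"
      by (intro eventually_mono[OF eventually_ge_at_top[of r\<^sub>0]] scale)
    moreover have "((\<lambda>\<mu>. \<mu> *\<^sub>R A.R \<mu> y) \<longlongrightarrow> y) at_top" using y by (intro A.R_approx_domain) auto
    ultimately show ?thesis by (intro Lim_in_closed_set[OF \<open>closed Z\<close>, of "\<lambda>\<mu>. \<mu> *\<^sub>R A.R \<mu> y" at_top]) auto
  qed
  then have "X0 \<subseteq> Z" unfolding X0_def using \<open>closed Z\<close> by (intro closure_minimal) auto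
  then show ?thesis using y by (auto simp: Z_def)
qed

text \<open>For large r both the closure and the generator can be resolved at r:
  \<open>RC_generator\<close> gives one inclusion, and surjectivity on \<open>X0\<close> makes it an
  equality by \<open>G_eqI\<close>.\<close>

lemma generator_eq: "P.G = op_part C"
proof -
  obtain K' \<omega>' where K': "\<And>t x. t \<ge> 0 \<Longrightarrow> x \<in> X0 \<Longrightarrow> norm (TA t (TB t x)) \<le> K' * exp (\<omega>' * t) * norm x"
    using P.exp_bound by blast
  define r where "r = max r\<^sub>1 (\<omega>' + 1)"
  have r: "r\<^sub>1 \<le> r" "r > \<omega>'" by (auto simp: r_def)
  show ?thesis
  proof (rule P.G_eqI[OF K', where z = "of_real r"])
    show "op_part C \<subseteq> P.G"
    proof (rule subrelI)
      fix v z assume "(v, z) \<in> op_part C"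
      then have vz: "(v, z) \<in> C" "z \<in> X0" by (auto simp: op_part_C)
      have "r *\<^sub>R v - z \<in> X0" using vz C_in by (intro X0D(5,7)) auto
      from RC_generator[OF r(1) this] show "(v, z) \<in> P.G" by (simp add: RC_eq[OF r(1) vz(1)])
    qed
    fix w assume w: "w \<in> X0"
    have "r *\<^sub>R RC r w - w \<in> X0" using C_in[OF RC_mem[OF r(1)]] w by (intro X0D(5,7)) auto
    then show "\<exists>x. (x, of_real r *\<^sub>C x - w) \<in> op_part C"
      using RC_mem[OF r(1), of w] by (intro exI[of _ "RC r w"]) (simp add: op_part_C scaleC_of_real)
  qed (use r in auto)
qed

lemma closure_analytic_resolvent_condition:
  assumes "analytic_semigroup X0 (\<lambda>t x. TA t (TB t x))"
  shows "analytic_resolvent_condition C \<gamma>"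
  unfolding analytic_resolvent_condition_def
proof (intro conjI exI)
  show "part_generates C (\<lambda>t x. TA t (TB t x))"
    using P.sg generator_eq by (simp add: part_generates_def closure_Domain_C P.G_def)
  show "analytic_semigroup (closure (Domain C)) (\<lambda>t x. TA t (TB t x))" using assms by (simp add: closure_Domain_C)
  show "\<forall>r>r\<^sub>1. complex_of_real r \<in> resolvent_set C" using resolvent_C(1) by simp
  show "(\<lambda>r. onorm (resolvent C (complex_of_real r))) \<in> O(\<lambda>r. r powr (- \<gamma>))"
  proof (rule bigoI[of _ K])
    show "\<forall>\<^sub>F r in at_top. norm (onorm (resolvent C (complex_of_real r))) \<le> K * norm (r powr (- \<gamma>))"
      using eventually_ge_at_top[of r\<^sub>1]
    proof eventually_elim
      case (elim r)
      have "onorm (resolvent C (complex_of_real r)) \<le> K * r powr (- \<gamma>)"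
        using K resolvent_C(2)[OF elim] by (intro onorm_bound) auto
      moreover have "0 \<le> onorm (resolvent C (complex_of_real r))"
        by (rule onorm_pos_le[OF resolvent_bounded_linear[OF resolvent_C(1)[OF elim]]])
      ultimately show ?case by simp
    qed
  qed
qed

text \<open>The resolvent of \<open>C\<close> at \<open>z\<close> is \<open>x \<mapsto> R(\<mu>) x + (z - C\<^sub>0)\<^sup>-\<^sup>1 (\<mu> - z) R(\<mu>) x\<close> for the real point
  \<open>\<mu> = \<omega> + \<bar>z - \<omega>\<bar>\<close>, where \<open>R\<close> is the resolvent of \<open>C\<close> and \<open>C\<^sub>0\<close> the part of \<open>C\<close> in \<open>X0\<close>.\<close>

lemma closure_almost_sectorial: "almost_sectorial \<gamma> C"
proof -
  obtain \<theta> \<omega>\<^sub>0 m where \<theta>: "pi / 2 < \<theta>" "\<theta> < pi" and m: "0 < m"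
    and S: "\<forall>\<omega>\<ge>\<omega>\<^sub>0. \<forall>z\<in>sector \<omega> \<theta>. (\<forall>w\<in>X0. \<exists>x. (x, z *\<^sub>C x - w) \<in> P.G) \<and>
     (\<forall>x y. (x, y) \<in> P.G \<longrightarrow> cmod (z - of_real \<omega>) * norm x \<le> m * norm (z *\<^sub>C x - y))"
    using P.sector_resolvent by blast
  have sec: "\<And>\<omega> z w. \<omega> \<ge> \<omega>\<^sub>0 \<Longrightarrow> z \<in> sector \<omega> \<theta> \<Longrightarrow> w \<in> X0 \<Longrightarrow> \<exists>x. (x, z *\<^sub>C x - w) \<in> P.G"
      "\<And>\<omega> z x y. \<omega> \<ge> \<omega>\<^sub>0 \<Longrightarrow> z \<in> sector \<omega> \<theta> \<Longrightarrow> (x, y) \<in> P.G \<Longrightarrow> cmod (z - of_real \<omega>) * norm x \<le> m * norm (z *\<^sub>C x - y)"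
    using S by blast+
  define \<omega>' where "\<omega>' = max \<omega>\<^sub>0 r\<^sub>1"
  have \<omega>': "\<omega>' \<ge> \<omega>\<^sub>0" "\<omega>' \<ge> r\<^sub>1" "\<omega>' > 0" using r1 B.r0 by (auto simp: \<omega>'_def)
  \<comment> \<open>1 accounts for the resolvent at the real point, and 2 m for the correction from
    the part.\<close>
  define L where "L = (1 + 2 * m) * K"
  have L: "L \<ge> 0" using m K by (simp add: L_def)
  \<comment> \<open>The bound is stated with L + 1 because L may be 0 while the constant of almost
    sectoriality must be positive.\<close>
  have main: "z \<in> resolvent_set C \<and> cmod (z - of_real \<omega>') powr \<gamma> * onorm (resolvent C z) \<le> L + 1"
    if z: "z \<in> sector \<omega>' \<theta>" for z
  proof -
    define d where "d = cmod (z - of_real \<omega>')"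
    define \<mu> where "\<mu> = \<omega>' + d"
    have d: "0 < d" using z by (simp add: d_def sector_def)
    have \<mu>: "r\<^sub>1 \<le> \<mu>" "d \<le> \<mu>" "0 < \<mu>" using \<omega>' d by (auto simp: \<mu>_def)
    \<comment> \<open>The real point lies at the same distance d from the vertex as z, so |\<mu> -
      z| \<le> 2 d; this d cancels the 1 / d decay of the resolvent of the part.\<close>
    have \<mu>z: "cmod (of_real \<mu> - z) \<le> 2 * d"
    proof -
      have "of_real \<mu> - z = of_real d - (z - of_real \<omega>')" by (simp add: \<mu>_def)
      then have "cmod (of_real \<mu> - z) \<le> cmod (of_real d) + d" unfolding d_def by (metis norm_triangle_ineq4)
      then show ?thesis using d by simp
    qed
    have RCX: "RC \<mu> x \<in> X0" for x by (rule C_in[OF RC_mem[OF \<mu>(1)]])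
    have ex: "\<exists>y. (y, z *\<^sub>C y - x) \<in> C" for x
    proof -
      define w where "w = (of_real \<mu> - z) *\<^sub>C RC \<mu> x"
      have "w \<in> X0" unfolding w_def by (rule X0D(4)[OF RCX])
      then obtain s where "(s, z *\<^sub>C s - w) \<in> P.G" using sec(1)[OF \<omega>'(1) z] by blast
      then have "(s, z *\<^sub>C s - w) \<in> C" by (simp add: generator_eq op_part_C)
      from CD(3)[OF RC_mem[OF \<mu>(1), of x] this]
      have "(RC \<mu> x + s, z *\<^sub>C (RC \<mu> x + s) - x) \<in> C"
        by (simp add: w_def scaleC.diff_left scaleC_of_real scaleC_add_right algebra_simps)
      then show ?thesis by blast
    qed
    have le: "norm u \<le> L * \<mu> powr (- \<gamma>) * norm (z *\<^sub>C u - v)" if uv: "(u, v) \<in> C" for u v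
    proof -
      define x where "x = z *\<^sub>C u - v"
      define q where "q = RC \<mu> x"
      define w where "w = (of_real \<mu> - z) *\<^sub>C q"
      have q: "norm q \<le> K * \<mu> powr (- \<gamma>) * norm x" unfolding q_def RC_def by (rule resolvent_C(2)[OF \<mu>(1)])
      have "(u - q, v - (\<mu> *\<^sub>R q - x)) \<in> C" unfolding q_def by (rule CD(6)[OF uv RC_mem[OF \<mu>(1)]])
      also have "v - (\<mu> *\<^sub>R q - x) = z *\<^sub>C (u - q) - w"
        by (simp add: x_def w_def scaleC.diff_left scaleC_of_real scaleC.diff_right algebra_simps)
      finally have C: "(u - q, z *\<^sub>C (u - q) - w) \<in> C" .
      have "w \<in> X0" unfolding w_def q_def by (rule X0D(4)[OF RCX])
      then have "z *\<^sub>C (u - q) - w \<in> X0" by (intro X0D(4,7) C_in[OF C])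
      then have "(u - q, z *\<^sub>C (u - q) - w) \<in> P.G" using C by (simp add: generator_eq op_part_C)
      from sec(2)[OF \<omega>'(1) z this] have "d * norm (u - q) \<le> m * norm w" by (simp add: d_def)
      also have "\<dots> \<le> m * (2 * d * norm q)"
        unfolding w_def norm_scaleC using m \<mu>z by (intro mult_left_mono mult_right_mono) auto
      also have "\<dots> = d * (2 * m * norm q)" by simp
      finally have "norm (u - q) \<le> 2 * m * norm q" using d by simp
      then have "norm u \<le> (1 + 2 * m) * norm q"
        using norm_triangle_sub[of u q] by (simp add: algebra_simps)
      also have "\<dots> \<le> (1 + 2 * m) * (K * \<mu> powr (- \<gamma>) * norm x)" using q m by (intro mult_left_mono) auto
      finally show ?thesis by (simp add: L_def x_def mult_ac)
    qed
    have res: "z \<in> resolvent_set C" by (rule resolvent_setI(1)[OF C_linear ex le])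
    have "onorm (resolvent C z) \<le> L * \<mu> powr (- \<gamma>)"
      using L resolvent_setI(2)[OF C_linear ex le] by (intro onorm_bound) auto
    then have "d powr \<gamma> * onorm (resolvent C z) \<le> d powr \<gamma> * (L * \<mu> powr (- \<gamma>))" by (intro mult_left_mono) auto
    \<comment> \<open>As d \<le> \<mu>, the real-axis decay \<mu>^(-\<gamma>) already compensates
      the weight d^\<gamma>.\<close>
    also have "\<dots> \<le> \<mu> powr \<gamma> * (L * \<mu> powr (- \<gamma>))"
      using L \<mu> d \<gamma> by (intro mult_right_mono powr_mono2) auto
    also have "\<dots> = L" using \<mu> by (simp add: powr_minus)
    finally show ?thesis using res by (simp add: d_def)
  qed
  show ?thesis
    unfolding almost_sectorial_def
    using \<theta> L main by (intro exI[of _ \<omega>'] exI[of _ \<theta>] exI[of _ "L + 1"]) auto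
qed

end

end

end

theorem corollary2p16:
  fixes A B :: "('x::complex_banach) operator"
    and \<omega>\<^sub>A M\<^sub>A p p' :: real and q' :: ereal
  assumes "closed_operator A" and "closed_operator B"
    and "resolvent_commuting A B"
    and "1 \<le> p" and "1 \<le> p'"
    and "weak_hille_yosida A \<omega>\<^sub>A M\<^sub>A"
    and "Lp_convolution_estimate A \<omega>\<^sub>A M\<^sub>A p"
    and "analytic_resolvent_condition B (1 / p')"
    and "1 / p + 1 / p' > 1"
    and "1 < q'" and "1 / ereal p' + 1 / q' = 1"
    and "\<exists>r\<^sub>0::real. \<forall>r\<ge>r\<^sub>0. closure (Range (shifted (complex_of_real r) (op_sum A B))) = UNIV"
    and "analytic_semigroup (closure (Domain A \<inter> Domain B))
           (\<lambda>t x. part_semigroup A t (part_semigroup B t x))"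
  shows "closable (op_sum A B) \<and>
    (\<forall>\<gamma>::real. 0 < \<gamma> \<and> ereal \<gamma> < 1 / ereal p - 1 / q' \<longrightarrow>
       analytic_resolvent_condition (op_closure (op_sum A B)) \<gamma> \<and>
       almost_sectorial \<gamma> (op_closure (op_sum A B)))"
proof -
  define \<alpha> where "\<alpha> = 1 / p'"
  have \<alpha>: "0 < \<alpha>" "\<alpha> \<le> 1" using assms(5) by (auto simp: \<alpha>_def)
  have A: "linear_operator A" and B: "linear_operator B"
    using assms(1,2) by (auto simp: closed_operator_def)
  interpret hA: hille_yosida_operator A \<omega>\<^sub>A M\<^sub>A using A assms(6) by unfold_locales
  obtain T \<omega>\<^sub>B where T: "part_generates B T" "analytic_semigroup (closure (Domain B)) T"
    and \<omega>\<^sub>B: "\<And>r. r > \<omega>\<^sub>B \<Longrightarrow> complex_of_real r \<in> resolvent_set B"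
    and bigo: "(\<lambda>r. onorm (resolvent B (complex_of_real r))) \<in> O(\<lambda>r. r powr (- \<alpha>))"
    using assms(8) unfolding analytic_resolvent_condition_def \<alpha>_def by blast
  obtain \<delta> U where TB: "analytic_sg (closure (Domain B)) (part_semigroup B) \<delta> U"
    using part_semigroup_analytic[OF B T] by blast
  obtain C\<^sub>0 where C0: "C\<^sub>0 > 0"
    "\<forall>\<^sub>F r in at_top. norm (onorm (resolvent B (complex_of_real r))) \<le> C\<^sub>0 * norm (r powr (- \<alpha>))"
    using landau_o.bigE[OF bigo] by blast
  then obtain N where N: "\<And>r. r \<ge> N \<Longrightarrow> norm (onorm (resolvent B (complex_of_real r))) \<le> C\<^sub>0 * norm (r powr (- \<alpha>))"
    unfolding eventually_at_top_linorder by blast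
  \<comment> \<open>One threshold lying in both resolvent sets, positive, and beyond the point where
    the O-bound for B holds.\<close>
  define r\<^sub>0 where "r\<^sub>0 = max (max 1 N) (max \<omega>\<^sub>A \<omega>\<^sub>B + 1)"
  have r0: "r\<^sub>0 > 0" "r\<^sub>0 \<ge> N" "r\<^sub>0 > \<omega>\<^sub>A" "r\<^sub>0 > \<omega>\<^sub>B" by (auto simp: r\<^sub>0_def)
  interpret tB: analytic_sg "closure (Domain B)" "part_semigroup B" \<delta> U by (rule TB)
  interpret hB: analytic_operator B "part_semigroup B" \<delta> U r\<^sub>0 C\<^sub>0 \<alpha>
  proof unfold_locales
    show "tB.G = op_part B"
      using part_generates_part_semigroup[OF T(1)] unfolding tB.G_def by (simp add: part_generates_def)
    fix r x assume r: "r \<ge> r\<^sub>0"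
    then show res: "complex_of_real r \<in> resolvent_set B" using r0 \<omega>\<^sub>B by simp
    have "norm (resolvent B (complex_of_real r) x) \<le> onorm (resolvent B (complex_of_real r)) * norm x"
      by (rule onorm[OF resolvent_bounded_linear[OF res]])
    also have "\<dots> \<le> C\<^sub>0 * r powr (- \<alpha>) * norm x"
      using N[of r] r r0 by (intro mult_right_mono) auto
    finally show "norm (resolvent B (complex_of_real r) x) \<le> C\<^sub>0 * r powr (- \<alpha>) * norm x" .
  qed (use B r0 C0 in auto)
  interpret commuting_pair A B \<omega>\<^sub>A M\<^sub>A "part_semigroup B" \<delta> U r\<^sub>0 C\<^sub>0 \<alpha>
  proof unfold_locales
    fix \<mu> \<nu> x assume "r\<^sub>0 \<le> \<mu>" "r\<^sub>0 \<le> \<nu>"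
    then show "hA.R \<mu> (hB.R \<nu> x) = hB.R \<nu> (hA.R \<mu> x)"
      using assms(3) hA.res hB.res r0 unfolding resolvent_commuting_def hA.R_def hB.R_def by simp
  qed (rule r0)
  obtain \<delta>P UP where P: "analytic_sg X0 (\<lambda>t x. part_semigroup A t (part_semigroup B t x)) \<delta>P UP"
    using analytic_semigroup_imp_analytic_sg[OF X0] assms(13) unfolding X0_def by blast
  obtain \<mu> where \<mu>: "\<mu> > \<omega>\<^sub>A" and
    cont: "\<And>f. Lp_loc p f \<Longrightarrow> continuous_on {0..} (diamond (integrated_semigroup A \<mu>) f)" and
    est: "\<And>f t. Lp_loc p f \<Longrightarrow> 0 \<le> t \<Longrightarrow> norm (diamond (integrated_semigroup A \<mu>) f t) \<le>
             M\<^sub>A * (integral {0..t} (\<lambda>s. exp (p * \<omega>\<^sub>A * (t - s)) * norm (f s) powr p)) powr (1 / p)"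
    using assms(7) unfolding Lp_convolution_estimate_def Let_def by blast
  obtain d where d: "\<And>r. r \<ge> d \<Longrightarrow> closure (Range (shifted (complex_of_real r) (op_sum A B))) = UNIV"
    using assms(12) by blast
  \<comment> \<open>Moves the conjugate exponent into the reals, including q' = \<infinity>; the
    condition on \<gamma> then becomes \<gamma> + (1 - \<alpha>) < 1 / p.\<close>
  have q': "1 / q' = ereal (1 - \<alpha>)"
  proof -
    have e: "1 / ereal p' = ereal \<alpha>" using assms(5) by (simp add: \<alpha>_def one_ereal_def)
    have "ereal \<alpha> + 1 / q' = 1" using assms(11) unfolding e .
    then show ?thesis by (cases "1 / q'") (auto simp: one_ereal_def)
  qed
  have "analytic_resolvent_condition C \<gamma> \<and> almost_sectorial \<gamma> C"
    if \<gamma>: "0 < \<gamma>" "ereal \<gamma> < 1 / ereal p - 1 / q'" for \<gamma>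
  proof -
    have "1 / ereal p = ereal (1 / p)" using assms(4) by (simp add: one_ereal_def)
    then have "\<gamma> + (1 - \<alpha>) < 1 / p" using \<gamma>(2) unfolding q' by simp
    from apriori[OF \<mu> assms(4) \<gamma>(1) this \<alpha>(2) cont est]
    obtain K r\<^sub>1 where K: "K \<ge> 0" "r\<^sub>1 \<ge> r\<^sub>0" and
      ap: "\<And>r u a b. r \<ge> r\<^sub>1 \<Longrightarrow> (u, a) \<in> A \<Longrightarrow> (u, b) \<in> B \<Longrightarrow> norm u \<le> K * r powr (- \<gamma>) * norm (r *\<^sub>R u - a - b)"
      by blast
    have r2: "r\<^sub>0 \<le> max r\<^sub>1 d" using K by simp
    have ap': "norm u \<le> K * r powr (- \<gamma>) * norm (r *\<^sub>R u - a - b)" if "max r\<^sub>1 d \<le> r" "(u, a) \<in> A" "(u, b) \<in> B" for r u a b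
      using ap that by simp
    have d': "closure (Range (shifted (complex_of_real r) (op_sum A B))) = UNIV" if "max r\<^sub>1 d \<le> r" for r
      using d that by simp
    show ?thesis
      using closure_analytic_resolvent_condition[OF r2 \<gamma>(1) K(1) ap' d' \<alpha>(1) P]
        closure_almost_sectorial[OF r2 \<gamma>(1) K(1) ap' d' \<alpha>(1) P] assms(13) by (simp add: X0_def)
  qed
  then show ?thesis using sum_closable by (simp add: op_closure_sum)
qed

end
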